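(* Let $m_1,m_2\in\mathbb{N}$ and let $\varphi(z)$ be a strictly proper rational $m_2\times m_1$ matrix function which is non-expansive on $\mathbb{R}$ and has no poles in $\mathbb{C}_+$. Assume that $$\varphi(z)=C(zI_n-\mathcal{A})^{-1}B$$ is a minimal realization of $\varphi$ and that $X>0$ is a solution of the Riccati equation $$XC^*CX+\mathrm{i}(X\mathcal{A}^*-\mathcal{A}X)+BB^*=0 .$$ Put $$\alpha=\mathcal{A}+\mathrm{i}BB^*X^{-1},\qquad \Sigma_0=X,\qquad \vartheta_1=B,\qquad \vartheta_2=-\mathrm{i}XC^*,$$ and, for $x\ge0$, $$\Lambda(x)=\begin{bmatrix}\mathrm{e}^{-\mathrm{i}x\alpha}\vartheta_1&\mathrm{e}^{\mathrm{i}x\alpha}\vartheta_2\end{bmatrix},\qquad \Sigma(x)=\Sigma_0+\int_0^x\Lambda(t)\Lambda(t)^*dt,$$ $$v(x)=-2\mathrm{i}\,\vartheta_1^*\,\mathrm{e}^{\mathrm{i}x\alpha^*}\Sigma(x)^{-1}\mathrm{e}^{\mathrm{i}x\alpha}\vartheta_2 .$$ Then $\varphi(z)$ is the Weyl function of the Dirac system $$\frac{d}{dx}y(x,z)=\mathrm{i}\,(zj+jV(x))\,y(x,z)\quad (x\ge 0),\qquad j=\begin{bmatrix} I_{m_1}&0\\ 0&-I_{m_2}\end{bmatrix},\quad V=\begin{bmatrix}0&v\\ v^*&0\end{bmatrix},$$ with this potential $v$. Moreover, this solution of the inverse problem is unique in the class of Dirac systems with locally bounded potentials: any Dirac system of this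 form on $[0,\infty)$ with a measurable $m_1\times m_2$ potential that is bounded on every finite interval and whose Weyl function is $\varphi$ has potential equal to $v$ (almost everywhere).
   Context: $\mathbb{C}_+$ is the open upper half-plane, $m:=m_1+m_2$. A rational matrix function $\varphi$ is strictly proper if $\lim_{z\to\infty}\varphi(z)=0$. Non-expansive on $\mathbb{R}$ means $\varphi(z)^*\varphi(z)\le I_{m_1}$ for $z\in\mathbb{R}$. A strictly proper rational $\varphi$ admits realizations $\varphi(z)=C_N(zI_N-\mathcal{A}_N)^{-1}B_N$ with matrices $C_N$, $\mathcal{A}_N$, $B_N$ of sizes $m_2\times N$, $N\times N$, $N\times m_1$, $N\in\mathbb{N}$; the minimal possible $N$ is the McMillan degree of $\varphi$, denoted $n$, and realizations with $N=n$ are called minimal. For a Dirac system $\frac{d}{dx}y(x,z)=\mathrm{i}\,(zj+jV(x))\,y(x,z)$ ($x\ge 0$), where $j=\begin{bmatrix} I_{m_1}&0\\ 0&-I_{m_2}\end{bmatrix}$ and $V=\begin{bmatrix}0&v\\ v^*&0\end{bmatrix}$, with measurable, locally summable (integrable on finite intervals) $m_1\times m_2$ potential $v$, let $u(x,z)$ denote the fundamental ($m\times m$) solution normalized by $u(0,z)=I_m$. An $m\times m_1$ matrix function $\mathcal{P}(z)$, meromorphic in $\mathbb{C}_+$, is called nonsingular with property-$j$ if, for all $z\in\mathbb{C}_+$ excluding possibly a discrete set of points, $\mathcal{P}(z)^*\mathcal{P}(z)>0$ and $\mathcal{P}(z)^*j\mathcal{P}(z)\ge 0$. For $x\ge0$,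 $z\in\mathbb{C}_+$, $\mathcal{N}(x,z)$ is the set of values at $x,z$ of the matrix functions $$\varphi(x,z,\mathcal{P})=\begin{bmatrix}0&I_{m_2}\end{bmatrix}u(x,z)^{-1}\mathcal{P}(z)\Big(\begin{bmatrix}I_{m_1}&0\end{bmatrix}u(x,z)^{-1}\mathcal{P}(z)\Big)^{-1},$$ where $\mathcal{P}$ runs over the nonsingular matrix functions with property-$j$ (for given $z$, those $\mathcal{P}$ for which $z$ is not in the exceptional discrete set); the inverse always exists. The Weyl (Weyl-Titchmarsh) function of the Dirac system is the $m_2\times m_1$ matrix function on $\mathbb{C}_+$ whose value at $z$ is the unique element of $\bigcap_{0\le x<\infty}\mathcal{N}(x,z)$; it is known that this intersection is always a single point and that the Weyl function is analytic and non-expansive in $\mathbb{C}_+$. *)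

theory Defs
  imports
    "HOL-Complex_Analysis.Complex_Analysis"
    "HOL-Computational_Algebra.Polynomial"
begin

unbundle no fps_syntax

text \<open>
  A \<open>p \<times> q\<close> complex matrix has type \<open>complex^'q^'p\<close>, with \<open>p = CARD('p)\<close> and \<open>q = CARD('q)\<close>; so
  all sizes are at least 1. Block matrices of size \<open>m = m\<^sub>1 + m\<^sub>2\<close> are indexed by the sum type
  \<open>'m1 + 'm2\<close>.
\<close>

section \<open>Complex matrices\<close>

definition cadjoint :: "complex^'q^'p \<Rightarrow> complex^'p^'q"  (\<open>_\<^sup>\<dagger>\<close> [1000] 999) where
  "A\<^sup>\<dagger> = (\<chi> i j. cnj (A $ j $ i))"

definition mat_scale :: "complex \<Rightarrow> complex^'q^'p \<Rightarrow> complex^'q^'p"  (infixr \<open>*\<^sub>m\<close> 75) where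
  "c *\<^sub>m A = (\<chi> i j. c * A $ i $ j)"

definition quad_form :: "complex^'p^'p \<Rightarrow> complex^'p \<Rightarrow> complex" where
  "quad_form A x = (\<Sum>i\<in>UNIV. cnj (x $ i) * (A *v x) $ i)"

definition pos_semidef :: "complex^'p^'p \<Rightarrow> bool" where
  "pos_semidef A \<longleftrightarrow> A\<^sup>\<dagger> = A \<and> (\<forall>x. 0 \<le> Re (quad_form A x))"

definition pos_def :: "complex^'p^'p \<Rightarrow> bool" where
  "pos_def A \<longleftrightarrow> A\<^sup>\<dagger> = A \<and> (\<forall>x. x \<noteq> 0 \<longrightarrow> 0 < Re (quad_form A x))"

definition mat_exp :: "complex^'p^'p \<Rightarrow> complex^'p^'p" where
  "mat_exp A = (\<Sum>k. (1 / fact k) *\<^sub>R (((\<lambda>M. A ** M) ^^ k) (mat 1)))"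

definition block_row ::
  "complex^'p^'k \<Rightarrow> complex^'q^'k \<Rightarrow> complex^('p::finite + 'q::finite)^'k" where
  "block_row P Q = (\<chi> i s. case s of Inl a \<Rightarrow> P $ i $ a | Inr b \<Rightarrow> Q $ i $ b)"

section \<open>Rational matrix functions and realizations\<close>

text \<open>
  A rational matrix function is represented by the function whose entries are the values of
  fractions in lowest terms. This excludes spurious values at removable singularities; at a pole
  of an entry the value of that entry is \<open>0\<close> because \<open>x / 0 = 0\<close>.
\<close>

definition rational_matrix_function :: "(complex \<Rightarrow> complex^'q^'p) \<Rightarrow> bool" where
  "rational_matrix_function \<phi> \<longleftrightarrow>
     (\<forall>i j. \<exists>p q :: complex poly. q \<noteq> 0 \<and> coprime p q \<and>
        (\<forall>z. \<phi> z $ i $ j = poly p z / poly q z))"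

definition strictly_proper :: "(complex \<Rightarrow> complex^'q^'p) \<Rightarrow> bool" where
  "strictly_proper \<phi> \<longleftrightarrow> (\<phi> \<longlongrightarrow> 0) at_infinity"

definition nonexpansive_on_reals :: "(complex \<Rightarrow> complex^'q^'p) \<Rightarrow> bool" where
  "nonexpansive_on_reals \<phi> \<longleftrightarrow> (\<forall>z\<in>\<real>. pos_semidef (mat 1 - (\<phi> z)\<^sup>\<dagger> ** \<phi> z))"

definition upper_half_plane :: "complex set"  (\<open>\<complex>\<^sub>+\<close>) where
  "\<complex>\<^sub>+ = {z. 0 < Im z}"

definition no_poles_in_upper_half_plane :: "(complex \<Rightarrow> complex^'q^'p) \<Rightarrow> bool" where
  "no_poles_in_upper_half_plane \<phi> \<longleftrightarrow> (\<forall>z\<in>\<complex>\<^sub>+. \<forall>i j. \<not> is_pole (\<lambda>w. \<phi> w $ i $ j) z)"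

definition realization ::
  "(complex \<Rightarrow> complex^'q^'p) \<Rightarrow> complex^'k^'p \<Rightarrow> complex^'k^'k \<Rightarrow> complex^'q^'k \<Rightarrow> bool" where
  "realization \<phi> C A B \<longleftrightarrow>
     (\<forall>z. invertible (mat z - A) \<longrightarrow> \<phi> z = C ** matrix_inv (mat z - A) ** B)"

text \<open>
  The McMillan degree quantifies over the size \<open>N\<close> of the state space, which therefore cannot be
  a type: the matrices of a realization of size \<open>N\<close> are given here by their entries with indices
  below \<open>N\<close>, and \<open>R\<close> is the inverse of \<open>z I - A\<close>. Lemma \<open>has_realization_of_size_CARD\<close> below
  shows that this is the same notion as \<^const>\<open>realization\<close>.
\<close>

definition has_realization_of_size :: "(complex \<Rightarrow> complex^'q^'p) \<Rightarrow> nat \<Rightarrow> bool" where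
  "has_realization_of_size \<phi> N \<longleftrightarrow>
     (\<exists>(C :: 'p \<Rightarrow> nat \<Rightarrow> complex) (A :: nat \<Rightarrow> nat \<Rightarrow> complex) (B :: nat \<Rightarrow> 'q \<Rightarrow> complex).
        \<forall>z R. (\<forall>i<N. \<forall>j<N. (\<Sum>k<N. ((if i = k then z else 0) - A i k) * R k j)
                               = (if i = j then 1 else 0)) \<longrightarrow>
              (\<forall>a b. \<phi> z $ a $ b = (\<Sum>i<N. \<Sum>j<N. C a i * R i j * B j b)))"

definition mcmillan_degree :: "(complex \<Rightarrow> complex^'q^'p) \<Rightarrow> nat" where
  "mcmillan_degree \<phi> = (LEAST N. 1 \<le> N \<and> has_realization_of_size \<phi> N)"

definition minimal_realization ::
  "(complex \<Rightarrow> complex^'q^'p) \<Rightarrow> complex^'k^'p \<Rightarrow> complex^'k^'k \<Rightarrow> complex^'q^'k \<Rightarrow> bool" where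
  "minimal_realization \<phi> C A B \<longleftrightarrow> realization \<phi> C A B \<and> CARD('k) = mcmillan_degree \<phi>"

lemma has_realization_of_size_CARD:
  fixes \<phi> :: "complex \<Rightarrow> complex^'q^'p"
  shows "has_realization_of_size \<phi> CARD('k::finite) \<longleftrightarrow>
    (\<exists>(C :: complex^'k^'p) A B. realization \<phi> C A B)"
proof -
  obtain f :: "nat \<Rightarrow> 'k" where f: "bij_betw f {..<CARD('k)} UNIV"
    using ex_bij_betw_nat_finite[of "UNIV :: 'k set"] by (auto simp: atLeast0LessThan)
  define g where "g = inv_into {..<CARD('k)} f"
  have gf: "g (f i) = i" if "i < CARD('k)" for i
    using f that by (simp add: g_def bij_betw_def)
  have fg: "f (g a) = a" and gl: "g a < CARD('k)" for a
    using f bij_betw_inv_into_right[OF f, of a] bij_betw_apply[OF bij_betw_inv_into[OF f], of a]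
    by (auto simp: g_def)
  have sumf: "(\<Sum>k<CARD('k). h k) = (\<Sum>a\<in>UNIV. h (g a))" for h :: "nat \<Rightarrow> complex"
    by (rule sum.reindex_bij_witness[of _ g f]) (auto simp: fg gf gl)
  have inv_iff: "M ** R = mat 1 \<longleftrightarrow> invertible M \<and> R = matrix_inv M" for M R :: "complex^'k^'k"
  proof
    assume MR: "M ** R = mat 1"
    then have RM: "R ** M = mat 1" by (simp add: matrix_left_right_inverse)
    then have M: "invertible M" using MR invertible_def by blast
    then have "M ** matrix_inv M = mat 1"
      unfolding matrix_inv_def invertible_def by (rule someI2_ex) simp
    then have "R = matrix_inv M"
      by (metis RM matrix_mul_assoc matrix_mul_lid matrix_mul_rid)
    with M show "invertible M \<and> R = matrix_inv M" ..
  next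
    assume "invertible M \<and> R = matrix_inv M"
    then have M: "\<exists>N. M ** N = mat 1 \<and> N ** M = mat 1" and R: "R = matrix_inv M"
      by (auto simp: invertible_def)
    from M show "M ** R = mat 1"
      unfolding R matrix_inv_def by (rule someI2_ex) simp
  qed
  have matmul: "(C ** R ** B) $ a $ b = (\<Sum>i\<in>UNIV. \<Sum>j\<in>UNIV. C $ a $ i * R $ i $ j * B $ j $ b)"
    for C :: "complex^'k^'p" and R :: "complex^'k^'k" and B :: "complex^'q^'k" and a b
    unfolding matrix_matrix_mult_def
    by (simp add: sum_distrib_right) (rule sum.swap)
  show ?thesis
  proof
    assume "has_realization_of_size \<phi> CARD('k)"
    then obtain C A B where *: "\<forall>z R.
        (\<forall>i<CARD('k). \<forall>j<CARD('k). (\<Sum>k<CARD('k). ((if i = k then z else 0) - A i k) * R k j)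
                               = (if i = j then 1 else 0)) \<longrightarrow>
        (\<forall>a b. \<phi> z $ a $ b = (\<Sum>i<CARD('k). \<Sum>j<CARD('k). C a i * R i j * B j b))"
      unfolding has_realization_of_size_def by (elim exE)
    define C' :: "complex^'k^'p" where "C' = (\<chi> a i. C a (g i))"
    define A' :: "complex^'k^'k" where "A' = (\<chi> i j. A (g i) (g j))"
    define B' :: "complex^'q^'k" where "B' = (\<chi> i b. B (g i) b)"
    have "\<phi> z = C' ** matrix_inv (mat z - A') ** B'" if z: "invertible (mat z - A')" for z
    proof -
      define R where "R = matrix_inv (mat z - A')"
      have R: "(mat z - A') ** R = mat 1"
        using z inv_iff R_def by blast
      have "\<phi> z $ a $ b = (\<Sum>i<CARD('k). \<Sum>j<CARD('k). C a i * R $ f i $ f j * B j b)" for a b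
      proof (rule *[THEN spec, THEN spec, THEN mp, THEN spec, THEN spec], intro allI impI)
        fix i j assume ij: "i < CARD('k)" "j < CARD('k)"
        have "((mat z - A') ** R) $ f i $ f j = (if f i = f j then 1 else 0)"
          by (simp only: R) (simp add: mat_def)
        then have "(\<Sum>a\<in>UNIV. ((if f i = a then z else 0) - A (g (f i)) (g a)) * R $ a $ f j)
            = (if f i = f j then 1 else 0)"
          by (simp add: matrix_matrix_mult_def mat_def A'_def)
        moreover have "f i = a \<longleftrightarrow> i = g a" for a using ij gf fg by metis
        moreover have "f i = f j \<longleftrightarrow> i = j" using ij gf by metis
        ultimately show "(\<Sum>k<CARD('k). ((if i = k then z else 0) - A i k) * R $ f k $ f j)
                               = (if i = j then 1 else 0)"
          by (simp add: sumf fg gf ij)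
      qed
      then show ?thesis
        by (simp add: vec_eq_iff matmul sumf fg R_def C'_def B'_def)
    qed
    then show "\<exists>(C :: complex^'k^'p) A B. realization \<phi> C A B"
      unfolding realization_def by blast
  next
    assume "\<exists>(C :: complex^'k^'p) A B. realization \<phi> C A B"
    then obtain C :: "complex^'k^'p" and A B where *:
      "\<And>z. invertible (mat z - A) \<Longrightarrow> \<phi> z = C ** matrix_inv (mat z - A) ** B"
      unfolding realization_def by blast
    have "\<phi> z $ a $ b =
        (\<Sum>i<CARD('k). \<Sum>j<CARD('k). C $ a $ f i * R i j * B $ f j $ b)"
      if R: "\<forall>i<CARD('k). \<forall>j<CARD('k).
          (\<Sum>k<CARD('k). ((if i = k then z else 0) - A $ f i $ f k) * R k j)
            = (if i = j then 1 else 0)" for z R a b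
    proof -
      define R' :: "complex^'k^'k" where "R' = (\<chi> i j. R (g i) (g j))"
      have "((mat z - A) ** R') $ i $ j = mat 1 $ i $ j" for i j
      proof -
        have "(\<Sum>a\<in>UNIV. ((if g i = g a then z else 0) - A $ i $ a) * R (g a) (g j))
            = (if g i = g j then 1 else 0)"
          using R[rule_format, OF gl gl, of i j] by (simp add: sumf fg)
        moreover have "g i = g a \<longleftrightarrow> i = a" for i a using fg by metis
        ultimately show ?thesis
          by (simp add: matrix_matrix_mult_def mat_def R'_def)
      qed
      then have "(mat z - A) ** R' = mat 1" by (simp add: vec_eq_iff)
      then have "\<phi> z = C ** R' ** B" using * inv_iff by metis
      then show ?thesis by (simp add: matmul sumf fg R'_def)
    qed
    then show "has_realization_of_size \<phi> CARD('k)"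
      unfolding has_realization_of_size_def
      by (intro exI[of _ "\<lambda>a i. C $ a $ f i"] exI[of _ "\<lambda>i j. A $ f i $ f j"]
          exI[of _ "\<lambda>i b. B $ f i $ b"]) blast
  qed
qed

section \<open>Dirac systems and Weyl functions\<close>

definition dirac_j :: "complex^('m1::finite + 'm2::finite)^('m1 + 'm2)" where
  "dirac_j = (\<chi> r s. if r = s then (case r of Inl _ \<Rightarrow> 1 | Inr _ \<Rightarrow> -1) else 0)"

definition dirac_V :: "complex^'m2^'m1 \<Rightarrow> complex^('m1::finite + 'm2::finite)^('m1 + 'm2)" where
  "dirac_V v = (\<chi> r s. case (r, s) of
      (Inl a, Inr b) \<Rightarrow> v $ a $ b
    | (Inr b, Inl a) \<Rightarrow> v\<^sup>\<dagger> $ b $ a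
    | _ \<Rightarrow> 0)"

definition locally_summable :: "(real \<Rightarrow> complex^'m2^'m1) \<Rightarrow> bool" where
  "locally_summable v \<longleftrightarrow> (\<forall>r\<ge>0. v absolutely_integrable_on {0..r})"

definition measurable_locally_bounded :: "(real \<Rightarrow> complex^'m2^'m1) \<Rightarrow> bool" where
  "measurable_locally_bounded v \<longleftrightarrow>
     v \<in> borel_measurable (lebesgue_on {0..}) \<and> (\<forall>r\<ge>0. bounded (v ` {0..r}))"

definition dirac_rhs ::
  "(real \<Rightarrow> complex^'m2^'m1) \<Rightarrow> complex \<Rightarrow> real \<Rightarrow> complex^('m1::finite + 'm2::finite)^('m1 + 'm2)" where
  "dirac_rhs v z x = \<i> *\<^sub>m (z *\<^sub>m dirac_j + dirac_j ** dirac_V (v x))"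

text \<open>
  For a locally summable potential, solutions of the system are understood in the sense of
  Caratheodory: absolutely continuous in \<open>x\<close>, with the equation holding almost everywhere. This is
  the integrated form of the initial value problem \<open>u' = \<i> (z j + j V) u\<close>, \<open>u(0, z) = I\<close>.
\<close>

definition fundamental_solution ::
  "(real \<Rightarrow> complex^'m2^'m1) \<Rightarrow> (real \<Rightarrow> complex \<Rightarrow> complex^('m1::finite + 'm2::finite)^('m1 + 'm2)) \<Rightarrow> bool" where
  "fundamental_solution v u \<longleftrightarrow>
     (\<forall>z. \<forall>x\<ge>0. (\<lambda>t. dirac_rhs v z t ** u t z) absolutely_integrable_on {0..x} \<and>
        u x z = mat 1 + integral {0..x} (\<lambda>t. dirac_rhs v z t ** u t z))"

text \<open>
  \<open>\<P>\<close> is nonsingular with property-\<open>j\<close>, with exceptional set \<open>D\<close>. The set \<open>D\<close> contains the points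
  of \<open>\<complex>\<^sub>+\<close> at which \<open>\<P>\<close> is not analytic, since a meromorphic function has no meaningful value there.
\<close>

definition nonsingular_property_j ::
  "complex set \<Rightarrow> (complex \<Rightarrow> complex^'m1^('m1::finite + 'm2::finite)) \<Rightarrow> bool" where
  "nonsingular_property_j D \<P> \<longleftrightarrow>
     (\<forall>i k. (\<lambda>z. \<P> z $ i $ k) meromorphic_on \<complex>\<^sub>+) \<and>
     D sparse_in \<complex>\<^sub>+ \<and>
     (\<forall>z\<in>\<complex>\<^sub>+ - D.
        (\<forall>i k. (\<lambda>w. \<P> w $ i $ k) analytic_on {z}) \<and>
        pos_def ((\<P> z)\<^sup>\<dagger> ** \<P> z) \<and>
        pos_semidef ((\<P> z)\<^sup>\<dagger> ** dirac_j ** \<P> z))"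

definition upper_row :: "complex^('m1::finite + 'm2::finite)^'m1" where
  "upper_row = block_row (mat 1) 0"

definition lower_row :: "complex^('m1::finite + 'm2::finite)^'m2" where
  "lower_row = block_row 0 (mat 1)"

definition moebius_value ::
  "complex^('m1::finite + 'm2::finite)^('m1 + 'm2) \<Rightarrow> complex^'m1^('m1 + 'm2) \<Rightarrow> complex^'m1^'m2" where
  "moebius_value U P =
     lower_row ** matrix_inv U ** P ** matrix_inv (upper_row ** matrix_inv U ** P)"

definition weyl_set ::
  "(real \<Rightarrow> complex \<Rightarrow> complex^('m1::finite + 'm2::finite)^('m1 + 'm2)) \<Rightarrow> real \<Rightarrow> complex
     \<Rightarrow> (complex^'m1^'m2) set" where
  "weyl_set u x z = {moebius_value (u x z) (\<P> z) | D \<P>. nonsingular_property_j D \<P> \<and> z \<notin> D}"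

text \<open>
  For a locally summable potential the fundamental solution exists and is unique on \<open>[0, \<infinity>)\<close>, so
  \<open>\<exists>u\<close> just names it.
\<close>

definition weyl_function ::
  "(real \<Rightarrow> complex^'m2^'m1) \<Rightarrow> (complex \<Rightarrow> complex^'m1^'m2) \<Rightarrow> bool" where
  "weyl_function v \<phi> \<longleftrightarrow> locally_summable v \<and>
     (\<exists>u. fundamental_solution v u \<and> (\<forall>z\<in>\<complex>\<^sub>+. (\<Inter>x\<in>{0..}. weyl_set u x z) = {\<phi> z}))"

end

theory Submission
  imports Defs
begin

text \<open>
  Uniqueness: let two locally bounded potentials have the same Weyl function \<open>\<phi>\<close>, with fundamental
  solutions \<open>u\<^sub>1\<close>, \<open>u\<^sub>2\<close>. For fixed \<open>x\<close> the matrix \<open>T = u\<^sub>2 u\<^sub>1\<^sup>-\<^sup>1\<close> is entire in \<open>z\<close>. For \<open>z\<close> in the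
  upper half-plane the solutions starting in the graph of \<open>\<phi>(z)\<close> decay like \<open>exp (- x Im z)\<close> and all
  other solutions grow at most like \<open>exp (x Im z)\<close>; these factors cancel in \<open>T\<close>, and likewise in the
  lower half-plane. So \<open>T\<close> is bounded, by Liouville it does not depend on \<open>z\<close>, and comparing the
  differential equations of \<open>T\<close> for different \<open>z\<close> shows first that \<open>T\<close> commutes with \<open>j\<close>, then that
  \<open>T\<close> is the identity, and hence that the potentials agree.

  Existence: put \<open>q\<^sub>0 = (\<A> - z)\<^sup>-\<^sup>1 B g\<close>, \<open>k = g + \<i> B\<^sup>* X\<^sup>-\<^sup>1 q\<^sub>0\<close> and \<open>s(x) = \<Sigma>(x)\<^sup>-\<^sup>1 exp (- \<i> x \<alpha>) q\<^sub>0\<close>.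
  The function \<open>y(x) = exp (\<i> x z) ([k; 0] - \<i> j \<Lambda>(x)\<^sup>* s(x))\<close> solves the system, starts at
  \<open>[g; \<phi>(z) g]\<close>, and satisfies
  \<open>y\<^sup>* j y = exp (- 2 x Im z) (|k|\<^sup>2 + 2 Im z s\<^sup>* \<Sigma> s) \<ge> 0\<close>. Hence \<open>\<phi>(z)\<close> lies in all Weyl sets.
\<close>

section \<open>Complex matrices and vectors\<close>

text \<open>Potentials are merely measurable and bounded on finite intervals, so solutions need not
  be differentiable at every point. All calculus is therefore done with pairs of a locally Lipschitz
  function and its bounded integrand (\<open>prim\<close>).

  The main tool is the form of j evaluated on two solutions with different spectral parameters: it
  yields the energy balance, the inverse of u and the analyticity in z.

  The cancellation in T needs exact exponents: with M bounding the potentials, the rates are |Im z|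
  + M for growth and M - Im z for decay, so that only exp (2 M x) survives. The real axis is reached
  by continuity.

  For existence, \<alpha> is the shift of A that turns the Riccati equation into \<alpha> X - X
  \<alpha>\<dagger> = \<i> (B B\<dagger> - X C\<dagger> C X), an identity that propagates from X to
  \<Sigma>(x). The vector k absorbs the shift: (A - z) q = B g becomes (\<alpha> - z) q = B
  k.\<close>

definition cip :: "complex^'n \<Rightarrow> complex^'n \<Rightarrow> complex" where
  "cip x y = (\<Sum>i\<in>UNIV. cnj (x $ i) * y $ i)"

lemma Re_cip: "Re (cip x y) = x \<bullet> y"
  by (simp add: cip_def inner_vec_def inner_complex_def)

lemma cip_cnj: "cnj (cip x y) = cip y x"
  by (simp add: cip_def mult.commute)

lemma cip_self: "cip x x = of_real ((norm x)\<^sup>2)"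
proof (rule complex_eqI)
  show "Re (cip x x) = Re (of_real ((norm x)\<^sup>2))"
    by (simp add: Re_cip power2_norm_eq_inner)
  have "cnj (cip x x) = cip x x" by (rule cip_cnj)
  then show "Im (cip x x) = Im (of_real ((norm x)\<^sup>2))"
    by (metis Im_complex_of_real Reals_cnj_iff complex_is_Real_iff)
qed

lemma norm_cip_self: "norm (cip x x) = norm x * norm x"
  by (simp only: cip_self norm_of_real) (simp add: power2_eq_square)

lemma cip_add_left: "cip (x + y) w = cip x w + cip y w"
  and cip_add_right: "cip w (x + y) = cip w x + cip w y"
  and cip_diff_left: "cip (x - y) w = cip x w - cip y w"
  and cip_diff_right: "cip w (x - y) = cip w x - cip w y"
  and cip_minus_left: "cip (- x) w = - cip x w"
  and cip_minus_right: "cip w (- x) = - cip w x"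
  by (simp_all add: cip_def algebra_simps sum.distrib sum_subtractf sum_negf)

lemma cip_scale_left: "cip (c *s x) y = cnj c * cip x y"
  and cip_scale_right: "cip x (c *s y) = c * cip x y"
  by (simp_all add: cip_def sum_distrib_left mult.assoc mult.left_commute)

lemma cip_zero [simp]: "cip 0 y = 0" "cip x 0 = 0"
  by (simp_all add: cip_def)

lemmas cip_simps = cip_add_left cip_add_right cip_diff_left cip_diff_right cip_minus_left
  cip_minus_right cip_scale_left cip_scale_right

lemma norm_cip_le: "norm (cip x y) \<le> norm x * norm y"
proof -
  have "norm (cip x y) \<le> (\<Sum>i\<in>UNIV. \<bar>norm (x $ i)\<bar> * \<bar>norm (y $ i)\<bar>)"
    unfolding cip_def by (rule sum_norm_le) (simp add: norm_mult)
  also have "\<dots> \<le> norm x * norm y"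
    unfolding norm_vec_def by (rule L2_set_mult_ineq)
  finally show ?thesis .
qed

lemma bounded_bilinear_cip: "bounded_bilinear cip"
proof
  fix x x' y y' :: "complex^'n" and r :: real
  show "cip (x + x') y = cip x y + cip x' y" by (rule cip_add_left)
  show "cip x (y + y') = cip x y + cip x y'" by (rule cip_add_right)
  show "cip (r *\<^sub>R x) y = r *\<^sub>R cip x y"
    by (simp add: cip_def scaleR_sum_right)
  show "cip x (r *\<^sub>R y) = r *\<^sub>R cip x y"
    by (simp add: cip_def scaleR_sum_right)
  show "\<exists>K. \<forall>x y :: complex^'n. norm (cip x y) \<le> norm x * norm y * K"
    by (intro exI[of _ 1]) (simp add: norm_cip_le)
qed

lemma cip_adjoint: "cip (M\<^sup>\<dagger> *v x) y = cip x (M *v y)"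
proof -
  have "cip (M\<^sup>\<dagger> *v x) y = (\<Sum>i\<in>UNIV. \<Sum>j\<in>UNIV. M $ j $ i * cnj (x $ j) * y $ i)"
    by (simp add: cip_def matrix_vector_mult_def cadjoint_def sum_distrib_right)
  also have "\<dots> = (\<Sum>j\<in>UNIV. \<Sum>i\<in>UNIV. M $ j $ i * cnj (x $ j) * y $ i)"
    by (rule sum.swap)
  also have "\<dots> = cip x (M *v y)"
    by (simp add: cip_def matrix_vector_mult_def sum_distrib_left mult_ac)
  finally show ?thesis .
qed

lemma cadjoint_cadjoint [simp]: "(M\<^sup>\<dagger>)\<^sup>\<dagger> = M"
  by (simp add: cadjoint_def vec_eq_iff)

lemma cip_adjoint': "cip x (M\<^sup>\<dagger> *v y) = cip (M *v x) y"
  using cip_adjoint[of "M\<^sup>\<dagger>" x y] by simp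

lemma cadjoint_mult: "(M ** N)\<^sup>\<dagger> = N\<^sup>\<dagger> ** M\<^sup>\<dagger>"
  by (simp add: cadjoint_def vec_eq_iff matrix_matrix_mult_def mult.commute)

lemma cadjoint_add: "(M + N)\<^sup>\<dagger> = M\<^sup>\<dagger> + N\<^sup>\<dagger>"
  and cadjoint_scale: "(c *\<^sub>m M)\<^sup>\<dagger> = cnj c *\<^sub>m M\<^sup>\<dagger>"
  and cadjoint_mat: "(mat c)\<^sup>\<dagger> = mat (cnj c)"
  by (auto simp: cadjoint_def mat_scale_def mat_def vec_eq_iff)

lemma mat_scale_mult_left: "(c *\<^sub>m M) ** N = c *\<^sub>m (M ** N)"
  and mat_scale_mult_right: "M ** (c *\<^sub>m N) = c *\<^sub>m (M ** N)"
  by (simp_all add: mat_scale_def vec_eq_iff matrix_matrix_mult_def sum_distrib_left mult_ac)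

lemma mat_scale_vector: "(c *\<^sub>m M) *v x = c *s (M *v x)"
  by (simp add: mat_scale_def vec_eq_iff matrix_vector_mult_def sum_distrib_left mult_ac)

lemma mat_scale_component [simp]: "(c *\<^sub>m M) $ i $ k = c * M $ i $ k"
  by (simp add: mat_scale_def)

lemma mat_scale_add: "c *\<^sub>m (M + N) = c *\<^sub>m M + c *\<^sub>m N"
  by (simp add: vec_eq_iff distrib_left)

lemma mat_vector: "(mat c) *v x = c *s (x :: complex^'n)"
  by (simp add: vec_eq_iff matrix_vector_mult_def mat_def if_distrib[of "\<lambda>x. x * _"] cong: if_cong)

lemma vector_minus_mult: "M *v (- x) = - (M *v (x :: complex^'n))"
  by (simp add: vec_eq_iff matrix_vector_mult_def sum_negf)

lemma mat_minus_vector: "(- M) *v x = - (M *v (x :: complex^'n))"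
  by (simp add: vec_eq_iff matrix_vector_mult_def sum_negf)

lemma cvector_scaleR: "M *v (r *\<^sub>R x) = r *\<^sub>R (M *v (x :: complex^'n))"
  by (simp add: vec_eq_iff matrix_vector_mult_def scaleR_sum_right)

lemma scaleR_cvector: "(r *\<^sub>R M) *v x = r *\<^sub>R (M *v (x :: complex^'n))"
  by (simp add: vec_eq_iff matrix_vector_mult_def scaleR_sum_right)

lemma norm_scale_vector: "norm (c *s (x :: complex^'n)) = norm c * norm x"
proof -
  have "norm (c *s x) = L2_set (\<lambda>i. norm c * norm (x $ i)) UNIV"
    by (simp add: norm_vec_def norm_mult)
  also have "\<dots> = norm c * norm x"
    unfolding norm_vec_def by (rule L2_set_right_distrib[symmetric]) simp
  finally show ?thesis .
qed

lemma inner_scale_self: "x \<bullet> (c *s (x :: complex^'n)) = Re c * (norm x)\<^sup>2"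
  by (simp flip: Re_cip add: cip_scale_right cip_self)

lemma norm_matrix_vector_le: "norm (M *v (x :: complex^'n)) \<le> norm M * norm x"
proof -
  have "norm ((M *v x) $ i) \<le> norm (M $ i) * norm x" for i
  proof -
    have "norm ((M *v x) $ i) \<le> (\<Sum>k\<in>UNIV. \<bar>norm (M $ i $ k)\<bar> * \<bar>norm (x $ k)\<bar>)"
      unfolding matrix_vector_mult_def by simp (rule sum_norm_le, simp add: norm_mult)
    also have "\<dots> \<le> norm (M $ i) * norm x"
      unfolding norm_vec_def by (rule L2_set_mult_ineq)
    finally show ?thesis .
  qed
  then have "norm (M *v x) \<le> L2_set (\<lambda>i. norm (M $ i) * norm x) UNIV"
    unfolding norm_vec_def[of "M *v x"] by (intro L2_set_mono) auto
  also have "\<dots> = norm M * norm x"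
    unfolding norm_vec_def[of M] by (rule L2_set_left_distrib[symmetric]) simp
  finally show ?thesis .
qed

lemma norm_cadjoint: "norm (M\<^sup>\<dagger>) = norm M"
proof -
  have "(norm (M\<^sup>\<dagger>))\<^sup>2 = (\<Sum>i\<in>UNIV. \<Sum>j\<in>UNIV. (norm (M $ j $ i))\<^sup>2)"
    by (simp add: norm_vec_def L2_set_def sum_nonneg cadjoint_def)
  also have "\<dots> = (\<Sum>j\<in>UNIV. \<Sum>i\<in>UNIV. (norm (M $ j $ i))\<^sup>2)"
    by (rule sum.swap)
  also have "\<dots> = (norm M)\<^sup>2"
    by (simp add: norm_vec_def L2_set_def sum_nonneg)
  finally show ?thesis by simp
qed

text \<open>Row i of the product is, up to conjugation, the adjoint of N applied to the conjugated
  row i of M. So the vector estimate can be applied row by row.\<close>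

lemma norm_matrix_mult_le: "norm (M ** (N :: complex^'k^'n)) \<le> norm M * norm N"
proof -
  have row: "(M ** N) $ i = (\<chi> k. cnj ((N\<^sup>\<dagger> *v (\<chi> l. cnj (M $ i $ l))) $ k))" for i
    by (simp add: vec_eq_iff matrix_matrix_mult_def matrix_vector_mult_def cadjoint_def mult.commute)
  have "norm ((M ** N) $ i) \<le> norm (M $ i) * norm N" for i
  proof -
    have "norm ((M ** N) $ i) = norm (N\<^sup>\<dagger> *v (\<chi> l. cnj (M $ i $ l)))"
      unfolding row by (simp add: norm_vec_def)
    also have "\<dots> \<le> norm (N\<^sup>\<dagger>) * norm (\<chi> l. cnj (M $ i $ l))"
      by (rule norm_matrix_vector_le)
    also have "norm (\<chi> l. cnj (M $ i $ l)) = norm (M $ i)"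
      by (simp add: norm_vec_def)
    finally show ?thesis by (simp add: norm_cadjoint mult.commute)
  qed
  then have "norm (M ** N) \<le> L2_set (\<lambda>i. norm (M $ i) * norm N) UNIV"
    unfolding norm_vec_def[of "M ** N"] by (intro L2_set_mono) auto
  also have "\<dots> = norm M * norm N"
    unfolding norm_vec_def[of M] by (rule L2_set_left_distrib[symmetric]) simp
  finally show ?thesis .
qed

lemma bounded_bilinear_matrix_vector:
  "bounded_bilinear ((*v) :: complex^'n^'m \<Rightarrow> complex^'n \<Rightarrow> complex^'m)"
proof
  show "\<exists>K. \<forall>M (x :: complex^'n). norm (M *v x :: complex^'m) \<le> norm M * norm x * K"
    by (intro exI[of _ 1]) (simp add: norm_matrix_vector_le)
qed (simp_all add: algebra_simps cvector_scaleR scaleR_cvector)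

lemma bounded_bilinear_matrix_matrix:
  "bounded_bilinear ((**) :: complex^'n^'m \<Rightarrow> complex^'k^'n \<Rightarrow> complex^'k^'m)"
proof
  show "\<exists>K. \<forall>M (N :: complex^'k^'n). norm (M ** N :: complex^'k^'m) \<le> norm M * norm N * K"
    by (intro exI[of _ 1]) (simp add: norm_matrix_mult_le)
qed (simp_all add: vec_eq_iff matrix_matrix_mult_def scaleR_sum_right
      algebra_simps sum.distrib)

lemma bounded_linear_cadjoint: "bounded_linear (cadjoint :: complex^'n^'m \<Rightarrow> _)"
  by (rule bounded_linear_intro[of _ 1])
    (simp_all add: cadjoint_add norm_cadjoint, simp add: cadjoint_def vec_eq_iff)

lemma bounded_linear_scale_vector: "bounded_linear ((*s) c :: complex^'n \<Rightarrow> _)"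
  by (rule bounded_linear_intro[of _ "norm c"])
    (simp_all add: vector_add_ldistrib norm_scale_vector mult.commute,
      simp add: vec_eq_iff scaleR_conv_of_real)

lemma bounded_bilinear_scale_vector: "bounded_bilinear ((*s) :: complex \<Rightarrow> complex^'n \<Rightarrow> _)"
proof
  show "\<exists>K. \<forall>c (x :: complex^'n). norm (c *s x) \<le> norm c * norm x * K"
    by (intro exI[of _ 1]) (simp add: norm_scale_vector)
qed (simp_all add: vec_eq_iff algebra_simps)

lemma norm_mat_scale: "norm (c *\<^sub>m M) = norm c * norm M"
proof -
  have "(c *\<^sub>m M) $ i = c *s (M $ i)" for i by (simp add: vec_eq_iff)
  then show ?thesis
    by (simp add: norm_vec_def[of "c *\<^sub>m M"] norm_vec_def[of M] norm_scale_vector L2_set_right_distrib)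
qed

lemma bounded_linear_mat_scale: "bounded_linear ((*\<^sub>m) c :: complex^'n^'m \<Rightarrow> _)"
  by (rule bounded_linear_intro[of _ "norm c"])
    (simp_all add: norm_mat_scale mult.commute,
      simp_all add: vec_eq_iff scaleR_conv_of_real algebra_simps)

lemma norm_entry_le: "norm (M $ i $ k) \<le> norm (M :: complex^'n^'m)"
  by (rule order_trans[OF Finite_Cartesian_Product.norm_nth_le Finite_Cartesian_Product.norm_nth_le])

lemma bounded_linear_entry: "bounded_linear (\<lambda>M :: complex^'n^'m. M $ i $ k)"
  by (rule bounded_linear_intro[of _ 1]) (simp_all add: norm_entry_le)

lemma quad_form_cip: "quad_form M x = cip x (M *v x)"
  by (simp add: quad_form_def cip_def)

lemma quad_form_gram: "quad_form (P\<^sup>\<dagger> ** P) x = of_real ((norm (P *v x))\<^sup>2)"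
  by (simp add: quad_form_cip cip_adjoint' cip_self flip: matrix_vector_mul_assoc)

lemma matrix_inv_left_right:
  fixes M :: "complex^'n^'n"
  assumes "invertible M"
  shows "M ** matrix_inv M = mat 1" "matrix_inv M ** M = mat 1"
proof -
  have "\<exists>N. M ** N = mat 1 \<and> N ** M = mat 1"
    using assms by (simp add: invertible_def)
  then have "M ** matrix_inv M = mat 1 \<and> matrix_inv M ** M = mat 1"
    unfolding matrix_inv_def by (rule someI_ex)
  then show "M ** matrix_inv M = mat 1" "matrix_inv M ** M = mat 1" by auto
qed

lemma invertible_if_injective:
  fixes M :: "complex^'n^'n"
  assumes "\<And>x. M *v x = 0 \<Longrightarrow> x = 0"
  shows "invertible M"
  using assms matrix_left_invertible_ker[of M] matrix_left_right_inverse invertible_def by metis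

lemma pos_def_invertible:
  assumes "pos_def X"
  shows "invertible X"
proof (rule invertible_if_injective, rule ccontr)
  fix w assume "X *v w = 0" "w \<noteq> 0"
  then show False using assms by (auto simp: pos_def_def quad_form_cip dest!: spec[of _ w])
qed

lemma matrix_inv_unique:
  fixes M :: "complex^'n^'n"
  assumes "N ** M = mat 1"
  shows "invertible M" "matrix_inv M = N"
proof -
  show inv: "invertible M"
    using assms matrix_left_right_inverse invertible_def by metis
  show "matrix_inv M = N"
    by (metis assms inv matrix_inv_left_right(1) matrix_mul_assoc matrix_mul_lid matrix_mul_rid)
qed

lemma matrix_eqI:
  fixes M N :: "complex^'n^'m"
  assumes "\<And>x. M *v x = N *v x"
  shows "M = N"
  using assms matrix_eq[of M N] by blast

lemma cip_eqI:
  assumes "\<And>x. cip x y = cip x w"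
  shows "y = w"
proof -
  have "cip (y - w) (y - w) = 0"
    using assms[of "y - w"] by (simp add: cip_diff_right)
  then show ?thesis by (simp add: cip_self)
qed

section \<open>Block vectors\<close>

definition up :: "complex^('m1::finite + 'm2::finite) \<Rightarrow> complex^'m1" where
  "up y = (\<chi> a. y $ Inl a)"

definition lo :: "complex^('m1::finite + 'm2::finite) \<Rightarrow> complex^'m2" where
  "lo y = (\<chi> b. y $ Inr b)"

definition stack :: "complex^'m1 \<Rightarrow> complex^'m2 \<Rightarrow> complex^('m1::finite + 'm2::finite)" where
  "stack p q = (\<chi> s. case s of Inl a \<Rightarrow> p $ a | Inr b \<Rightarrow> q $ b)"

lemma sum_UNIV_Plus:
  "(\<Sum>s\<in>(UNIV :: ('a::finite + 'b::finite) set). f s) = (\<Sum>a\<in>UNIV. f (Inl a)) + (\<Sum>b\<in>UNIV. f (Inr b))"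
  unfolding UNIV_Plus_UNIV[symmetric] by (subst sum.Plus) auto

lemma up_stack [simp]: "up (stack p q) = p" and lo_stack [simp]: "lo (stack p q) = q"
  by (simp_all add: up_def lo_def stack_def vec_eq_iff)

lemma stack_up_lo [simp]: "stack (up y) (lo y) = y"
  by (simp add: up_def lo_def stack_def vec_eq_iff split: sum.split)

lemma block_vector_eqI: "up y = up w \<Longrightarrow> lo y = lo w \<Longrightarrow> y = w"
  by (metis stack_up_lo)

lemma up_add: "up (y + w) = up y + up w" and lo_add: "lo (y + w) = lo y + lo w"
  and up_diff: "up (y - w) = up y - up w" and lo_diff: "lo (y - w) = lo y - lo w"
  and up_scale: "up (c *s y) = c *s up y" and lo_scale: "lo (c *s y) = c *s lo y"
  and up_zero [simp]: "up 0 = 0" and lo_zero [simp]: "lo 0 = 0"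
  by (simp_all add: up_def lo_def vec_eq_iff)

lemma stack_add: "stack (p + p') (q + q') = stack p q + stack p' q'"
  by (simp add: stack_def vec_eq_iff split: sum.split)

lemma cip_blocks: "cip y w = cip (up y) (up w) + cip (lo y) (lo w)"
  by (simp add: cip_def sum_UNIV_Plus up_def lo_def)

lemma inner_blocks: "y \<bullet> w = up y \<bullet> up w + lo y \<bullet> lo w"
  using arg_cong[OF cip_blocks[of y w], of Re] by (simp add: Re_cip)

lemma norm_blocks: "(norm y)\<^sup>2 = (norm (up y))\<^sup>2 + (norm (lo y))\<^sup>2"
  using arg_cong[OF cip_blocks[of y y], of Re] by (simp add: cip_self)

lemma norm_up_le: "norm (up y) \<le> norm y" and norm_lo_le: "norm (lo y) \<le> norm y"
  by (rule power2_le_imp_le; simp add: norm_blocks[of y])+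

lemma norm_le_blocks: "norm y \<le> norm (up y) + norm (lo y)"
  by (rule power2_le_imp_le) (simp_all add: norm_blocks[of y] power2_sum)

lemma bounded_linear_up: "bounded_linear up"
  by (rule bounded_linear_intro[of _ 1]) (simp_all add: up_add norm_up_le, simp add: up_def vec_eq_iff)

lemma bounded_linear_lo: "bounded_linear lo"
  by (rule bounded_linear_intro[of _ 1]) (simp_all add: lo_add norm_lo_le, simp add: lo_def vec_eq_iff)

lemma block_row_vector: "block_row P Q *v y = P *v up y + Q *v lo y"
  by (simp add: block_row_def matrix_vector_mult_def vec_eq_iff sum_UNIV_Plus up_def lo_def)

lemma cadjoint_block_row_gram: "block_row P Q ** (block_row P Q)\<^sup>\<dagger> = P ** P\<^sup>\<dagger> + Q ** Q\<^sup>\<dagger>"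
  by (simp add: vec_eq_iff matrix_matrix_mult_def cadjoint_def block_row_def sum_UNIV_Plus)

lemma upper_row_vector: "upper_row *v y = up y" and lower_row_vector: "lower_row *v y = lo y"
  by (simp_all add: upper_row_def lower_row_def block_row_vector)

lemma dirac_j_vector: "dirac_j *v y = stack (up y) (- lo y)"
  by (simp add: vec_eq_iff dirac_j_def matrix_vector_mult_def stack_def up_def lo_def
      if_distrib[of "\<lambda>x. x * _"] if_distribR cong: if_cong split: sum.split)

lemma dirac_V_vector: "dirac_V w *v y = stack (w *v lo y) (w\<^sup>\<dagger> *v up y)"
  by (simp add: vec_eq_iff dirac_V_def matrix_vector_mult_def stack_def up_def lo_def
      sum_UNIV_Plus split: sum.split)

lemma dirac_rhs_vector:
  "up (dirac_rhs w z t *v y) = (\<i> * z) *s up y + \<i> *s (w t *v lo y)"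
  "lo (dirac_rhs w z t *v y) = - (\<i> * z) *s lo y - \<i> *s ((w t)\<^sup>\<dagger> *v up y)"
  by (simp_all add: dirac_rhs_def mat_scale_vector matrix_vector_mult_add_rdistrib up_scale lo_scale
      up_add lo_add dirac_j_vector dirac_V_vector vector_add_ldistrib vector_smult_assoc
      vector_smult_rneg vector_smult_lneg flip: matrix_vector_mul_assoc)

text \<open>The indefinite form of j. Property-j of a matrix function means that this form is
  nonnegative on its range, that is, the lower block never exceeds the upper block in norm.\<close>

definition jform :: "complex^('m1::finite + 'm2::finite) \<Rightarrow> complex^('m1 + 'm2) \<Rightarrow> complex" where
  "jform y w = cip (up y) (up w) - cip (lo y) (lo w)"

lemma jform_dirac_j: "jform y w = cip y (dirac_j *v w)"
  by (simp add: jform_def cip_blocks dirac_j_vector cip_minus_right)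

lemma jform_self: "jform y y = of_real ((norm (up y))\<^sup>2 - (norm (lo y))\<^sup>2)"
  by (simp add: jform_def cip_self)

lemma dirac_j_dirac_j: "dirac_j ** dirac_j = mat 1"
  by (rule matrix_eqI) (simp add: dirac_j_vector flip: matrix_vector_mul_assoc)

lemma norm_dirac_j_vector: "norm (dirac_j *v y) = norm y"
  by (rule power2_eq_imp_eq) (simp_all add: norm_blocks dirac_j_vector)

lemma cadjoint_dirac_j: "dirac_j\<^sup>\<dagger> = dirac_j"
  by (auto simp: cadjoint_def dirac_j_def vec_eq_iff split: sum.split)

lemma norm_jform_le: "norm (jform y w) \<le> norm y * norm w"
  unfolding jform_dirac_j using norm_cip_le[of y "dirac_j *v w"] by (simp add: norm_dirac_j_vector)

section \<open>Locally Lipschitz primitives\<close>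

text \<open>Integrated form of F' = f on [0, \<infinity>). Boundedness of f on finite intervals is
  built in because it makes F locally Lipschitz, which is what the product rule below relies
  on.\<close>

definition prim :: "(real \<Rightarrow> 'a::euclidean_space) \<Rightarrow> (real \<Rightarrow> 'a) \<Rightarrow> bool" where
  "prim F f \<longleftrightarrow> (\<forall>x\<ge>0. f absolutely_integrable_on {0..x} \<and> bounded (f ` {0..x}) \<and>
     F x = F 0 + integral {0..x} f)"

lemma primD:
  assumes "prim F f" "0 \<le> x"
  shows "f absolutely_integrable_on {0..x}" "bounded (f ` {0..x})" "F x = F 0 + integral {0..x} f"
  using assms unfolding prim_def by blast+

lemma prim_continuous:
  assumes "prim F f"
  shows "continuous_on {0..X} F"
proof (cases "0 \<le> X")
  case True
  have "f integrable_on {0..X}"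
    using primD(1)[OF assms True] set_lebesgue_integral_eq_integral(1) by blast
  then have "continuous_on {0..X} (\<lambda>x. F 0 + integral {0..x} f)"
    by (intro continuous_intros indefinite_integral_continuous_1)
  then show ?thesis
    by (rule continuous_on_eq) (simp add: primD(3)[OF assms, symmetric])
qed auto

lemma prim_continuous_atLeast:
  assumes "prim F f"
  shows "continuous_on {0..} F"
  unfolding continuous_on_eq_continuous_within
proof
  fix x :: real assume "x \<in> {0..}"
  then have "at x within {0..} = at x within {0..x + 1}"
    by (intro at_within_nhd[of x "{..<x + 1}"]) auto
  then show "continuous (at x within {0..}) F"
    using prim_continuous[OF assms, of "x + 1"] \<open>x \<in> {0..}\<close>
    unfolding continuous_on_eq_continuous_within by (metis atLeastAtMost_iff atLeast_iff le_add_same_cancel1 zero_le_one)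
qed

lemma prim_bounded:
  assumes "prim F f"
  shows "bounded (F ` {0..X})"
  by (intro compact_imp_bounded compact_continuous_image prim_continuous[OF assms]) auto

lemma prim_integral:
  assumes "prim F f" "0 \<le> r" "r \<le> s"
  shows "f integrable_on {r..s}" "integral {r..s} f = F s - F r"
proof -
  have int: "f integrable_on {0..s}"
    using assms by (intro set_lebesgue_integral_eq_integral(1) primD(1)[OF assms(1)]) simp
  then show "f integrable_on {r..s}"
    by (rule integrable_on_subinterval) (use assms in auto)
  have "integral {0..r} f + integral {r..s} f = integral {0..s} f"
    using int assms by (intro Henstock_Kurzweil_Integration.integral_combine) auto
  then show "integral {r..s} f = F s - F r"
    using primD(3)[OF assms(1), of r] primD(3)[OF assms(1), of s] assms by (simp add: algebra_simps)
qed

lemma prim_lipschitz: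
  assumes "prim F f" "0 \<le> X"
  obtains K where "0 \<le> K" "\<And>t. t \<in> {0..X} \<Longrightarrow> norm (f t) \<le> K"
    "\<And>r s. 0 \<le> r \<Longrightarrow> r \<le> s \<Longrightarrow> s \<le> X \<Longrightarrow> norm (F s - F r) \<le> K * (s - r)"
proof -
  obtain K where K: "\<And>t. t \<in> {0..X} \<Longrightarrow> norm (f t) \<le> K"
    using primD(2)[OF assms] unfolding bounded_iff by blast
  have "0 \<le> K" using K[of 0] assms(2) by (meson atLeastAtMost_iff norm_ge_zero order_refl order_trans)
  moreover have "norm (F s - F r) \<le> K * (s - r)" if "0 \<le> r" "r \<le> s" "s \<le> X" for r s
  proof -
    have "(f has_integral (F s - F r)) {r..s}"
      using integrable_integral[OF prim_integral(1)[OF assms(1) that(1,2)]]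
      by (simp add: prim_integral(2)[OF assms(1) that(1,2)])
    from has_integral_bound_real[OF \<open>0 \<le> K\<close> finite.emptyI this] K that show ?thesis by auto
  qed
  ultimately show ?thesis using that K by blast
qed

lemma prim_bounded_linear:
  assumes "bounded_linear L" "prim F f"
  shows "prim (\<lambda>x. L (F x)) (\<lambda>x. L (f x))"
  unfolding prim_def
proof (intro allI impI conjI)
  fix x :: real assume x: "0 \<le> x"
  note p = primD[OF assms(2) x]
  show "(\<lambda>x. L (f x)) absolutely_integrable_on {0..x}"
    using absolutely_integrable_linear[OF p(1) assms(1)] by (simp add: o_def)
  show "bounded ((\<lambda>x. L (f x)) ` {0..x})"
    using bounded_linear_image[OF p(2) assms(1)] by (simp add: image_image)
  have "f integrable_on {0..x}" using p(1) set_lebesgue_integral_eq_integral(1) by blast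
  from integral_linear[OF this assms(1)] have "integral {0..x} (\<lambda>x. L (f x)) = L (integral {0..x} f)"
    by (simp add: o_def)
  then show "L (F x) = L (F 0) + integral {0..x} (\<lambda>x. L (f x))"
    using p(3) linear_add[OF bounded_linear.linear[OF assms(1)]] by metis
qed

lemma norm_integral_le:
  fixes f :: "real \<Rightarrow> 'a::euclidean_space"
  assumes "f integrable_on {a..b}" "a \<le> b" "0 \<le> K" "\<And>t. t \<in> {a..b} \<Longrightarrow> norm (f t) \<le> K"
  shows "norm (integral {a..b} f) \<le> K * (b - a)"
  using has_integral_bound_real[OF assms(3) finite.emptyI integrable_integral[OF assms(1)]] assms(2,4)
  by simp

lemma prim_add:
  assumes "prim F f" "prim G g"
  shows "prim (\<lambda>x. F x + G x) (\<lambda>x. f x + g x)"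
  unfolding prim_def
proof (intro allI impI conjI)
  fix x :: real assume x: "0 \<le> x"
  note p = primD[OF assms(1) x] primD[OF assms(2) x]
  show "(\<lambda>x. f x + g x) absolutely_integrable_on {0..x}"
    using p by (intro set_integral_add(1))
  show "bounded ((\<lambda>x. f x + g x) ` {0..x})"
    using p by (intro bounded_plus_comp)
  have "integral {0..x} (\<lambda>x. f x + g x) = integral {0..x} f + integral {0..x} g"
    using p(1,4) set_lebesgue_integral_eq_integral(1) by (intro integral_add) blast+
  then show "F x + G x = F 0 + G 0 + integral {0..x} (\<lambda>x. f x + g x)"
    using p(3,6) by (simp add: algebra_simps)
qed

lemma prim_diff:
  assumes "prim F f" "prim G g"
  shows "prim (\<lambda>x. F x - G x) (\<lambda>x. f x - g x)"
proof -
  have "prim (\<lambda>x. - G x) (\<lambda>x. - g x)"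
    by (rule prim_bounded_linear[OF _ assms(2)]) (rule bounded_linear_minus[OF bounded_linear_ident])
  from prim_add[OF assms(1) this] show ?thesis by simp
qed

lemma prim_cong:
  assumes "prim F f" "\<And>x. 0 \<le> x \<Longrightarrow> F x = G x" "\<And>x. 0 \<le> x \<Longrightarrow> f x = g x"
  shows "prim G g"
proof -
  have "f absolutely_integrable_on {0..x} \<longleftrightarrow> g absolutely_integrable_on {0..x}"
    "bounded (f ` {0..x}) \<longleftrightarrow> bounded (g ` {0..x})" "integral {0..x} f = integral {0..x} g" for x
    using assms(3) by (intro set_integrable_cong integral_cong arg_cong[of _ _ bounded] image_cong; simp)+
  moreover have "F 0 = G 0" by (rule assms(2)) simp
  ultimately show ?thesis using assms(1,2) unfolding prim_def by metis
qed

text \<open>The difference quotients are bounded by C |s - r|, so the derivative vanishes at every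
  point, not just almost everywhere.\<close>

lemma quadratic_increment_imp_constant:
  fixes \<Phi> :: "real \<Rightarrow> 'a::real_normed_vector"
  assumes C: "\<And>r s. 0 \<le> r \<Longrightarrow> r \<le> s \<Longrightarrow> s \<le> X \<Longrightarrow> norm (\<Phi> s - \<Phi> r) \<le> C * (s - r)\<^sup>2"
    and "0 \<le> X"
  shows "\<Phi> X = \<Phi> 0"
proof -
  have C': "norm (\<Phi> s - \<Phi> r) \<le> C * (s - r)\<^sup>2" if "r \<in> {0..X}" "s \<in> {0..X}" for r s
    using C[of r s] C[of s r] that by (cases "r \<le> s") (auto simp: norm_minus_commute power2_commute)
  have "(\<Phi> has_derivative (\<lambda>h. 0)) (at r within {0..X})" if r: "r \<in> {0..X}" for r
    unfolding has_derivative_within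
  proof (rule conjI[OF _ Lim_null_comparison[where g = "\<lambda>s. C * norm (s - r)"]])
    show "\<forall>\<^sub>F s in at r within {0..X}.
        norm ((1 / norm (s - r)) *\<^sub>R (\<Phi> s - (\<Phi> r + 0))) \<le> C * norm (s - r)"
      unfolding eventually_at_filter
    proof (intro always_eventually allI impI)
      fix s assume "s \<noteq> r" "s \<in> {0..X}"
      then have "norm (\<Phi> s - \<Phi> r) / norm (s - r) \<le> C * (s - r)\<^sup>2 / norm (s - r)"
        using C'[OF r] by (intro divide_right_mono) simp_all
      also have "\<dots> = C * norm (s - r)"
        using \<open>s \<noteq> r\<close> by (cases "r < s") (auto simp: power2_eq_square abs_if divide_simps algebra_simps)
      finally show "norm ((1 / norm (s - r)) *\<^sub>R (\<Phi> s - (\<Phi> r + 0))) \<le> C * norm (s - r)"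
        by simp
    qed
    show "((\<lambda>s. C * norm (s - r)) \<longlongrightarrow> 0) (at r within {0..X})"
      by (auto intro!: tendsto_eq_intros)
  qed simp
  then show ?thesis
    using has_derivative_zero_unique[of "{0..X}" \<Phi> X 0] \<open>0 \<le> X\<close> by auto
qed

text \<open>The defect of the product rule has increments of second order because both primitives are
  Lipschitz; so it is constant, although the integrands are merely measurable.\<close>

lemma prim_bilinear:
  fixes F :: "real \<Rightarrow> 'a::euclidean_space" and G :: "real \<Rightarrow> 'b::euclidean_space"
    and h :: "'a \<Rightarrow> 'b \<Rightarrow> 'c::euclidean_space"
  assumes h: "bounded_bilinear h" and F: "prim F f" and G: "prim G g"
  shows "prim (\<lambda>x. h (F x) (G x)) (\<lambda>x. h (f x) (G x) + h (F x) (g x))"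
proof -
  interpret h: bounded_bilinear h by (rule h)
  obtain B where B: "0 \<le> B" "\<And>a b. norm (h a b) \<le> norm a * norm b * B"
    using h.nonneg_bounded by blast
  have bil: "bilinear h" "bilinear (\<lambda>b a. h a b)"
    using h h.flip by (simp_all add: bilinear_conv_bounded_bilinear)
  have ai: "(\<lambda>t. h (f t) (G t)) absolutely_integrable_on {0..x}"
      "(\<lambda>t. h (F t) (g t)) absolutely_integrable_on {0..x}" if "0 \<le> x" for x
  proof -
    have m: "F \<in> borel_measurable (lebesgue_on {0..x})" "G \<in> borel_measurable (lebesgue_on {0..x})"
      by (intro continuous_imp_measurable_on_sets_lebesgue prim_continuous[OF F] prim_continuous[OF G];
          simp)+
    show "(\<lambda>t. h (f t) (G t)) absolutely_integrable_on {0..x}"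
      using absolutely_integrable_bounded_measurable_product[OF bil(2) m(2) _ prim_bounded[OF G] primD(1)[OF F that]]
      by simp
    show "(\<lambda>t. h (F t) (g t)) absolutely_integrable_on {0..x}"
      using absolutely_integrable_bounded_measurable_product[OF bil(1) m(1) _ prim_bounded[OF F] primD(1)[OF G that]]
      by simp
  qed
  have bd: "bounded ((\<lambda>t. h (f t) (G t)) ` {0..x})" "bounded ((\<lambda>t. h (F t) (g t)) ` {0..x})" if "0 \<le> x" for x
  proof -
    have *: "bounded ((\<lambda>t. h (p t) (q t)) ` S)" if "bounded (p ` S)" "bounded (q ` S)" for p q and S :: "real set"
    proof -
      obtain P Q where PQ: "\<forall>t\<in>S. norm (p t) \<le> P" "\<forall>t\<in>S. norm (q t) \<le> Q"
        using \<open>bounded (p ` S)\<close> \<open>bounded (q ` S)\<close> by (auto simp: bounded_iff)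
      have "norm (h (p t) (q t)) \<le> P * Q * B" if "t \<in> S" for t
        using PQ that B(1)
        by (intro order_trans[OF B(2)] mult_right_mono mult_mono) (auto intro: order_trans[OF norm_ge_zero])
      then show ?thesis by (auto simp: bounded_iff)
    qed
    show "bounded ((\<lambda>t. h (f t) (G t)) ` {0..x})" "bounded ((\<lambda>t. h (F t) (g t)) ` {0..x})"
      using that by (auto intro!: * prim_bounded[OF F] prim_bounded[OF G] primD(2)[OF F] primD(2)[OF G])
  qed
  define k where "k = (\<lambda>t. h (f t) (G t) + h (F t) (g t))"
  have k_ai: "k absolutely_integrable_on {0..x}" if "0 \<le> x" for x
    unfolding k_def using ai[OF that] by (rule set_integral_add(1))
  have main: "h (F X) (G X) = h (F 0) (G 0) + integral {0..X} k" if X: "0 \<le> X" for X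
  proof -
    obtain K1 where K1: "0 \<le> K1" "\<And>t. t \<in> {0..X} \<Longrightarrow> norm (f t) \<le> K1"
        "\<And>r s. 0 \<le> r \<Longrightarrow> r \<le> s \<Longrightarrow> s \<le> X \<Longrightarrow> norm (F s - F r) \<le> K1 * (s - r)"
      using prim_lipschitz[OF F X] by blast
    obtain K2 where K2: "0 \<le> K2" "\<And>t. t \<in> {0..X} \<Longrightarrow> norm (g t) \<le> K2"
        "\<And>r s. 0 \<le> r \<Longrightarrow> r \<le> s \<Longrightarrow> s \<le> X \<Longrightarrow> norm (G s - G r) \<le> K2 * (s - r)"
      using prim_lipschitz[OF G X] by blast
    define \<Phi> where "\<Phi> = (\<lambda>x. h (F x) (G x) - integral {0..x} k)"
    have "norm (\<Phi> s - \<Phi> r) \<le> (2 * K1 * K2 * B) * (s - r)\<^sup>2" if rs: "0 \<le> r" "r \<le> s" "s \<le> X" for r s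
    proof -
      have int0: "k integrable_on {0..s}"
        using rs by (intro set_lebesgue_integral_eq_integral(1) k_ai) simp
      have ks: "(k has_integral (integral {0..s} k - integral {0..r} k)) {r..s}"
      proof -
        have "integral {0..r} k + integral {r..s} k = integral {0..s} k"
          using int0 rs by (intro Henstock_Kurzweil_Integration.integral_combine) auto
        moreover have "k integrable_on {r..s}"
          by (rule integrable_on_subinterval[OF int0]) (use rs in auto)
        ultimately show ?thesis
          by (metis add_diff_cancel_left' integrable_integral)
      qed
      have "(f has_integral (F s - F r)) {r..s}" "(g has_integral (G s - G r)) {r..s}"
        using integrable_integral[OF prim_integral(1)[OF F rs(1,2)]]
          integrable_integral[OF prim_integral(1)[OF G rs(1,2)]]
        by (simp_all add: prim_integral(2)[OF F rs(1,2)] prim_integral(2)[OF G rs(1,2)])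
      \<comment> \<open>Freezing G at s and F at r makes both integrals explicit, and their sum
        telescopes to the increment of h (F x) (G x). The error against k is a Lipschitz increment
        times a bounded integrand, integrated over length s - r.\<close>
      then have "((\<lambda>t. h (f t) (G s)) has_integral h (F s - F r) (G s)) {r..s}"
        "((\<lambda>t. h (F r) (g t)) has_integral h (F r) (G s - G r)) {r..s}"
        using has_integral_linear[OF _ h.bounded_linear_left[of "G s"], of f "F s - F r" "{r..s}"]
          has_integral_linear[OF _ h.bounded_linear_right[of "F r"], of g "G s - G r" "{r..s}"]
        by (simp_all add: o_def)
      from has_integral_diff[OF has_integral_add[OF this] ks]
      have hi: "((\<lambda>t. h (f t) (G s) + h (F r) (g t) - k t) has_integral (\<Phi> s - \<Phi> r)) {r..s}"
        by (rule has_integral_eq_rhs) (simp add: \<Phi>_def h.diff_left h.diff_right)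
      have "norm (\<Phi> s - \<Phi> r) \<le> (2 * K1 * K2 * (s - r) * B) * Henstock_Kurzweil_Integration.content {r..s}"
      proof (rule has_integral_bound_real[OF _ finite.emptyI hi])
        show "0 \<le> 2 * K1 * K2 * (s - r) * B" using K1 K2 B rs by simp
        show "norm (h (f t) (G s) + h (F r) (g t) - k t) \<le> 2 * K1 * K2 * (s - r) * B" if "t \<in> {r..s} - {}" for t
        proof -
          have t: "t \<in> {r..s}" using that by simp
          have "h (f t) (G s) + h (F r) (g t) - k t = h (f t) (G s - G t) - h (F t - F r) (g t)"
            by (simp add: k_def h.diff_left h.diff_right)
          also have "norm \<dots> \<le> norm (h (f t) (G s - G t)) + norm (h (F t - F r) (g t))"
            by (rule norm_triangle_ineq4)
          also have "\<dots> \<le> K1 * (K2 * (s - r)) * B + (K1 * (s - r)) * K2 * B"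
          proof (intro add_mono order_trans[OF B(2)] mult_right_mono mult_mono)
            show "norm (f t) \<le> K1" "norm (g t) \<le> K2" using K1 K2 t rs by auto
            have "norm (G s - G t) \<le> K2 * (s - t)" "norm (F t - F r) \<le> K1 * (t - r)"
              using K1(3)[of r t] K2(3)[of t s] t rs by auto
            moreover have "K2 * (s - t) \<le> K2 * (s - r)" "K1 * (t - r) \<le> K1 * (s - r)"
              using K1 K2 t by (auto intro!: mult_left_mono)
            ultimately show "norm (G s - G t) \<le> K2 * (s - r)" "norm (F t - F r) \<le> K1 * (s - r)"
              by linarith+
          qed (use K1 K2 B rs in auto)
          finally show ?thesis by (simp add: algebra_simps)
        qed
      qed
      also have "\<dots> = (2 * K1 * K2 * B) * (s - r)\<^sup>2"
        using rs by (simp add: power2_eq_square)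
      finally show ?thesis .
    qed
    from quadratic_increment_imp_constant[OF this X] show ?thesis
      by (simp add: \<Phi>_def algebra_simps)
  qed
  show ?thesis
    unfolding k_def[symmetric] prim_def
  proof (intro allI impI conjI)
    fix x :: real assume x: "0 \<le> x"
    show "k absolutely_integrable_on {0..x}" by (rule k_ai[OF x])
    show "bounded (k ` {0..x})" unfolding k_def using bd[OF x] by (rule bounded_plus_comp)
    show "h (F x) (G x) = h (F 0) (G 0) + integral {0..x} k" by (rule main[OF x])
  qed
qed

lemma prim_of_derivative:
  assumes "\<And>x. 0 \<le> x \<Longrightarrow> (F has_vector_derivative f x) (at x within {0..})"
    and "continuous_on {0..} f"
  shows "prim F f"
  unfolding prim_def
proof (intro allI impI conjI)
  fix x :: real assume x: "0 \<le> x"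
  have c: "continuous_on {0..x} f" by (rule continuous_on_subset[OF assms(2)]) auto
  show "f absolutely_integrable_on {0..x}"
    using c absolutely_integrable_continuous[of 0 x f] by (simp add: cbox_interval)
  show "bounded (f ` {0..x})"
    by (intro compact_imp_bounded compact_continuous_image c) auto
  have "(f has_integral (F x - F 0)) {0..x}"
    by (rule fundamental_theorem_of_calculus[OF x])
      (auto intro: has_vector_derivative_within_subset[OF assms(1)])
  then show "F x = F 0 + integral {0..x} f" by (simp add: integral_unique)
qed

lemma prim_const: "prim (\<lambda>x. c) (\<lambda>x. 0)"
  by (rule prim_of_derivative) auto

lemma prim_integral_of_continuous:
  assumes "continuous_on {0..} f"
  shows "prim (\<lambda>x. c + integral {0..x} f) f"
  unfolding prim_def
proof (intro allI impI conjI)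
  fix x :: real assume x: "0 \<le> x"
  have c: "continuous_on {0..x} f" by (rule continuous_on_subset[OF assms]) auto
  show "f absolutely_integrable_on {0..x}"
    using c absolutely_integrable_continuous[of 0 x f] by (simp add: cbox_interval)
  show "bounded (f ` {0..x})"
    by (intro compact_imp_bounded compact_continuous_image c) auto
qed simp

text \<open>The product r(t) exp (- K t) has a nonpositive integrand. No sign of K or r is assumed,
  so the same lemma covers growth and decay.\<close>

lemma prim_gronwall:
  fixes r \<rho> :: "real \<Rightarrow> real"
  assumes r: "prim r \<rho>" and "0 \<le> X" and le: "\<And>t. t \<in> {0..X} \<Longrightarrow> \<rho> t \<le> K * r t"
  shows "r X \<le> r 0 * exp (K * X)"
proof -
  have "prim (\<lambda>t. exp (- K * t)) (\<lambda>t. - K * exp (- K * t))"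
    by (rule prim_of_derivative)
      (auto intro!: derivative_eq_intros continuous_intros
        simp: has_real_derivative_iff_has_vector_derivative[symmetric])
  from prim_bilinear[OF bounded_bilinear_mult r this]
  have p: "prim (\<lambda>t. r t * exp (- K * t)) (\<lambda>t. \<rho> t * exp (- K * t) + r t * (- K * exp (- K * t)))" .
  let ?k = "\<lambda>t. \<rho> t * exp (- K * t) + r t * (- K * exp (- K * t))"
  have "integral {0..X} ?k \<le> integral {0..X} (\<lambda>t. 0)"
  proof (rule integral_le)
    show "?k integrable_on {0..X}" by (rule prim_integral(1)[OF p]) (use assms in auto)
    fix t assume "t \<in> {0..X}"
    then have "(\<rho> t - K * r t) * exp (- K * t) \<le> 0"
      using le[of t] by (intro mult_nonpos_nonneg) auto
    then show "?k t \<le> 0" by (simp add: algebra_simps)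
  qed auto
  then have "r X * exp (- K * X) \<le> r 0"
    using primD(3)[OF p \<open>0 \<le> X\<close>] by simp
  then have "r X * exp (- K * X) * exp (K * X) \<le> r 0 * exp (K * X)"
    by (rule mult_right_mono) auto
  moreover have "exp (- K * X) * exp (K * X) = 1"
    by (simp flip: exp_add)
  ultimately show ?thesis by (simp only: mult.assoc mult_1_right)
qed

text \<open>Applied to the squared norm, Gronwall sees only the component of f along F. This
  one-sided hypothesis keeps the exponent sharp: K may be negative, and Re z does not enter when F
  solves a Dirac system.\<close>

lemma prim_norm_gronwall:
  assumes F: "prim F f" and "0 \<le> X" and le: "\<And>t. t \<in> {0..X} \<Longrightarrow> F t \<bullet> f t \<le> K * (norm (F t))\<^sup>2"
  shows "norm (F X) \<le> norm (F 0) * exp (K * X)"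
proof -
  have "prim (\<lambda>t. F t \<bullet> F t) (\<lambda>t. f t \<bullet> F t + F t \<bullet> f t)"
    by (rule prim_bilinear[OF bounded_bilinear_inner F F])
  from prim_gronwall[OF this \<open>0 \<le> X\<close>, of "2 * K"]
  have "F X \<bullet> F X \<le> F 0 \<bullet> F 0 * exp (2 * K * X)"
    using le by (auto simp: power2_norm_eq_inner inner_commute)
  then have "(norm (F X))\<^sup>2 \<le> (norm (F 0) * exp (K * X))\<^sup>2"
    by (simp add: power2_norm_eq_inner power_mult_distrib flip: exp_double) (simp add: mult_ac)
  then show ?thesis by (rule power2_le_imp_le) simp
qed

lemma prim_zero:
  assumes F: "prim F f" and "0 \<le> X" and le: "\<And>t. t \<in> {0..X} \<Longrightarrow> norm (f t) \<le> K * norm (F t)"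
    and "F 0 = 0"
  shows "F X = 0"
proof -
  have "F t \<bullet> f t \<le> K * (norm (F t))\<^sup>2" if "t \<in> {0..X}" for t
  proof -
    have "F t \<bullet> f t \<le> norm (F t) * norm (f t)" by (rule norm_cauchy_schwarz)
    also have "\<dots> \<le> norm (F t) * (K * norm (F t))" by (intro mult_left_mono le that) auto
    finally show ?thesis by (simp add: power2_eq_square mult_ac)
  qed
  from prim_norm_gronwall[OF F \<open>0 \<le> X\<close> this] \<open>F 0 = 0\<close> show ?thesis by simp
qed

text \<open>Continuity is asked of the difference only: in the application both integrands contain
  measurable potentials, which cancel in the difference.\<close>

lemma prim_eq_imp_integrand_eq:
  assumes "prim F f" "prim F g" "continuous_on {0..} (\<lambda>t. f t - g t)" "0 \<le> x"
  shows "f x = g x"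
proof -
  define d where "d = (\<lambda>t. f t - g t)"
  have p: "prim (\<lambda>x. 0 :: 'a) d"
    using prim_diff[OF assms(1,2)] by (simp add: d_def)
  have I: "integral {0..y} d = 0" if "0 \<le> y" for y
    using primD(3)[OF p that] by simp
  have "((\<lambda>y. integral {0..y} d) has_vector_derivative d x) (at x within {0..x + 1})"
    by (rule integral_has_vector_derivative)
      (use assms in \<open>auto simp: d_def intro: continuous_on_subset\<close>)
  then have "((\<lambda>y. 0 :: 'a) has_vector_derivative d x) (at x within {0..x + 1})"
    by (rule has_vector_derivative_transform[rotated 2]) (use \<open>0 \<le> x\<close> I in auto)
  then have "d x = 0"
    using vector_derivative_unique_within[of x "{0..x+1}" "\<lambda>y. 0 :: 'a" "d x" 0] \<open>0 \<le> x\<close>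
    by (auto simp: trivial_limit_within islimpt_Icc)
  then show ?thesis by (simp add: d_def)
qed

section \<open>Dirac systems with locally bounded potentials\<close>

text \<open>The adjoint in the lower left block makes this map linear over the reals only.\<close>

lemma bounded_linear_dirac_V: "bounded_linear (dirac_V :: complex^'m2^'m1 \<Rightarrow> _)"
  unfolding linear_conv_bounded_linear[symmetric]
  by (rule linearI) (auto simp: dirac_V_def cadjoint_def vec_eq_iff split: sum.split)

lemma bounded_linear_dirac_rhs_part:
  "bounded_linear (\<lambda>w :: complex^'m2^'m1. \<i> *\<^sub>m (dirac_j ** dirac_V w))"
  by (intro bounded_linear_compose[OF bounded_linear_mat_scale]
      bounded_linear_compose[OF bounded_bilinear.bounded_linear_right[OF bounded_bilinear_matrix_matrix]]
      bounded_linear_dirac_V)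

lemma dirac_rhs_affine: "dirac_rhs v z t = \<i> *\<^sub>m (z *\<^sub>m dirac_j) + \<i> *\<^sub>m (dirac_j ** dirac_V (v t))"
  by (simp add: dirac_rhs_def mat_scale_add)

lemma bounded_dirac_rhs:
  assumes "bounded (v ` S)"
  shows "bounded (dirac_rhs v z ` S)"
  unfolding dirac_rhs_affine
  using bounded_linear_image[OF assms bounded_linear_dirac_rhs_part]
  by (intro bounded_plus_comp) (auto simp: image_image intro: finite_imp_bounded finite_subset[of _ "{_}"])

lemma continuous_on_dirac_rhs:
  assumes "continuous_on S v"
  shows "continuous_on S (dirac_rhs v z)"
  unfolding dirac_rhs_affine
  by (intro continuous_intros bounded_linear.continuous_on[OF bounded_linear_dirac_rhs_part] assms)

definition graph_matrix :: "complex^'m1^'m2 \<Rightarrow> complex^'m1^('m1::finite + 'm2::finite)" where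
  "graph_matrix \<Phi> = (\<chi> s k. case s of Inl a \<Rightarrow> mat 1 $ a $ k | Inr b \<Rightarrow> \<Phi> $ b $ k)"

lemma graph_matrix_vector: "graph_matrix \<Phi> *v g = stack g (\<Phi> *v g)"
proof (rule block_vector_eqI)
  have "up (graph_matrix \<Phi> *v g) = mat 1 *v g"
    by (simp only: up_def matrix_vector_mult_def graph_matrix_def) simp
  then show "up (graph_matrix \<Phi> *v g) = up (stack g (\<Phi> *v g))" by simp
  show "lo (graph_matrix \<Phi> *v g) = lo (stack g (\<Phi> *v g))"
    by (simp add: lo_def matrix_vector_mult_def graph_matrix_def stack_def)
qed

locale bounded_dirac =
  fixes v :: "real \<Rightarrow> complex^'m2^'m1"
    and u :: "real \<Rightarrow> complex \<Rightarrow> complex^('m1::finite + 'm2::finite)^('m1 + 'm2)"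
  assumes bdd: "0 \<le> r \<Longrightarrow> bounded (v ` {0..r})"
    and fund: "fundamental_solution v u"
begin

lemma u_0: "u 0 z = mat 1"
  using fund unfolding fundamental_solution_def by auto

text \<open>As an indefinite integral u is continuous, hence bounded on compact intervals. Together
  with the bound on the coefficient this bounds the integrand, as \<open>prim\<close>
  requires.\<close>

lemma u_prim: "prim (\<lambda>x. u x z) (\<lambda>t. dirac_rhs v z t ** u t z)"
  unfolding prim_def
proof (intro allI impI conjI)
  fix x :: real assume x: "0 \<le> x"
  have ai: "(\<lambda>t. dirac_rhs v z t ** u t z) absolutely_integrable_on {0..x}"
    and eq: "\<And>y. 0 \<le> y \<Longrightarrow> u y z = mat 1 + integral {0..y} (\<lambda>t. dirac_rhs v z t ** u t z)"
    using fund x unfolding fundamental_solution_def by blast+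
  show "(\<lambda>t. dirac_rhs v z t ** u t z) absolutely_integrable_on {0..x}" by (rule ai)
  show "u x z = u 0 z + integral {0..x} (\<lambda>t. dirac_rhs v z t ** u t z)"
    using eq[OF x] by (simp add: u_0)
  have "continuous_on {0..x} (\<lambda>y. mat 1 + integral {0..y} (\<lambda>t. dirac_rhs v z t ** u t z))"
    by (intro continuous_intros indefinite_integral_continuous_1 set_lebesgue_integral_eq_integral(1) ai)
  then have "continuous_on {0..x} (\<lambda>y. u y z)"
    by (rule continuous_on_eq) (simp add: eq[symmetric])
  then have "bounded ((\<lambda>y. u y z) ` {0..x})"
    by (intro compact_imp_bounded compact_continuous_image) auto
  then obtain K1 where K1: "\<forall>t\<in>{0..x}. norm (u t z) \<le> K1" by (auto simp: bounded_iff)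
  obtain K2 where K2: "\<forall>t\<in>{0..x}. norm (dirac_rhs v z t) \<le> K2"
    using bounded_dirac_rhs[OF bdd[OF x]] by (auto simp: bounded_iff)
  have "norm (dirac_rhs v z t ** u t z) \<le> K2 * K1" if "t \<in> {0..x}" for t
    using K1 K2 that
    by (intro order_trans[OF norm_matrix_mult_le] mult_mono) (auto intro: order_trans[OF norm_ge_zero])
  then show "bounded ((\<lambda>t. dirac_rhs v z t ** u t z) ` {0..x})" unfolding bounded_iff by blast
qed

lemma sol_prim: "prim (\<lambda>x. u x z *v h) (\<lambda>t. dirac_rhs v z t *v (u t z *v h))"
  using prim_bounded_linear[OF bounded_bilinear.bounded_linear_left[OF bounded_bilinear_matrix_vector] u_prim]
  by (simp add: matrix_vector_mul_assoc)

lemma sol_up_prim: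
  "prim (\<lambda>x. up (u x z *v h)) (\<lambda>t. (\<i> * z) *s up (u t z *v h) + \<i> *s (v t *v lo (u t z *v h)))"
  using prim_bounded_linear[OF bounded_linear_up sol_prim] by (simp add: dirac_rhs_vector)

lemma sol_lo_prim:
  "prim (\<lambda>x. lo (u x z *v h)) (\<lambda>t. - (\<i> * z) *s lo (u t z *v h) - \<i> *s ((v t)\<^sup>\<dagger> *v up (u t z *v h)))"
  using prim_bounded_linear[OF bounded_linear_lo sol_prim] by (simp add: dirac_rhs_vector)

text \<open>The terms with the potential cancel because \<open>j\<close> times the potential part is Hermitian.\<close>

lemma jform_prim:
  "prim (\<lambda>x. jform (u x \<zeta> *v g) (u x z *v h))
     (\<lambda>t. \<i> * (z - cnj \<zeta>) * cip (u t \<zeta> *v g) (u t z *v h))"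
  by (rule prim_cong[OF prim_diff[OF prim_bilinear[OF bounded_bilinear_cip sol_up_prim[of \<zeta> g] sol_up_prim[of z h]]
      prim_bilinear[OF bounded_bilinear_cip sol_lo_prim[of \<zeta> g] sol_lo_prim[of z h]]]])
    (simp_all add: jform_def cip_simps cip_blocks[of "u _ _ *v _"] cip_adjoint cip_adjoint' algebra_simps)

text \<open>The two spectral parameters are kept apart on purpose. For \<open>\<zeta> = z\<close>
  the factor is - 2 Im z and the energy balance results; for \<open>\<zeta> = cnj z\<close> it
  vanishes and the form is conserved; a fixed \<zeta> and a varying z give the dependence on
  z.\<close>

lemma jform_sol:
  assumes "0 \<le> x"
  shows "jform (u x \<zeta> *v g) (u x z *v h) =
    jform g h + \<i> * (z - cnj \<zeta>) * integral {0..x} (\<lambda>t. cip (u t \<zeta> *v g) (u t z *v h))"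
  using primD(3)[OF jform_prim assms] by (simp add: u_0)

lemma energy_prim:
  "prim (\<lambda>x. (norm (up (u x z *v h)))\<^sup>2 - (norm (lo (u x z *v h)))\<^sup>2)
     (\<lambda>t. - 2 * Im z * (norm (u t z *v h))\<^sup>2)"
  by (rule prim_cong[OF prim_bounded_linear[OF bounded_linear_Re jform_prim[of z h z h]]])
    (simp_all add: jform_self cip_self)

lemma energy_sol:
  assumes "0 \<le> x"
  shows "(norm (up (u x z *v h)))\<^sup>2 - (norm (lo (u x z *v h)))\<^sup>2 =
    (norm (up h))\<^sup>2 - (norm (lo h))\<^sup>2 - 2 * Im z * integral {0..x} (\<lambda>t. (norm (u t z *v h))\<^sup>2)"
  using primD(3)[OF energy_prim assms] by (simp add: u_0)

lemma norm_sq_integrable: "(\<lambda>t. (norm (u t z *v h))\<^sup>2) integrable_on {0..x}"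
  by (intro integrable_continuous_interval continuous_intros prim_continuous[OF sol_prim])

lemma jform_conserved:
  assumes "0 \<le> x"
  shows "jform (u x (cnj z) *v g) (u x z *v h) = jform g h"
  using jform_sol[OF assms, of "cnj z" g z h] by simp

text \<open>The inverse of u, written through the adjoint at \<open>cnj z\<close> instead of by
  \<open>matrix_inv\<close>: in this form it inherits estimates, analyticity in z and a differential
  equation from u.\<close>

definition u_inv where "u_inv x z = dirac_j ** (u x (cnj z))\<^sup>\<dagger> ** dirac_j"

text \<open>Conservation of the form, read as a matrix identity, says that u(cnj z)\<dagger> j u(z)
  = j.\<close>

lemma u_inv_left:
  assumes "0 \<le> x"
  shows "u_inv x z ** u x z = mat 1"
proof (rule matrix_eqI)
  fix h
  have "(u x (cnj z))\<^sup>\<dagger> *v (dirac_j *v (u x z *v h)) = dirac_j *v h"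
  proof (rule cip_eqI)
    fix g
    show "cip g ((u x (cnj z))\<^sup>\<dagger> *v (dirac_j *v (u x z *v h))) = cip g (dirac_j *v h)"
      using jform_conserved[OF assms, of z g h] by (simp add: cip_adjoint' jform_dirac_j)
  qed
  then show "u_inv x z ** u x z *v h = mat 1 *v h"
    by (simp add: u_inv_def dirac_j_dirac_j flip: matrix_vector_mul_assoc)
      (simp add: dirac_j_dirac_j matrix_vector_mul_assoc)
qed

lemma u_inv_right:
  assumes "0 \<le> x"
  shows "u x z ** u_inv x z = mat 1"
  using u_inv_left[OF assms] matrix_left_right_inverse by blast

lemma u_injective:
  assumes "0 \<le> x" "u x z *v h = 0"
  shows "h = 0"
  using u_inv_left[OF assms(1), of z] assms(2) by (metis matrix_vector_mul_assoc matrix_vector_mul_lid matrix_vector_mult_0_right)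

lemma potential_bound:
  assumes "0 \<le> X"
  obtains M where "0 \<le> M" "\<And>t. t \<in> {0..X} \<Longrightarrow> norm (v t) \<le> M"
proof -
  obtain M where "\<And>t. t \<in> {0..X} \<Longrightarrow> norm (v t) \<le> M"
    using bdd[OF assms] unfolding bounded_iff by blast
  moreover from this[of 0] have "0 \<le> M"
    using assms order_trans[OF norm_ge_zero] by simp
  ultimately show ?thesis using that by blast
qed

context
  fixes X M :: real
  assumes X: "0 \<le> X" and M: "0 \<le> M" "\<And>t. t \<in> {0..X} \<Longrightarrow> norm (v t) \<le> M"
begin

lemma inner_potential_le:
  assumes "t \<in> {0..X}"
  shows "a \<bullet> (\<i> *s (v t *v b)) \<le> M * norm a * norm b"
    and "b \<bullet> (- \<i> *s ((v t)\<^sup>\<dagger> *v a)) \<le> M * norm a * norm b"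
proof -
  have "norm (\<i> *s (v t *v b)) \<le> M * norm b"
    unfolding norm_scale_vector using order_trans[OF norm_matrix_vector_le mult_right_mono[OF M(2)[OF assms]]]
    by simp
  from order_trans[OF norm_cauchy_schwarz mult_left_mono[OF this, of "norm a"]]
  show "a \<bullet> (\<i> *s (v t *v b)) \<le> M * norm a * norm b" by (simp add: mult_ac)
  have "norm (- \<i> *s ((v t)\<^sup>\<dagger> *v a)) \<le> M * norm a"
    unfolding norm_scale_vector
    using order_trans[OF norm_matrix_vector_le mult_right_mono[OF M(2)[OF assms, folded norm_cadjoint[of "v t"]]]]
    by simp
  from order_trans[OF norm_cauchy_schwarz mult_left_mono[OF this, of "norm b"]]
  show "b \<bullet> (- \<i> *s ((v t)\<^sup>\<dagger> *v a)) \<le> M * norm a * norm b" by (simp add: mult_ac)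
qed

lemma inner_up_rhs_le:
  assumes "t \<in> {0..X}"
  shows "a \<bullet> ((\<i> * z) *s a + \<i> *s (v t *v b)) \<le> - Im z * (norm a)\<^sup>2 + M * norm a * norm b"
  using inner_potential_le(1)[OF assms, of a b]
  by (simp add: inner_right_distrib inner_scale_self)

lemma inner_lo_rhs_le:
  assumes "t \<in> {0..X}"
  shows "b \<bullet> (- (\<i> * z) *s b - \<i> *s ((v t)\<^sup>\<dagger> *v a)) \<le> Im z * (norm b)\<^sup>2 + M * norm a * norm b"
proof -
  have "b \<bullet> (- (\<i> * z) *s b - \<i> *s ((v t)\<^sup>\<dagger> *v a)) = b \<bullet> (- (\<i> * z) *s b) + b \<bullet> (- \<i> *s ((v t)\<^sup>\<dagger> *v a))"
    by (simp only: vector_smult_lneg[of \<i>] inner_diff_right inner_minus_right)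
  then show ?thesis using inner_potential_le(2)[OF assms, of b a] inner_scale_self[of b "- (\<i> * z)"] by simp
qed

text \<open>In the inner product of y with its derivative the spectral terms contribute - Im z on
  the upper and Im z on the lower block, and the two coupling terms together at most M |y|^2. A rate
  depending on |z| would not cancel in \<open>transfer_bound_upper\<close>.\<close>

lemma growth: "norm (u X z *v h) \<le> norm h * exp ((\<bar>Im z\<bar> + M) * X)"
proof -
  have "(u t z *v h) \<bullet> (dirac_rhs v z t *v (u t z *v h)) \<le> (\<bar>Im z\<bar> + M) * (norm (u t z *v h))\<^sup>2"
    if t: "t \<in> {0..X}" for t
  proof -
    define a b where "a = up (u t z *v h)" and "b = lo (u t z *v h)"
    have "(u t z *v h) \<bullet> (dirac_rhs v z t *v (u t z *v h)) \<le>
        (- Im z * (norm a)\<^sup>2 + M * norm a * norm b) + (Im z * (norm b)\<^sup>2 + M * norm a * norm b)"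
      unfolding inner_blocks[of "u t z *v h"] dirac_rhs_vector a_def[symmetric] b_def[symmetric]
      by (intro add_mono inner_up_rhs_le inner_lo_rhs_le t)
    also have "\<dots> \<le> (\<bar>Im z\<bar> + M) * ((norm a)\<^sup>2 + (norm b)\<^sup>2)"
    proof -
      have "M * (2 * norm a * norm b) \<le> M * ((norm a)\<^sup>2 + (norm b)\<^sup>2)"
        using M(1) sum_squares_bound[of "norm a" "norm b"] by (intro mult_left_mono) auto
      moreover have "- Im z * (norm a)\<^sup>2 \<le> \<bar>Im z\<bar> * (norm a)\<^sup>2" "Im z * (norm b)\<^sup>2 \<le> \<bar>Im z\<bar> * (norm b)\<^sup>2"
        by (intro mult_right_mono; simp)+
      ultimately show ?thesis by (simp add: algebra_simps)
    qed
    finally show ?thesis by (simp add: norm_blocks[of "u t z *v h"] a_def b_def)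
  qed
  from prim_norm_gronwall[OF sol_prim X this] show ?thesis by (simp add: u_0)
qed

text \<open>As long as the upper block dominates, the coupling term is at most M times its squared
  norm. Gronwall then runs on the upper block alone, without the opposite sign of the lower
  block.\<close>

lemma decay_up:
  assumes "\<And>t. t \<in> {0..X} \<Longrightarrow> norm (lo (u t z *v h)) \<le> norm (up (u t z *v h))"
  shows "norm (up (u X z *v h)) \<le> norm (up h) * exp ((M - Im z) * X)"
proof -
  have "up (u t z *v h) \<bullet> ((\<i> * z) *s up (u t z *v h) + \<i> *s (v t *v lo (u t z *v h)))
      \<le> (M - Im z) * (norm (up (u t z *v h)))\<^sup>2" if t: "t \<in> {0..X}" for t
  proof -
    define a b where "a = up (u t z *v h)" and "b = lo (u t z *v h)"
    have "M * norm a * norm b \<le> M * norm a * norm a"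
      using assms[OF t] M(1) by (intro mult_left_mono) (auto simp: a_def b_def)
    with inner_up_rhs_le[OF t, of a z b] show ?thesis
      unfolding a_def[symmetric] b_def[symmetric] by (simp add: algebra_simps power2_eq_square)
  qed
  from prim_norm_gronwall[OF sol_up_prim X this] show ?thesis by (simp add: u_0)
qed

lemma decay_lo:
  assumes "\<And>t. t \<in> {0..X} \<Longrightarrow> norm (up (u t z *v h)) \<le> norm (lo (u t z *v h))"
  shows "norm (lo (u X z *v h)) \<le> norm (lo h) * exp ((M + Im z) * X)"
proof -
  have "lo (u t z *v h) \<bullet> (- (\<i> * z) *s lo (u t z *v h) - \<i> *s ((v t)\<^sup>\<dagger> *v up (u t z *v h)))
      \<le> (M + Im z) * (norm (lo (u t z *v h)))\<^sup>2" if t: "t \<in> {0..X}" for t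
  proof -
    define a b where "a = up (u t z *v h)" and "b = lo (u t z *v h)"
    have "M * norm a * norm b \<le> M * norm b * norm b"
      using assms[OF t] M(1) by (intro mult_right_mono mult_left_mono) (auto simp: a_def b_def)
    with inner_lo_rhs_le[OF t, of b z a] show ?thesis
      unfolding a_def[symmetric] b_def[symmetric] by (simp add: algebra_simps power2_eq_square)
  qed
  from prim_norm_gronwall[OF sol_lo_prim X this] show ?thesis by (simp add: u_0)
qed

end

subsection \<open>Weyl sets\<close>

text \<open>The constant parameter P = u [I; \<Phi>] is admissible with empty exceptional set, and
  undoing u returns the column [I; \<Phi>], whose quotient of blocks is \<Phi>.\<close>

lemma weyl_setI:
  assumes x: "0 \<le> x"
    and le: "\<And>g. norm (lo (u x z *v stack g (\<Phi> *v g))) \<le> norm (up (u x z *v stack g (\<Phi> *v g)))"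
  shows "\<Phi> \<in> weyl_set u x z"
proof -
  define P where "P = u x z ** graph_matrix \<Phi>"
  have Pv: "P *v g = u x z *v stack g (\<Phi> *v g)" for g
    by (simp add: P_def graph_matrix_vector flip: matrix_vector_mul_assoc)
  have "pos_def (P\<^sup>\<dagger> ** P)"
    unfolding pos_def_def
  proof (intro conjI allI impI)
    fix g :: "complex^'m1" assume "g \<noteq> 0"
    then have "P *v g \<noteq> 0"
      unfolding Pv using u_injective[OF x] by (metis up_stack up_zero)
    then show "0 < Re (quad_form (P\<^sup>\<dagger> ** P) g)" by (simp add: quad_form_gram)
  qed (simp add: cadjoint_mult)
  moreover have "pos_semidef (P\<^sup>\<dagger> ** dirac_j ** P)"
    unfolding pos_semidef_def
  proof (intro conjI allI)
    fix g :: "complex^'m1"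
    have "quad_form (P\<^sup>\<dagger> ** dirac_j ** P) g = jform (P *v g) (P *v g)"
      by (simp add: quad_form_cip cip_adjoint' jform_dirac_j flip: matrix_vector_mul_assoc)
    then show "0 \<le> Re (quad_form (P\<^sup>\<dagger> ** dirac_j ** P) g)"
      using le[of g] by (simp add: jform_self Pv)
  qed (simp add: cadjoint_mult cadjoint_dirac_j matrix_mul_assoc)
  ultimately have "nonsingular_property_j {} (\<lambda>z. P)"
    by (auto simp: nonsingular_property_j_def sparse_in_def intro: meromorphic_on_const)
  moreover have "moebius_value (u x z) P = \<Phi>"
  proof -
    have "matrix_inv (u x z) ** P = graph_matrix \<Phi>"
      unfolding matrix_inv_unique(2)[OF u_inv_left[OF x]] P_def
      by (simp add: matrix_mul_assoc u_inv_left[OF x])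
    moreover have "upper_row ** graph_matrix \<Phi> = mat 1"
      by (rule matrix_eqI) (simp add: upper_row_vector graph_matrix_vector flip: matrix_vector_mul_assoc)
    moreover have "lower_row ** graph_matrix \<Phi> = \<Phi>"
      by (rule matrix_eqI) (simp add: lower_row_vector graph_matrix_vector flip: matrix_vector_mul_assoc)
    moreover have "matrix_inv (mat 1 :: complex^'m1^'m1) = mat 1"
      by (rule matrix_inv_unique(2)) simp
    ultimately show ?thesis
      by (simp add: moebius_value_def flip: matrix_mul_assoc)
  qed
  ultimately show ?thesis
    unfolding weyl_set_def by (intro CollectI exI[of _ "{}"] exI[of _ "\<lambda>z. P"]) simp
qed

text \<open>The matrix Q, the inverse of u times P, has the graph of \<Phi> as its range. Hence u
  maps the graph into the range of P, where the form of j is nonnegative.\<close>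

lemma weyl_setD:
  assumes x: "0 \<le> x" and z: "z \<in> \<complex>\<^sub>+" and "\<Phi> \<in> weyl_set u x z"
  shows "norm (lo (u x z *v stack g (\<Phi> *v g))) \<le> norm (up (u x z *v stack g (\<Phi> *v g)))"
proof -
  obtain D \<P> where D: "nonsingular_property_j D \<P>" "z \<notin> D" "\<Phi> = moebius_value (u x z) (\<P> z)"
    using assms(3) unfolding weyl_set_def by blast
  define P where "P = \<P> z"
  have pd: "pos_def (P\<^sup>\<dagger> ** P)" and ps: "pos_semidef (P\<^sup>\<dagger> ** dirac_j ** P)"
    using D z unfolding nonsingular_property_j_def P_def by auto
  have P_inj: "h = 0" if "P *v h = 0" for h
    using pd that unfolding pos_def_def by (metis less_irrefl norm_zero of_real_0 power_zero_numeral quad_form_gram zero_complex.simps(1))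
  have P_le: "norm (lo (P *v h)) \<le> norm (up (P *v h))" for h
  proof -
    have "quad_form (P\<^sup>\<dagger> ** dirac_j ** P) h = jform (P *v h) (P *v h)"
      by (simp add: quad_form_cip cip_adjoint' jform_dirac_j flip: matrix_vector_mul_assoc)
    then show ?thesis
      using ps unfolding pos_semidef_def by (auto simp: jform_self intro: power2_le_imp_le dest!: spec[of _ h])
  qed
  define Q where "Q = matrix_inv (u x z) ** P"
  define a where "a = upper_row ** Q"
  have uQ: "u x z *v (Q *v h) = P *v h" for h
    unfolding Q_def matrix_inv_unique(2)[OF u_inv_left[OF x]]
    by (simp add: matrix_vector_mul_assoc matrix_mul_assoc u_inv_right[OF x])
  have av: "a *v h = up (Q *v h)" for h
    by (simp add: a_def upper_row_vector flip: matrix_vector_mul_assoc)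
  \<comment> \<open>If the upper block of Q h vanishes, the energy at 0 is - |lo (Q h)|^2. In the
    upper half-plane energy does not increase with x, and at x it is nonnegative because P has
    property-j. So Q h = 0.\<close>
  have "invertible a"
  proof (rule invertible_if_injective)
    fix h assume "a *v h = 0"
    then have up0: "up (Q *v h) = 0" by (simp add: av)
    have "0 \<le> integral {0..x} (\<lambda>t. (norm (u t z *v (Q *v h)))\<^sup>2)"
      by (rule integral_nonneg[OF norm_sq_integrable]) auto
    then have "0 \<le> 2 * Im z * integral {0..x} (\<lambda>t. (norm (u t z *v (Q *v h)))\<^sup>2)"
      using z by (simp add: upper_half_plane_def)
    moreover have "(norm (lo (P *v h)))\<^sup>2 \<le> (norm (up (P *v h)))\<^sup>2"
      using P_le[of h] by (intro power_mono) auto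
    ultimately have "(norm (lo (Q *v h)))\<^sup>2 \<le> 0"
      using energy_sol[OF x, of z "Q *v h"] unfolding uQ up0 norm_zero zero_power2 by linarith
    then have "lo (Q *v h) = 0" by simp
    then have "Q *v h = 0" using up0 by (intro block_vector_eqI) auto
    then show "h = 0" using P_inj uQ[of h] by simp
  qed
  note a_inv = matrix_inv_left_right[OF this]
  have "\<Phi> = lower_row ** Q ** matrix_inv a"
    by (simp add: D(3) moebius_value_def Q_def a_def P_def matrix_mul_assoc)
  then have "\<Phi> *v g = lo (Q *v (matrix_inv a *v g))"
    by (simp add: lower_row_vector flip: matrix_vector_mul_assoc)
  moreover have "up (Q *v (matrix_inv a *v g)) = g"
    unfolding av[symmetric] by (simp add: a_inv matrix_vector_mul_assoc)
  ultimately have "stack g (\<Phi> *v g) = Q *v (matrix_inv a *v g)"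
    by (intro block_vector_eqI) simp_all
  then show ?thesis using P_le by (simp add: uQ)
qed

text \<open>If two matrices belonged to all Weyl sets, a nonzero solution starting in the lower block would
  be square integrable, but the modulus of such a solution is bounded below.\<close>

lemma weyl_point_unique:
  assumes z: "z \<in> \<complex>\<^sub>+" and "\<And>x. 0 \<le> x \<Longrightarrow> \<Phi> \<in> weyl_set u x z" "\<And>x. 0 \<le> x \<Longrightarrow> \<Psi> \<in> weyl_set u x z"
  shows "\<Phi> = \<Psi>"
proof (rule ccontr)
  assume "\<Phi> \<noteq> \<Psi>"
  then obtain g where g: "\<Phi> *v g \<noteq> \<Psi> *v g" using matrix_eqI by blast
  define d where "d = \<Phi> *v g - \<Psi> *v g"
  have Im: "0 < Im z" using z by (simp add: upper_half_plane_def)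
  define p q r where "p = stack g (\<Phi> *v g)" and "q = stack g (\<Psi> *v g)" and "r = (stack 0 d :: complex^('m1 + 'm2))"
  have r_eq: "r = p - q"
    by (rule block_vector_eqI) (simp_all add: p_def q_def r_def d_def up_diff lo_diff)
  define I where "I = (\<lambda>h x. integral {0..x} (\<lambda>t. (norm (u t z *v h))\<^sup>2))"
  have I_nonneg: "0 \<le> I h x" for h x
    unfolding I_def by (rule integral_nonneg[OF norm_sq_integrable]) auto
  have bound: "2 * Im z * I (stack g (\<Theta> *v g)) x \<le> (norm g)\<^sup>2"
    if "0 \<le> x" "\<Theta> \<in> weyl_set u x z" for \<Theta> x
  proof -
    have "(norm (lo (u x z *v stack g (\<Theta> *v g))))\<^sup>2 \<le> (norm (up (u x z *v stack g (\<Theta> *v g))))\<^sup>2"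
      using weyl_setD[OF that(1) z that(2), of g] by (intro power_mono) auto
    then show ?thesis
      using energy_sol[OF that(1), of z "stack g (\<Theta> *v g)"] zero_le_power2[of "norm (\<Theta> *v g)"]
      unfolding I_def up_stack lo_stack by linarith
  qed
  \<comment> \<open>The energy starts at - |d|^2 and does not increase, so already the lower block
    has norm at least |d|.\<close>
  have lower: "(norm d)\<^sup>2 \<le> (norm (u x z *v r))\<^sup>2" if "0 \<le> x" for x
  proof -
    have "0 \<le> 2 * Im z * I r x" using Im I_nonneg by simp
    moreover have "0 \<le> (norm (up (u x z *v r)))\<^sup>2" by simp
    moreover have "(norm (up (u x z *v r)))\<^sup>2 - (norm (lo (u x z *v r)))\<^sup>2 = - (norm d)\<^sup>2 - 2 * Im z * I r x"
      using energy_sol[OF that, of z r] unfolding I_def by (simp add: r_def)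
    ultimately show ?thesis
      using norm_blocks[of "u x z *v r"] by linarith
  qed
  have "x * (norm d)\<^sup>2 \<le> 2 * (norm g)\<^sup>2 / Im z" if x: "0 \<le> x" for x
  proof -
    have "x * (norm d)\<^sup>2 = integral {0..x} (\<lambda>t. (norm d)\<^sup>2)" using x by simp
    also have "\<dots> \<le> integral {0..x} (\<lambda>t. 2 * (norm (u t z *v p))\<^sup>2 + 2 * (norm (u t z *v q))\<^sup>2)"
    proof (rule integral_le)
      fix t assume t: "t \<in> {0..x}"
      define y w where "y = u t z *v p" and "w = u t z *v q"
      have "(norm d)\<^sup>2 \<le> (norm (y - w))\<^sup>2"
        using lower[of t] t by (simp add: r_eq y_def w_def matrix_vector_mult_diff_distrib)
      also have "\<dots> \<le> (norm y + norm w)\<^sup>2" by (intro power_mono norm_triangle_ineq4) simp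
      also have "\<dots> \<le> 2 * (norm y)\<^sup>2 + 2 * (norm w)\<^sup>2"
        using sum_squares_bound[of "norm y" "norm w"] by (simp add: power2_sum)
      finally show "(norm d)\<^sup>2 \<le> 2 * (norm (u t z *v p))\<^sup>2 + 2 * (norm (u t z *v q))\<^sup>2"
        by (simp add: y_def w_def)
    qed (intro integrable_const_ivl integrable_add integrable_on_mult_right norm_sq_integrable)+
    also have "\<dots> = 2 * I p x + 2 * I q x"
      unfolding I_def
      by (subst integral_add) (auto intro!: integrable_on_mult_right norm_sq_integrable)
    also have "\<dots> \<le> 2 * (norm g)\<^sup>2 / Im z"
      using bound[OF x assms(2)[OF x]] bound[OF x assms(3)[OF x]] Im
      by (simp add: p_def q_def field_simps)
    finally show ?thesis .
  qed
  \<comment> \<open>At this x the left-hand side exceeds the right-hand side by exactly 1.\<close>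
  from this[of "(2 * (norm g)\<^sup>2 / Im z + 1) / (norm d)\<^sup>2"] g Im show False
    by (simp add: d_def)
qed

end

section \<open>Uniqueness of the potential\<close>

text \<open>By Henstock's lemma, if the integral vanishes on all intervals then so does the integral of the norm.\<close>

lemma AE_zero_if_integral_zero:
  fixes f :: "real \<Rightarrow> 'a::euclidean_space"
  assumes ai: "\<And>x. 0 \<le> x \<Longrightarrow> f absolutely_integrable_on {0..x}"
    and zero: "\<And>x. 0 \<le> x \<Longrightarrow> integral {0..x} f = 0"
  shows "AE x in lebesgue_on {0..}. f x = 0"
proof -
  have "AE x in lebesgue. x \<in> {0..real N} \<longrightarrow> f x = 0" for N
  proof -
    have int: "f integrable_on {0..real N}"
      using set_lebesgue_integral_eq_integral(1)[OF ai] by simp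
    have sub0: "integral {a..b} f = 0" if "0 \<le> a" "a \<le> b" "b \<le> real N" for a b
    proof -
      have "f integrable_on {0..b}"
        using set_lebesgue_integral_eq_integral(1)[OF ai] that by simp
      then have "integral {0..a} f + integral {a..b} f = integral {0..b} f"
        using that by (intro Henstock_Kurzweil_Integration.integral_combine) auto
      then show ?thesis using zero[of a] zero[of b] that by simp
    qed
    have "((\<lambda>t. norm (f t)) has_integral 0) (cbox 0 (real N))"
      unfolding has_integral
    proof (intro allI impI)
      fix e :: real assume "0 < e"
      from int have "f integrable_on cbox 0 (real N)" by (simp add: cbox_interval)
      from Henstock_lemma[OF this \<open>0 < e\<close>] obtain \<gamma> where \<gamma>: "gauge \<gamma>"
        "\<And>p. p tagged_partial_division_of cbox 0 (real N) \<Longrightarrow> \<gamma> fine p \<Longrightarrow>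
          (\<Sum>(x, K)\<in>p. norm (Henstock_Kurzweil_Integration.content K *\<^sub>R f x - integral K f)) < e"
        by blast
      have small: "norm ((\<Sum>(x, K)\<in>p. Henstock_Kurzweil_Integration.content K *\<^sub>R norm (f x)) - 0) < e"
        if p: "p tagged_division_of cbox 0 (real N)" "\<gamma> fine p" for p
      proof -
        \<comment> \<open>Every cell lies in [0, N], where f integrates to 0 over each interval. So
          the Riemann sum of the norm is exactly the sum that Henstock's lemma controls.\<close>
        have "(\<Sum>(x, K)\<in>p. Henstock_Kurzweil_Integration.content K *\<^sub>R norm (f x)) =
            (\<Sum>(x, K)\<in>p. norm (Henstock_Kurzweil_Integration.content K *\<^sub>R f x - integral K f))"
        proof (rule sum.cong[OF refl], clarify)
          fix x K assume xK: "(x, K) \<in> p"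
          obtain a b where K: "K = cbox a b" "K \<subseteq> cbox 0 (real N)" "x \<in> K"
            using tagged_division_ofD(2,3,4)[OF p(1) xK] by blast
          then have "integral K f = 0"
            using sub0[of a b] by (auto simp: cbox_interval)
          then show "Henstock_Kurzweil_Integration.content K *\<^sub>R norm (f x) =
              norm (Henstock_Kurzweil_Integration.content K *\<^sub>R f x - integral K f)"
            by simp
        qed
        moreover have "\<dots> < e"
          using p \<gamma>(2) by (auto simp: tagged_division_of_def)
        moreover have "0 \<le> (\<Sum>(x, K)\<in>p. norm (Henstock_Kurzweil_Integration.content K *\<^sub>R f x - integral K f))"
          by (auto intro!: sum_nonneg)
        ultimately show ?thesis by simp
      qed
      show "\<exists>\<gamma>. gauge \<gamma> \<and> (\<forall>\<D>. \<D> tagged_division_of cbox 0 (real N) \<and> \<gamma> fine \<D> \<longrightarrow>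
          norm ((\<Sum>(x, K)\<in>\<D>. Henstock_Kurzweil_Integration.content K *\<^sub>R norm (f x)) - 0) < e)"
        by (rule exI[of _ \<gamma>], intro conjI allI impI \<gamma>(1) small) simp_all
    qed
    then have I0: "integral {0..real N} (\<lambda>t. norm (f t)) = 0"
      by (simp add: cbox_interval integral_unique)
    have nai: "(\<lambda>t. norm (f t)) absolutely_integrable_on {0..real N}"
      using absolutely_integrable_norm[OF ai[of "real N"]] by (simp add: o_def)
    have "integral\<^sup>L lebesgue (\<lambda>t. indicator {0..real N} t *\<^sub>R norm (f t)) = 0"
      using set_lebesgue_integral_eq_integral(2)[OF nai] I0 by (simp add: set_lebesgue_integral_def)
    then have "AE t in lebesgue. indicator {0..real N} t *\<^sub>R norm (f t) = 0"
      using nai unfolding set_integrable_def by (subst (asm) integral_nonneg_eq_0_iff_AE) auto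
    then show ?thesis
      by eventually_elim (auto simp: indicator_def split: if_splits)
  qed
  then have "AE x in lebesgue. \<forall>N. x \<in> {0..real N} \<longrightarrow> f x = 0"
    by (simp only: AE_all_countable) simp
  then have "AE x in lebesgue. x \<in> {0..} \<longrightarrow> f x = 0"
    by eventually_elim (auto intro: real_nat_ceiling_ge)
  then show ?thesis
    by (subst AE_restrict_space_iff) auto
qed

section \<open>Analyticity of the fundamental solution and its inverse in the spectral
  parameter\<close>

context bounded_dirac
begin

lemma cip_integrable: "(\<lambda>t. cip (u t \<zeta> *v g) (u t z *v h)) integrable_on {0..x}"
  by (intro integrable_continuous_interval bounded_bilinear.continuous_on[OF bounded_bilinear_cip]
      prim_continuous[OF sol_prim])

text \<open>The vector g is chosen so that its solution at \<open>cnj z\<close> takes the value j d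
  at x. Pairing it with the solution at w isolates the dependence on w: the first term is constant
  and the second carries the factor w - z.\<close>

lemma cip_sol_representation:
  assumes x: "0 \<le> x" and g: "g = u_inv x (cnj z) *v (dirac_j *v d)"
  shows "cip d (u x w *v e) = jform g e +
    \<i> * (w - z) * integral {0..x} (\<lambda>t. cip (u t (cnj z) *v g) (u t w *v e))"
proof -
  have "u x (cnj z) *v g = dirac_j *v d"
    using u_inv_right[OF x, of "cnj z"] unfolding g matrix_vector_mul_assoc[of "u x (cnj z)"] by simp
  then have "jform (u x (cnj z) *v g) (u x w *v e) = cip d (u x w *v e)"
    using cip_adjoint[of dirac_j d "dirac_j *v (u x w *v e)"]
    by (simp add: jform_dirac_j cadjoint_dirac_j matrix_vector_mul_assoc matrix_mul_assoc dirac_j_dirac_j)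
  then show ?thesis using jform_sol[OF x, of "cnj z" g w e] by simp
qed

context
  fixes X M :: real
  assumes X: "0 \<le> X" and M: "0 \<le> M" "\<And>t. t \<in> {0..X} \<Longrightarrow> norm (v t) \<le> M"
begin

lemma growth_upto:
  assumes "t \<in> {0..X}"
  shows "norm (u t z *v h) \<le> norm h * exp ((\<bar>Im z\<bar> + M) * X)"
proof -
  have "norm (u t z *v h) \<le> norm h * exp ((\<bar>Im z\<bar> + M) * t)"
    using assms M by (intro growth) auto
  also have "\<dots> \<le> norm h * exp ((\<bar>Im z\<bar> + M) * X)"
    using assms M(1) by (intro mult_left_mono) (auto intro!: mult_left_mono)
  finally show ?thesis .
qed

text \<open>Pairing u_inv h with itself moves the adjoint onto u at \<open>cnj z\<close>, where
  \<open>growth_upto\<close> applies. The bound is unchanged since j is an isometry and |Im z| is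
  invariant under conjugation.\<close>

lemma u_inv_growth:
  assumes t: "t \<in> {0..X}"
  shows "norm (u_inv t z *v h) \<le> norm h * exp ((\<bar>Im z\<bar> + M) * X)"
proof (cases "u_inv t z *v h = 0")
  case False
  define g where "g = u_inv t z *v h"
  have "(norm g)\<^sup>2 = Re (cip g g)" by (simp add: cip_self)
  also have "cip g g = cip (u t (cnj z) *v (dirac_j *v g)) (dirac_j *v h)"
    unfolding cip_adjoint'[symmetric]
    by (subst (2) g_def)
      (simp add: u_inv_def cadjoint_dirac_j flip: matrix_vector_mul_assoc)
  also have "Re \<dots> \<le> norm (u t (cnj z) *v (dirac_j *v g)) * norm (dirac_j *v h)"
    by (rule order_trans[OF complex_Re_le_cmod norm_cip_le])
  also have "\<dots> \<le> (norm g * exp ((\<bar>Im z\<bar> + M) * X)) * norm h"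
    using growth_upto[OF t, of "cnj z" "dirac_j *v g"]
    by (intro mult_mono) (auto simp: norm_dirac_j_vector)
  finally have "norm g * norm g \<le> norm g * (norm h * exp ((\<bar>Im z\<bar> + M) * X))"
    by (simp add: power2_eq_square mult_ac)
  then show ?thesis using False by (simp add: g_def)
qed simp

text \<open>The difference d is paired with itself: the representation produces the factor w - z,
  and one power of |d| cancels. The two equal exponentials come from \<open>u_inv\<close> and from u
  at \<open>cnj z\<close>, the third from u at w, where |Im w| \<le> |Im z| + 1. The factor X is the
  length of the interval.\<close>

lemma sol_lipschitz:
  assumes t: "t \<in> {0..X}" and w: "norm (w - z) \<le> 1"
  shows "norm (u t w *v e - u t z *v e) \<le>
    norm (w - z) * (X * exp ((\<bar>Im z\<bar> + M) * X) ^ 2 * exp ((\<bar>Im z\<bar> + 1 + M) * X) * norm e)"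
proof (cases "u t w *v e = u t z *v e")
  case False
  define d where "d = u t w *v e - u t z *v e"
  define E where "E = exp ((\<bar>Im z\<bar> + M) * X)"
  define E' where "E' = exp ((\<bar>Im z\<bar> + 1 + M) * X)"
  define g where "g = u_inv t (cnj z) *v (dirac_j *v d)"
  define I where "I = integral {0..t} (\<lambda>s. cip (u s (cnj z) *v g) (u s w *v e))"
  have t0: "0 \<le> t" using t by simp
  have "cip d d = cip d (u t w *v e) - cip d (u t z *v e)"
    by (subst (2) d_def) (simp add: cip_diff_right)
  also have "\<dots> = \<i> * (w - z) * I"
    using cip_sol_representation[OF t0 g_def, of w e] cip_sol_representation[OF t0 g_def, of z e]
    by (simp add: I_def)
  finally have "norm (cip d d) = norm (\<i> * (w - z) * I)" by (rule arg_cong)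
  then have d2: "(norm d)\<^sup>2 = norm (w - z) * norm I"
    by (simp add: cip_self norm_mult norm_power)
  have "norm I \<le> ((norm d * E) * E * (norm e * E')) * (t - 0)"
    unfolding I_def
  proof (rule norm_integral_le[OF cip_integrable t0])
    fix s assume "s \<in> {0..t}"
    then have s: "s \<in> {0..X}" using t by simp
    have "norm (u s (cnj z) *v g) \<le> norm g * E"
      using growth_upto[OF s, of "cnj z" g] by (simp add: E_def)
    also have "norm g \<le> norm d * E"
      using u_inv_growth[OF t, of "cnj z" "dirac_j *v d"] by (simp add: g_def E_def norm_dirac_j_vector)
    finally have 1: "norm (u s (cnj z) *v g) \<le> norm d * E * E" by (simp add: E_def)
    have "\<bar>Im w\<bar> \<le> \<bar>Im z\<bar> + 1"
      using abs_Im_le_cmod[of "w - z"] w by simp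
    then have "exp ((\<bar>Im w\<bar> + M) * X) \<le> E'"
      using X by (auto simp: E'_def intro!: mult_right_mono)
    then have 2: "norm (u s w *v e) \<le> norm e * E'"
      by (rule order_trans[OF growth_upto[OF s] mult_left_mono]) simp
    show "norm (cip (u s (cnj z) *v g) (u s w *v e)) \<le> norm d * E * E * (norm e * E')"
      by (rule order_trans[OF norm_cip_le mult_mono[OF 1 2]]) (auto simp: E_def)
  qed (auto simp: E_def E'_def)
  also have "\<dots> \<le> ((norm d * E) * E * (norm e * E')) * X"
    using t by (intro mult_left_mono) (auto simp: E_def E'_def)
  finally have "(norm d)\<^sup>2 \<le> norm (w - z) * (((norm d * E) * E * (norm e * E')) * X)"
    unfolding d2 by (rule mult_left_mono) simp
  then have "norm d * norm d \<le> norm d * (norm (w - z) * (X * E\<^sup>2 * E' * norm e))"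
    by (simp add: power2_eq_square mult_ac)
  then show ?thesis using False by (simp add: d_def E_def E'_def)
qed (use X in auto)

end

text \<open>By \<open>cip_sol_representation\<close> the difference quotient at z is exactly \<i>
  I(w). So differentiability reduces to continuity of I at z, which \<open>sol_lipschitz\<close>
  supplies.\<close>

lemma u_entry_holomorphic:
  assumes x: "0 \<le> x"
  shows "(\<lambda>z. u x z $ i $ k) holomorphic_on UNIV"
proof -
  obtain M where M: "0 \<le> M" "\<And>t. t \<in> {0..x} \<Longrightarrow> norm (v t) \<le> M"
    using potential_bound[OF x] by blast
  define e :: "complex^('m1 + 'm2)" where "e = axis k 1"
  define a :: "complex^('m1 + 'm2)" where "a = axis i 1"
  have entry: "u x z $ i $ k = cip a (u x z *v e)" for z
    by (simp add: cip_def a_def e_def axis_def matrix_vector_mult_def if_distrib[of "\<lambda>x. _ * x"]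
        if_distrib[of cnj] if_distrib[of "\<lambda>x. x * _"] cong: if_cong)
  have "\<exists>D. ((\<lambda>z. u x z $ i $ k) has_field_derivative D) (at z)" for z
  proof -
    define g where "g = u_inv x (cnj z) *v (dirac_j *v a)"
    define I where "I = (\<lambda>w. integral {0..x} (\<lambda>t. cip (u t (cnj z) *v g) (u t w *v e)))"
    define K where "K = x * exp ((\<bar>Im z\<bar> + M) * x) ^ 2 * exp ((\<bar>Im z\<bar> + 1 + M) * x) * norm e"
    define L where "L = norm g * exp ((\<bar>Im z\<bar> + M) * x)"
    have K0: "0 \<le> K" "0 \<le> L" using x by (auto simp: K_def L_def)
    have f: "u x w $ i $ k = jform g e + \<i> * (w - z) * I w" for w
      using cip_sol_representation[OF x g_def, of w e] by (simp add: entry I_def)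
    have lip: "norm (I w - I z) \<le> L * K * x * norm (w - z)" if w: "norm (w - z) \<le> 1" for w
    proof -
      have "I w - I z = integral {0..x} (\<lambda>t. cip (u t (cnj z) *v g) (u t w *v e - u t z *v e))"
        unfolding I_def cip_diff_right
        by (intro integral_diff[symmetric] cip_integrable)
      also have "norm \<dots> \<le> (L * (norm (w - z) * K)) * (x - 0)"
      proof (rule norm_integral_le[OF _ x])
        show "(\<lambda>t. cip (u t (cnj z) *v g) (u t w *v e - u t z *v e)) integrable_on {0..x}"
          unfolding cip_diff_right by (intro integrable_diff cip_integrable)
        fix t assume t: "t \<in> {0..x}"
        have "norm (u t (cnj z) *v g) \<le> L"
          using growth_upto[OF x M t, of "cnj z" g] by (simp add: L_def)
        moreover have "norm (u t w *v e - u t z *v e) \<le> norm (w - z) * K"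
          using sol_lipschitz[OF x M t w, of e] by (simp add: K_def)
        ultimately show "norm (cip (u t (cnj z) *v g) (u t w *v e - u t z *v e)) \<le> L * (norm (w - z) * K)"
          by (intro order_trans[OF norm_cip_le] mult_mono) (use K0 in auto)
      qed (use K0 in auto)
      finally show ?thesis by (simp add: mult_ac)
    qed
    have "((\<lambda>w. \<i> * I w - \<i> * I z) \<longlongrightarrow> 0) (at z)"
    proof (rule Lim_null_comparison)
      show "\<forall>\<^sub>F w in at z. norm (\<i> * I w - \<i> * I z) \<le> L * K * x * norm (w - z)"
        unfolding eventually_at
      proof (intro exI[of _ 1] conjI ballI impI)
        fix w assume "w \<noteq> z \<and> dist w z < 1"
        then show "norm (\<i> * I w - \<i> * I z) \<le> L * K * x * norm (w - z)"
          using lip[of w] by (simp add: dist_norm norm_mult flip: right_diff_distrib)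
      qed simp
      show "((\<lambda>w. L * K * x * norm (w - z)) \<longlongrightarrow> 0) (at z)"
        by (auto intro!: tendsto_eq_intros)
    qed
    then have "((\<lambda>w. \<i> * I w) \<longlongrightarrow> \<i> * I z) (at z)"
      by (rule LIM_zero_cancel)
    then have "((\<lambda>w. (u x w $ i $ k - u x z $ i $ k) / (w - z)) \<longlongrightarrow> \<i> * I z) (at z)"
      by (rule Lim_transform_eventually) (auto simp: eventually_at_filter f)
    then show ?thesis unfolding has_field_derivative_iff by blast
  qed
  then show ?thesis
    unfolding holomorphic_on_def field_differentiable_def by auto
qed

lemma u_inv_entry_holomorphic:
  assumes "0 \<le> x"
  shows "(\<lambda>z. u_inv x z $ i $ k) holomorphic_on UNIV"
proof -
  have "(\<lambda>z. cnj (u x (cnj z) $ r $ s)) holomorphic_on UNIV" for r s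
    using holomorphic_on_compose_cnj_cnj[of "\<lambda>z. u x z $ r $ s" UNIV]
      holomorphic_on_subset[OF u_entry_holomorphic[OF assms, of r s]]
    by (simp add: o_def)
  then show ?thesis
    unfolding u_inv_def matrix_matrix_mult_def cadjoint_def
    by (simp, intro holomorphic_intros)
qed

text \<open>The coefficient is \<i> j (z + V) with V Hermitian and j j = I, so both sides equal -
  \<i> (z + V).\<close>

lemma dirac_rhs_adjoint: "(dirac_rhs v (cnj z) t)\<^sup>\<dagger> ** dirac_j = - (dirac_j ** dirac_rhs v z t)"
proof (rule matrix_eqI, rule cip_eqI)
  fix h g :: "complex^('m1 + 'm2)"
  show "cip g ((dirac_rhs v (cnj z) t)\<^sup>\<dagger> ** dirac_j *v h) = cip g (- (dirac_j ** dirac_rhs v z t) *v h)"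
    by (simp add: mat_minus_vector cip_adjoint' cip_blocks[of "dirac_rhs _ _ _ *v _"] cip_blocks[of g]
        dirac_rhs_vector dirac_j_vector cip_simps cip_adjoint algebra_simps flip: matrix_vector_mul_assoc)
qed

lemma u_inv_prim: "prim (\<lambda>x. u_inv x z) (\<lambda>t. - (u_inv t z ** dirac_rhs v z t))"
proof -
  have bl: "bounded_linear (\<lambda>M :: complex^('m1 + 'm2)^('m1 + 'm2). dirac_j ** M\<^sup>\<dagger> ** dirac_j)"
    by (intro bounded_linear_compose[OF bounded_bilinear.bounded_linear_left[OF bounded_bilinear_matrix_matrix]]
        bounded_linear_compose[OF bounded_bilinear.bounded_linear_right[OF bounded_bilinear_matrix_matrix]]
        bounded_linear_cadjoint)
  have "dirac_j ** (dirac_rhs v (cnj z) t ** u t (cnj z))\<^sup>\<dagger> ** dirac_j = - (u_inv t z ** dirac_rhs v z t)" for t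
  proof -
    have "dirac_j ** (dirac_rhs v (cnj z) t ** u t (cnj z))\<^sup>\<dagger> ** dirac_j =
        dirac_j ** (u t (cnj z))\<^sup>\<dagger> ** ((dirac_rhs v (cnj z) t)\<^sup>\<dagger> ** dirac_j)"
      by (simp add: cadjoint_mult matrix_mul_assoc)
    also have "\<dots> = - (dirac_j ** (u t (cnj z))\<^sup>\<dagger> ** (dirac_j ** dirac_rhs v z t))"
      unfolding dirac_rhs_adjoint
      by (rule bounded_bilinear.minus_right[OF bounded_bilinear_matrix_matrix])
    finally show ?thesis by (simp add: u_inv_def matrix_mul_assoc)
  qed
  with prim_bounded_linear[OF bl u_prim[of "cnj z"]] show ?thesis
    by (simp add: u_inv_def)
qed

end

section \<open>Decay of the Weyl solutions and of their duals at the conjugate point\<close>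

context bounded_dirac
begin

context
  fixes X M :: real and z :: complex and \<Phi> :: "complex^'m1^'m2"
  assumes X: "0 \<le> X" and M: "0 \<le> M" "\<And>t. t \<in> {0..X} \<Longrightarrow> norm (v t) \<le> M"
    and z: "z \<in> \<complex>\<^sub>+" and \<Phi>: "\<And>x. 0 \<le> x \<Longrightarrow> \<Phi> \<in> weyl_set u x z"
begin

text \<open>Membership in all Weyl sets up to X makes the upper block dominate on the whole
  interval, so \<open>decay_up\<close> applies; the factor 2 accounts for the lower block.\<close>

lemma weyl_solution_decay:
  "norm (u X z *v stack g (\<Phi> *v g)) \<le> 2 * norm g * exp ((M - Im z) * X)"
proof -
  have le: "norm (lo (u t z *v stack g (\<Phi> *v g))) \<le> norm (up (u t z *v stack g (\<Phi> *v g)))"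
    if "t \<in> {0..X}" for t
    using weyl_setD[OF _ z \<Phi>] that by simp
  have "norm (u X z *v stack g (\<Phi> *v g)) \<le> 2 * norm (up (u X z *v stack g (\<Phi> *v g)))"
    using norm_le_blocks[of "u X z *v stack g (\<Phi> *v g)"] le[of X] X by simp
  also have "norm (up (u X z *v stack g (\<Phi> *v g))) \<le> norm g * exp ((M - Im z) * X)"
    using decay_up[OF X M le] by simp
  finally show ?thesis by simp
qed

text \<open>The solution is \<open>j\<close>-orthogonal to the graph of a contraction, so its upper block is
  dominated by its lower block.\<close>

lemma dual_weyl_solution_le:
  fixes k
  assumes t: "0 \<le> t"
  defines "y \<equiv> u t (cnj z) *v stack (\<Phi>\<^sup>\<dagger> *v k) k"
  shows "norm (up y) \<le> norm (lo y)"
proof (cases "up y = 0")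
  case False
  \<comment> \<open>At t the upper blocks of the Weyl solutions fill the whole space, because p is
    injective. So some Weyl solution w has the same upper block as y, and orthogonality to it
    compares the blocks of y.\<close>
  define p where "p = upper_row ** (u t z ** graph_matrix \<Phi>)"
  have p: "p *v g = up (u t z *v stack g (\<Phi> *v g))" for g
    by (simp add: p_def upper_row_vector graph_matrix_vector flip: matrix_vector_mul_assoc)
  have "invertible p"
  proof (rule invertible_if_injective)
    fix g assume "p *v g = 0"
    then have "u t z *v stack g (\<Phi> *v g) = 0"
      using weyl_setD[OF t z \<Phi>[OF t], of g] by (intro block_vector_eqI) (auto simp: p)
    then have "stack g (\<Phi> *v g) = (0 :: complex^('m1 + 'm2))" by (rule u_injective[OF t])
    then show "g = 0" by (metis up_stack up_zero)
  qed
  then have inv: "p ** matrix_inv p = mat 1" by (rule matrix_inv_left_right)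
  define g where "g = matrix_inv p *v up y"
  define w where "w = u t z *v stack g (\<Phi> *v g)"
  have up_w: "up w = up y"
    using p[of g] inv by (simp add: w_def g_def matrix_vector_mul_assoc)
  have "jform y w = 0"
    unfolding y_def w_def jform_conserved[OF t] by (simp add: jform_def cip_adjoint)
  then have "cip (up y) (up y) = cip (lo y) (lo w)" by (simp add: jform_def up_w)
  then have "(norm (up y))\<^sup>2 = Re (cip (lo y) (lo w))"
    by (metis Re_complex_of_real cip_self)
  also have "\<dots> \<le> norm (lo y) * norm (lo w)"
    by (rule order_trans[OF complex_Re_le_cmod norm_cip_le])
  also have "\<dots> \<le> norm (lo y) * norm (up y)"
    using weyl_setD[OF t z \<Phi>[OF t], of g] unfolding up_w[symmetric] w_def
    by (intro mult_left_mono) auto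
  finally show ?thesis using False by (simp add: power2_eq_square)
qed simp

lemma dual_weyl_solution_decay:
  "norm (u X (cnj z) *v stack (\<Phi>\<^sup>\<dagger> *v k) k) \<le> 2 * norm k * exp ((M - Im z) * X)"
proof -
  define h where "h = stack (\<Phi>\<^sup>\<dagger> *v k) k"
  have le: "norm (up (u t (cnj z) *v h)) \<le> norm (lo (u t (cnj z) *v h))" if "t \<in> {0..X}" for t
    using dual_weyl_solution_le that by (simp add: h_def)
  have "norm (u X (cnj z) *v h) \<le> 2 * norm (lo (u X (cnj z) *v h))"
    using norm_le_blocks[of "u X (cnj z) *v h"] le[of X] X by simp
  also have "norm (lo (u X (cnj z) *v h)) \<le> norm (lo h) * exp ((M + Im (cnj z)) * X)"
    by (rule decay_lo[OF X M le])
  finally show ?thesis by (simp add: h_def)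
qed

text \<open>This vector measures how far the initial value g lies off the graph of \<Phi>. It is
  detected by the form of j against the dual vector with lower block k; the form is conserved, so at
  X it pairs h with a decaying dual solution. This smallness later compensates the growth of the
  other system.\<close>

lemma weyl_coordinate_bound:
  fixes h
  defines "g \<equiv> u_inv X z *v h"
  shows "norm (lo g - \<Phi> *v up g) \<le> 2 * norm h * exp ((M - Im z) * X)"
proof (cases "lo g = \<Phi> *v up g")
  case False
  define k where "k = lo g - \<Phi> *v up g"
  have ug: "u X z *v g = h"
    by (simp add: g_def matrix_vector_mul_assoc u_inv_right[OF X])
  have "jform (stack (\<Phi>\<^sup>\<dagger> *v k) k) g = cip k (\<Phi> *v up g) - cip k (lo g)"
    by (simp add: jform_def cip_adjoint)
  also have "\<dots> = - cip k k" by (simp add: k_def cip_diff_right)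
  finally have "- cip k k = jform (u X (cnj z) *v stack (\<Phi>\<^sup>\<dagger> *v k) k) h"
    using jform_conserved[OF X, of z "stack (\<Phi>\<^sup>\<dagger> *v k) k" g] by (simp add: ug)
  then have "norm (- cip k k) \<le> norm (u X (cnj z) *v stack (\<Phi>\<^sup>\<dagger> *v k) k) * norm h"
    by (simp only: norm_jform_le)
  also have "\<dots> \<le> 2 * norm k * exp ((M - Im z) * X) * norm h"
    by (intro mult_right_mono dual_weyl_solution_decay) simp
  finally have "norm k * norm k \<le> norm k * (2 * norm h * exp ((M - Im z) * X))"
    by (simp add: norm_cip_self mult_ac)
  then show ?thesis using False by (simp add: k_def)
qed simp

end

end

section \<open>The transfer matrix between two systems with the same Weyl function\<close>

locale dirac_pair = S1: bounded_dirac v1 u1 + S2: bounded_dirac v2 u2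
  for v1 v2 :: "real \<Rightarrow> complex^'m2^'m1"
    and u1 u2 :: "real \<Rightarrow> complex \<Rightarrow> complex^('m1::finite + 'm2::finite)^('m1 + 'm2)" +
  fixes \<phi> :: "complex \<Rightarrow> complex^'m1^'m2"
  assumes weyl1: "z \<in> \<complex>\<^sub>+ \<Longrightarrow> 0 \<le> x \<Longrightarrow> \<phi> z \<in> weyl_set u1 x z"
    and weyl2: "z \<in> \<complex>\<^sub>+ \<Longrightarrow> 0 \<le> x \<Longrightarrow> \<phi> z \<in> weyl_set u2 x z"
begin

definition transfer where "transfer x z = u2 x z ** S1.u_inv x z"

text \<open>The initial value g is split into a graph part and a purely lower part k. On the first,
  growth of the inverse of u1 meets decay of u2; on the second, the small coordinate meets growth of
  u2. Each product contributes 2 exp (2 M X).\<close>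

lemma transfer_bound_upper:
  assumes X: "0 \<le> X" and M: "0 \<le> M" "\<And>t. t \<in> {0..X} \<Longrightarrow> norm (v1 t) \<le> M"
    "\<And>t. t \<in> {0..X} \<Longrightarrow> norm (v2 t) \<le> M" and z: "z \<in> \<complex>\<^sub>+"
  shows "norm (transfer X z *v h) \<le> 4 * exp (2 * M * X) * norm h"
proof -
  have Im: "\<bar>Im z\<bar> = Im z" using z by (simp add: upper_half_plane_def)
  define g where "g = S1.u_inv X z *v h"
  define k where "k = lo g - \<phi> z *v up g"
  have "g = stack (up g) (\<phi> z *v up g) + stack 0 k"
    by (rule block_vector_eqI) (simp_all add: up_add lo_add k_def)
  then have "transfer X z *v h = u2 X z *v stack (up g) (\<phi> z *v up g) + u2 X z *v stack 0 k"
    by (metis g_def matrix_vector_mul_assoc matrix_vector_right_distrib transfer_def)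
  also have "norm \<dots> \<le> 2 * norm (up g) * exp ((M - Im z) * X) + norm k * exp ((Im z + M) * X)"
  proof (intro order_trans[OF norm_triangle_ineq] add_mono)
    show "norm (u2 X z *v stack (up g) (\<phi> z *v up g)) \<le> 2 * norm (up g) * exp ((M - Im z) * X)"
      by (rule S2.weyl_solution_decay[OF X M(1,3) z weyl2[OF z]])
    have "norm (stack 0 k :: complex^('m1 + 'm2)) = norm k"
      by (rule power2_eq_imp_eq) (simp_all add: norm_blocks)
    then show "norm (u2 X z *v stack 0 k) \<le> norm k * exp ((Im z + M) * X)"
      using S2.growth[OF X M(1,3), of z "stack 0 k"] by (simp add: Im)
  qed
  also have "\<dots> \<le> 2 * (norm h * exp ((Im z + M) * X)) * exp ((M - Im z) * X) +
      (2 * norm h * exp ((M - Im z) * X)) * exp ((Im z + M) * X)"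
  proof (intro add_mono mult_right_mono mult_left_mono)
    have "norm g \<le> norm h * exp ((\<bar>Im z\<bar> + M) * X)"
      unfolding g_def by (rule S1.u_inv_growth[OF X M(1,2)]) (use X in auto)
    then show "norm (up g) \<le> norm h * exp ((Im z + M) * X)"
      using norm_up_le[of g] by (simp add: Im)
    show "norm k \<le> 2 * norm h * exp ((M - Im z) * X)"
      unfolding k_def g_def by (rule S1.weyl_coordinate_bound[OF X M(1,2) z weyl1[OF z]])
  qed auto
  also have "\<dots> = 4 * (exp ((Im z + M) * X) * exp ((M - Im z) * X)) * norm h" by simp
  also have "exp ((Im z + M) * X) * exp ((M - Im z) * X) = exp (2 * M * X)"
    by (simp add: exp_add[symmetric] algebra_simps)
  finally show ?thesis .
qed

lemma transfer_entry_holomorphic: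
  assumes "0 \<le> x"
  shows "(\<lambda>z. transfer x z $ i $ k) holomorphic_on UNIV"
  unfolding transfer_def matrix_matrix_mult_def
  by (simp, intro holomorphic_intros S2.u_entry_holomorphic S1.u_inv_entry_holomorphic assms)

end

lemma dirac_pair_commute: "dirac_pair v1 v2 u1 u2 \<phi> \<Longrightarrow> dirac_pair v2 v1 u2 u1 \<phi>"
  by (simp add: dirac_pair_def dirac_pair_axioms_def)

context dirac_pair
begin

text \<open>The adjoint of the transfer matrix at z is j times the transfer matrix of the
  interchanged pair at \<open>cnj z\<close> times j, so the bound in the upper half-plane carries
  over.\<close>

lemma transfer_bound_lower:
  assumes X: "0 \<le> X" and M: "0 \<le> M" "\<And>t. t \<in> {0..X} \<Longrightarrow> norm (v1 t) \<le> M"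
    "\<And>t. t \<in> {0..X} \<Longrightarrow> norm (v2 t) \<le> M" and z: "cnj z \<in> \<complex>\<^sub>+"
  shows "norm (transfer X z *v h) \<le> 4 * exp (2 * M * X) * norm h"
proof (cases "transfer X z *v h = 0")
  case False
  interpret P: dirac_pair v2 v1 u2 u1 \<phi>
    by (rule dirac_pair_commute) (rule dirac_pair_axioms)
  define g where "g = transfer X z *v h"
  have "cip g g = cip g (u2 X z *v (dirac_j *v ((u1 X (cnj z))\<^sup>\<dagger> *v (dirac_j *v h))))"
    by (subst (2) g_def) (simp add: transfer_def S1.u_inv_def flip: matrix_vector_mul_assoc)
  also have "\<dots> = cip (P.transfer X (cnj z) *v (dirac_j *v g)) (dirac_j *v h)"
  proof -
    have "P.transfer X (cnj z) *v (dirac_j *v g) = u1 X (cnj z) *v (dirac_j *v ((u2 X z)\<^sup>\<dagger> *v (dirac_j *v (dirac_j *v g))))"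
      by (simp add: P.transfer_def S2.u_inv_def flip: matrix_vector_mul_assoc)
    also have "dirac_j *v (dirac_j *v g) = g"
      by (simp add: matrix_vector_mul_assoc dirac_j_dirac_j)
    finally show ?thesis
      using cip_adjoint[of dirac_j "(u2 X z)\<^sup>\<dagger> *v g" "(u1 X (cnj z))\<^sup>\<dagger> *v (dirac_j *v h)"]
        cip_adjoint[of "u2 X z" g] cip_adjoint'[of _ "u1 X (cnj z)" "dirac_j *v h"]
      by (simp only: cadjoint_dirac_j)
  qed
  finally have "norm (cip g g) \<le> norm (P.transfer X (cnj z) *v (dirac_j *v g)) * norm (dirac_j *v h)"
    by (simp only: norm_cip_le)
  also have "\<dots> \<le> (4 * exp (2 * M * X) * norm (dirac_j *v g)) * norm (dirac_j *v h)"
    by (intro mult_right_mono P.transfer_bound_upper[OF X M(1,3,2) z] norm_ge_zero)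
  finally have "norm g * norm g \<le> norm g * (4 * exp (2 * M * X) * norm h)"
    by (simp add: norm_cip_self norm_dirac_j_vector mult_ac)
  then show ?thesis using False by (simp add: g_def)
qed simp

lemma transfer_constant:
  assumes X: "0 \<le> X"
  shows "transfer X z = transfer X 0"
proof -
  obtain M1 M2 where M1: "0 \<le> M1" "\<And>t. t \<in> {0..X} \<Longrightarrow> norm (v1 t) \<le> M1"
    and M2: "0 \<le> M2" "\<And>t. t \<in> {0..X} \<Longrightarrow> norm (v2 t) \<le> M2"
    using S1.potential_bound[OF X] S2.potential_bound[OF X] by metis
  define M where "M = max M1 M2"
  have M: "0 \<le> M" "\<And>t. t \<in> {0..X} \<Longrightarrow> norm (v1 t) \<le> M" "\<And>t. t \<in> {0..X} \<Longrightarrow> norm (v2 t) \<le> M"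
    unfolding M_def using M1(1) order_trans[OF M1(2) max.cobounded1] order_trans[OF M2(2) max.cobounded2]
    by simp_all
  have "transfer X z $ i $ k = transfer X 0 $ i $ k" for i k
  proof -
    define f where "f = (\<lambda>z. transfer X z $ i $ k)"
    define K where "K = 4 * exp (2 * M * X)"
    have hol: "f holomorphic_on UNIV" unfolding f_def by (rule transfer_entry_holomorphic[OF X])
    have f_le: "norm (f w) \<le> norm (transfer X w *v axis k 1)" for w
    proof -
      have "f w = (transfer X w *v axis k 1) $ i"
        by (simp add: f_def matrix_vector_mult_def axis_def if_distrib[of "\<lambda>x. _ * x"] cong: if_cong)
      then show ?thesis by (simp add: Finite_Cartesian_Product.norm_nth_le)
    qed
    have off: "norm (f w) \<le> K" if "Im w > 0 \<or> Im w < 0" for w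
      using that order_trans[OF f_le transfer_bound_upper[OF X M]] order_trans[OF f_le transfer_bound_lower[OF X M]]
      by (auto simp: K_def upper_half_plane_def norm_axis_1)
    have "norm (f w) \<le> K" for w
    proof (cases "Im w > 0 \<or> Im w < 0")
      case False
      \<comment> \<open>Real points lie in the closure of the upper half-plane, and f is continuous,
        so the bound extends to them.\<close>
      have "closure {w. Im w > 0} = {w. Im w \<ge> 0}"
        using closure_halfspace_gt[of \<i> 0] by (simp add: inner_complex_def)
      then show ?thesis
        using False off holomorphic_on_imp_continuous_on[OF hol]
        by (intro continuous_on_closure_norm_le[of "{w. Im w > 0}" f])
          (auto intro: continuous_on_subset)
    qed (rule off)
    then have "bounded (range f)" by (auto simp: bounded_iff)
    then have "f constant_on UNIV" by (rule Liouville_theorem[OF hol])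
    then show ?thesis unfolding constant_on_def f_def by (metis UNIV_I)
  qed
  then show ?thesis by (simp add: vec_eq_iff)
qed

text \<open>Since the transfer matrix does not depend on z, its value at 0 satisfies the equation
  for every z simultaneously; different values of z can now be compared.\<close>

lemma transfer_prim:
  "prim (\<lambda>x. transfer x 0) (\<lambda>t. dirac_rhs v2 z t ** transfer t 0 - transfer t 0 ** dirac_rhs v1 z t)"
proof (rule prim_cong[OF prim_bilinear[OF bounded_bilinear_matrix_matrix S2.u_prim[of z] S1.u_inv_prim[of z]]])
  fix x :: real assume x: "0 \<le> x"
  show "u2 x z ** S1.u_inv x z = transfer x 0"
    using transfer_constant[OF x, of z] by (simp add: transfer_def)
  then show "dirac_rhs v2 z x ** u2 x z ** S1.u_inv x z + u2 x z ** - (S1.u_inv x z ** dirac_rhs v1 z x) =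
      dirac_rhs v2 z x ** transfer x 0 - transfer x 0 ** dirac_rhs v1 z x"
    using bounded_bilinear.minus_right[OF bounded_bilinear_matrix_matrix, of "u2 x z" "S1.u_inv x z ** dirac_rhs v1 z x"]
    by (simp add: matrix_mul_assoc[symmetric])
      (simp add: matrix_mul_assoc)
qed

text \<open>Subtracting the equations for z = 1 and z = 0 cancels both potentials and leaves \<i> (j
  T - T j). This is continuous and integrates to zero, so it vanishes everywhere.\<close>

lemma transfer_commutes:
  assumes x: "0 \<le> x"
  shows "dirac_j ** transfer x 0 = transfer x 0 ** dirac_j"
proof -
  let ?T = "\<lambda>t. transfer t 0"
  define f where "f = (\<lambda>z t. dirac_rhs v2 z t ** ?T t - ?T t ** dirac_rhs v1 z t)"
  have diff: "f 1 t - f 0 t = \<i> *\<^sub>m (dirac_j ** ?T t - ?T t ** dirac_j)" for t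
  proof (rule matrix_eqI)
    fix h
    have rhs: "dirac_rhs v 1 t *v y = \<i> *s (dirac_j *v y) + dirac_rhs v 0 t *v y"
      for v :: "real \<Rightarrow> complex^'m2^'m1" and y
      by (simp add: dirac_rhs_def mat_scale_vector matrix_vector_mult_add_rdistrib vector_add_ldistrib)
    show "(f 1 t - f 0 t) *v h = \<i> *\<^sub>m (dirac_j ** ?T t - ?T t ** dirac_j) *v h"
      by (simp add: f_def matrix_vector_mult_diff_rdistrib rhs mat_scale_vector vector_ssub_ldistrib
          matrix_vector_right_distrib vector_scalar_commute flip: matrix_vector_mul_assoc)
  qed
  have cT: "continuous_on {0..} ?T" by (rule prim_continuous_atLeast[OF transfer_prim])
  have "f 1 x = f 0 x"
  proof (rule prim_eq_imp_integrand_eq[OF _ _ _ x])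
    show "prim ?T (f 1)" "prim ?T (f 0)" unfolding f_def by (rule transfer_prim)+
    show "continuous_on {0..} (\<lambda>t. f 1 t - f 0 t)"
      unfolding diff
      by (intro bounded_linear.continuous_on[OF bounded_linear_mat_scale] continuous_on_diff
          bounded_bilinear.continuous_on[OF bounded_bilinear_matrix_matrix] continuous_on_const cT)
  qed
  then have "\<i> *\<^sub>m (dirac_j ** ?T x - ?T x ** dirac_j) = 0" using diff[of x] by simp
  then show ?thesis by (simp add: vec_eq_iff)
qed

lemma transfer_off_diagonal:
  assumes x: "0 \<le> x"
  shows "lo (transfer x 0 *v stack p 0) = 0" "up (transfer x 0 *v stack 0 q) = 0"
proof -
  have *: "dirac_j *v (transfer x 0 *v h) = transfer x 0 *v (dirac_j *v h)" for h
    using transfer_commutes[OF x] by (simp add: matrix_vector_mul_assoc)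
  have "lo (transfer x 0 *v stack p 0) = - lo (transfer x 0 *v stack p 0)"
    using arg_cong[OF *[of "stack p 0"], of lo] by (simp add: dirac_j_vector)
  then show "lo (transfer x 0 *v stack p 0) = 0" by (simp only: vec_eq_iff vector_uminus_component) simp
  have "stack (0 :: complex^'m1) (- q) = - stack 0 q"
    by (simp add: stack_def vec_eq_iff split: sum.split)
  moreover have "up (- y) = - up y" for y :: "complex^('m1 + 'm2)" by (simp add: up_def vec_eq_iff)
  ultimately have "up (transfer x 0 *v stack 0 q) = - up (transfer x 0 *v stack 0 q)"
    using arg_cong[OF *[of "stack 0 q"], of up] by (simp add: dirac_j_vector vector_minus_mult)
  then show "up (transfer x 0 *v stack 0 q) = 0" by (simp only: vec_eq_iff vector_uminus_component) simp
qed

lemma transfer_0: "transfer 0 0 = mat 1"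
  using S1.u_inv_left[of 0 0] by (simp add: transfer_def S1.u_0 S2.u_0)

lemma transfer_vector_prim:
  "prim (\<lambda>x. transfer x 0 *v h)
    (\<lambda>t. dirac_rhs v2 0 t *v (transfer t 0 *v h) - transfer t 0 *v (dirac_rhs v1 0 t *v h))"
  using prim_bounded_linear[OF bounded_bilinear.bounded_linear_left[OF bounded_bilinear_matrix_vector] transfer_prim[of 0]]
  by (simp add: matrix_vector_mult_diff_rdistrib flip: matrix_vector_mul_assoc)

lemma dirac_rhs_0_stack:
  "dirac_rhs v 0 t *v stack p q = stack (\<i> *s (v t *v q)) (- \<i> *s ((v t)\<^sup>\<dagger> *v p))"
  by (rule block_vector_eqI) (simp_all add: dirac_rhs_vector vector_smult_lneg)

text \<open>At z = 0 the coefficients are block off-diagonal while T is block diagonal, so the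
  diagonal blocks of the derivative vanish and T keeps its initial value.\<close>

lemma transfer_eq_id:
  assumes x: "0 \<le> x"
  shows "transfer x 0 = mat 1"
proof -
  have "prim (\<lambda>x. up (transfer x 0 *v stack p 0)) (\<lambda>t. 0)" for p
  proof (rule prim_cong[OF prim_bounded_linear[OF bounded_linear_up transfer_vector_prim[of "stack p 0"]] refl])
    fix t :: real assume t: "0 \<le> t"
    then show "up (dirac_rhs v2 0 t *v (transfer t 0 *v stack p 0) - transfer t 0 *v (dirac_rhs v1 0 t *v stack p 0)) = 0"
      by (simp add: dirac_rhs_0_stack transfer_off_diagonal up_diff dirac_rhs_vector)
  qed
  from primD(3)[OF this x] have upT: "up (transfer x 0 *v stack p 0) = p" for p
    by (simp add: transfer_0)
  have "prim (\<lambda>x. lo (transfer x 0 *v stack 0 q)) (\<lambda>t. 0)" for q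
  proof (rule prim_cong[OF prim_bounded_linear[OF bounded_linear_lo transfer_vector_prim[of "stack 0 q"]] refl])
    fix t :: real assume t: "0 \<le> t"
    then show "lo (dirac_rhs v2 0 t *v (transfer t 0 *v stack 0 q) - transfer t 0 *v (dirac_rhs v1 0 t *v stack 0 q)) = 0"
      by (simp add: dirac_rhs_0_stack transfer_off_diagonal lo_diff dirac_rhs_vector)
  qed
  from primD(3)[OF this x] have loT: "lo (transfer x 0 *v stack 0 q) = q" for q
    by (simp add: transfer_0)
  show ?thesis
  proof (rule matrix_eqI)
    fix h :: "complex^('m1 + 'm2)"
    have "h = stack (up h) 0 + stack 0 (lo h)" by (simp flip: stack_add)
    then have "transfer x 0 *v h = transfer x 0 *v stack (up h) 0 + transfer x 0 *v stack 0 (lo h)"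
      by (metis matrix_vector_right_distrib)
    then show "transfer x 0 *v h = mat 1 *v h"
      by (intro block_vector_eqI) (simp_all add: up_add lo_add upT loT transfer_off_diagonal[OF x])
  qed
qed

lemma potentials_AE_eq: "AE x in lebesgue_on {0..}. v2 x = v1 x"
proof -
  define d where "d = (\<lambda>t. v2 t - v1 t)"
  have "AE x in lebesgue_on {0..}. d x $ a $ b = 0" for a b
  proof (rule AE_zero_if_integral_zero)
    \<comment> \<open>With T = I the equation says that j times the difference of the two V
      integrates to zero. The unit vector with index b, the component a and the factor - \<i>
      extract one entry of d.\<close>
    have "prim (\<lambda>x. up (transfer x 0 *v stack 0 (axis b 1))) (\<lambda>t. \<i> *s (d t *v axis b 1))"
      by (rule prim_cong[OF prim_bounded_linear[OF bounded_linear_up transfer_vector_prim[of "stack 0 (axis b 1)"]] refl])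
        (simp add: transfer_eq_id dirac_rhs_0_stack up_diff d_def matrix_vector_mult_diff_rdistrib vector_ssub_ldistrib)
    then have "prim (\<lambda>x. up (transfer x 0 *v stack 0 (axis b 1)) $ a) (\<lambda>t. (\<i> *s (d t *v axis b 1)) $ a)"
      by (rule prim_bounded_linear[OF bounded_linear_vec_nth])
    then have "prim (\<lambda>x. - \<i> * up (transfer x 0 *v stack 0 (axis b 1)) $ a) (\<lambda>t. - \<i> * (\<i> *s (d t *v axis b 1)) $ a)"
      by (rule prim_bounded_linear[OF bounded_linear_mult_right])
    moreover have "- \<i> * (\<i> *s (d t *v axis b 1)) $ a = d t $ a $ b" for t
      by (simp add: matrix_vector_mult_def axis_def if_distrib[of "\<lambda>x. _ * x"] cong: if_cong)
    ultimately have p: "prim (\<lambda>x. - \<i> * up (transfer x 0 *v stack 0 (axis b 1)) $ a) (\<lambda>t. d t $ a $ b)"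
      by simp
    fix x :: real assume x: "0 \<le> x"
    show "(\<lambda>t. d t $ a $ b) absolutely_integrable_on {0..x}" by (rule primD(1)[OF p x])
    show "integral {0..x} (\<lambda>t. d t $ a $ b) = 0"
      using primD(3)[OF p x] by (simp add: transfer_eq_id x)
  qed
  then have "AE x in lebesgue_on {0..}. \<forall>a b. d x $ a $ b = 0"
    unfolding AE_all_countable by blast
  then show ?thesis
    by eventually_elim (simp add: d_def vec_eq_iff)
qed

end

section \<open>Existence of fundamental solutions\<close>

primrec picard :: "(real \<Rightarrow> complex^'n^'n) \<Rightarrow> nat \<Rightarrow> real \<Rightarrow> complex^'n^'n" where
  "picard M 0 = (\<lambda>x. mat 1)"
| "picard M (Suc n) = (\<lambda>x. mat 1 + integral {0..x} (\<lambda>t. M t ** picard M n t))"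

lemma picard_continuous:
  assumes "continuous_on {0..X} M"
  shows "continuous_on {0..X} (picard M n)"
proof (induction n)
  case (Suc n)
  then show ?case
    by (auto intro!: continuous_intros indefinite_integral_continuous_1 integrable_continuous_interval
        bounded_bilinear.continuous_on[OF bounded_bilinear_matrix_matrix] assms)
qed (simp add: continuous_intros)

text \<open>The weight exp (2 K x) makes the integral operator a contraction: integrating K exp (2 K
  t) over [0, x] gives at most half of the weight. So a geometric series works on every
  interval.\<close>

lemma picard_step:
  fixes M :: "real \<Rightarrow> complex^'n^'n"
  assumes c: "continuous_on {0..X} M" and K: "0 < K" "\<And>t. t \<in> {0..X} \<Longrightarrow> norm (M t) \<le> K"
    and x: "x \<in> {0..X}"
  shows "norm (picard M (Suc n) x - picard M n x) \<le> norm (mat 1 :: complex^'n^'n) * (1 / 2) ^ n * exp (2 * K * x)"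
  using x
proof (induction n arbitrary: x)
  case 0
  have "norm (integral {0..x} (\<lambda>t. M t ** mat 1)) \<le> (K * norm (mat 1 :: complex^'n^'n)) * (x - 0)"
  proof (intro norm_integral_le integrable_continuous_interval)
    show "continuous_on {0..x} (\<lambda>t. M t ** mat 1)"
      using 0 by (auto intro: continuous_on_subset[OF c])
    fix t assume "t \<in> {0..x}"
    then show "norm (M t ** (mat 1 :: complex^'n^'n)) \<le> K * norm (mat 1 :: complex^'n^'n)"
      using 0 by (intro order_trans[OF norm_matrix_mult_le] mult_right_mono K(2)) auto
  qed (use K 0 in auto)
  also have "\<dots> \<le> norm (mat 1 :: complex^'n^'n) * exp (2 * K * x)"
  proof -
    have "K * x \<le> exp (2 * K * x)"
    proof -
      have "0 \<le> K * x" using K(1) 0 by simp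
      then show ?thesis using exp_ge_add_one_self[of "2 * K * x"] by linarith
    qed
    then have "norm (mat 1 :: complex^'n^'n) * (K * x) \<le> norm (mat 1 :: complex^'n^'n) * exp (2 * K * x)"
      by (rule mult_left_mono) simp
    then show ?thesis by (simp add: mult_ac)
  qed
  finally show ?case by simp
next
  case (Suc n)
  define D where "D = norm (mat 1 :: complex^'n^'n) * (1 / 2) ^ n"
  define g where "g = (\<lambda>t. K * (D * exp (2 * K * t)))"
  have cM: "continuous_on {0..x} M" by (rule continuous_on_subset[OF c]) (use Suc.prems in auto)
  have int: "(\<lambda>t. M t ** picard M m t) integrable_on {0..x}" for m
    by (intro integrable_continuous_interval bounded_bilinear.continuous_on[OF bounded_bilinear_matrix_matrix]
        cM picard_continuous)
  have hi: "(g has_integral (D / 2 * exp (2 * K * x) - D / 2 * exp (2 * K * 0))) {0..x}"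
    unfolding g_def
    by (rule fundamental_theorem_of_calculus)
      (use Suc.prems in \<open>auto intro!: derivative_eq_intros
        simp: has_real_derivative_iff_has_vector_derivative[symmetric]\<close>)
  have "picard M (Suc (Suc n)) x - picard M (Suc n) x =
      integral {0..x} (\<lambda>t. M t ** picard M (Suc n) t) - integral {0..x} (\<lambda>t. M t ** picard M n t)"
    by simp
  also have "\<dots> = integral {0..x} (\<lambda>t. M t ** (picard M (Suc n) t - picard M n t))"
    unfolding bounded_bilinear.diff_right[OF bounded_bilinear_matrix_matrix]
    by (rule integral_diff[OF int int, symmetric])
  also have "norm \<dots> \<le> integral {0..x} g"
  proof (rule integral_norm_bound_integral)
    show "(\<lambda>t. M t ** (picard M (Suc n) t - picard M n t)) integrable_on {0..x}"
      unfolding bounded_bilinear.diff_right[OF bounded_bilinear_matrix_matrix]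
      by (rule integrable_diff[OF int int])
    show "g integrable_on {0..x}" using hi by blast
    fix t assume "t \<in> {0..x}"
    then have t: "t \<in> {0..X}" using Suc.prems by auto
    show "norm (M t ** (picard M (Suc n) t - picard M n t)) \<le> g t"
      unfolding g_def D_def
      by (intro order_trans[OF norm_matrix_mult_le] mult_mono K(2) Suc.IH t) (use K in auto)
  qed
  also have "\<dots> = D / 2 * exp (2 * K * x) - D / 2"
    using integral_unique[OF hi] by simp
  also have "\<dots> \<le> norm (mat 1 :: complex^'n^'n) * (1 / 2) ^ Suc n * exp (2 * K * x)"
    by (simp add: D_def)
  finally show ?case .
qed

text \<open>Besides the fundamental solution, this also provides the auxiliary solution from which
  the derivative of \<Sigma>(x) inverse is found.\<close>

lemma linear_ode_exists:
  fixes M :: "real \<Rightarrow> complex^'n^'n"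
  assumes c: "continuous_on {0..} M"
  obtains U where "U 0 = mat 1" "prim U (\<lambda>t. M t ** U t)"
proof -
  define U where "U = (\<lambda>x. mat 1 + (\<Sum>k. picard M (Suc k) x - picard M k x))"
  have cX: "continuous_on {0..X} M" for X by (rule continuous_on_subset[OF c]) auto
  have ul: "uniform_limit {0..X} (picard M) U sequentially" if X: "0 \<le> X" for X
  proof -
    obtain K0 where K0: "\<And>t. t \<in> {0..X} \<Longrightarrow> norm (M t) \<le> K0"
      using compact_imp_bounded[OF compact_continuous_image[OF cX[of X] compact_Icc]]
      unfolding bounded_iff by blast
    define K where "K = \<bar>K0\<bar> + 1"
    have K: "0 < K" "\<And>t. t \<in> {0..X} \<Longrightarrow> norm (M t) \<le> K"
      unfolding K_def using K0 by (force, smt (verit))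
    have "uniform_limit {0..X} (\<lambda>n x. \<Sum>k<n. picard M (Suc k) x - picard M k x)
        (\<lambda>x. \<Sum>k. picard M (Suc k) x - picard M k x) sequentially"
    proof (rule Weierstrass_m_test)
      show "summable (\<lambda>n. norm (mat 1 :: complex^'n^'n) * (1 / 2) ^ n * exp (2 * K * X))"
        by (intro summable_mult summable_mult2 summable_geometric) auto
      show "norm (picard M (Suc n) x - picard M n x)
          \<le> norm (mat 1 :: complex^'n^'n) * (1 / 2) ^ n * exp (2 * K * X)" if x: "x \<in> {0..X}" for n x
        by (rule order_trans[OF picard_step[OF cX K x] mult_left_mono]) (use K(1) x in auto)
    qed
    from uniform_limit_add[OF uniform_limit_const[of "\<lambda>x. mat 1 :: complex^'n^'n"] this]
    have "uniform_limit {0..X} (\<lambda>n x. mat 1 + (\<Sum>k<n. picard M (Suc k) x - picard M k x)) U sequentially"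
      by (simp only: U_def)
    moreover have "mat 1 + (\<Sum>k<n. picard M (Suc k) x - picard M k x) = picard M n x" for n x
      using sum_lessThan_telescope[of "\<lambda>k. picard M k x" n] by (simp del: picard.simps(2))
    ultimately show ?thesis by simp
  qed
  have cU: "continuous_on {0..X} U" if "0 \<le> X" for X
    by (rule uniform_limit_theorem[OF always_eventually[OF allI[OF picard_continuous[OF cX]]] ul[OF that]]) simp
  have eq: "U X = mat 1 + integral {0..X} (\<lambda>t. M t ** U t)" if X: "0 \<le> X" for X
  proof -
    have bdd: "bounded (M ` {0..X})" "bounded (U ` {0..X})"
      by (intro compact_imp_bounded compact_continuous_image cX cU[OF X]; simp)+
    have "uniform_limit {0..X} (\<lambda>n t. M t ** picard M n t) (\<lambda>t. M t ** U t) sequentially"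
      by (rule bounded_bilinear.bounded_uniform_limit[OF bounded_bilinear_matrix_matrix
            uniform_limit_const ul[OF X] bdd(2,1)])
    then obtain I J where IJ: "\<And>n. ((\<lambda>t. M t ** picard M n t) has_integral I n) {0..X}"
        "((\<lambda>t. M t ** U t) has_integral J) {0..X}" "I \<longlonglongrightarrow> J"
      by (rule uniform_limit_integral)
        (auto intro!: bounded_bilinear.continuous_on[OF bounded_bilinear_matrix_matrix] cX picard_continuous)
    have "(\<lambda>n. picard M (Suc n) X) = (\<lambda>n. mat 1 + I n)"
      using IJ(1) by (auto simp: integral_unique)
    then have "(\<lambda>n. picard M (Suc n) X) \<longlonglongrightarrow> mat 1 + J"
      using tendsto_add[OF tendsto_const IJ(3)] by simp
    moreover have "(\<lambda>n. picard M (Suc n) X) \<longlonglongrightarrow> U X"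
      using tendsto_uniform_limitI[OF ul[OF X], of X] X by (intro LIMSEQ_Suc) auto
    ultimately show ?thesis
      using LIMSEQ_unique integral_unique[OF IJ(2)] by metis
  qed
  have U0: "U 0 = mat 1" using eq[of 0] by simp
  have "prim U (\<lambda>t. M t ** U t)"
    unfolding prim_def
  proof (intro allI impI conjI)
    fix x :: real assume x: "0 \<le> x"
    have c': "continuous_on {0..x} (\<lambda>t. M t ** U t)"
      by (intro bounded_bilinear.continuous_on[OF bounded_bilinear_matrix_matrix] cX cU[OF x])
    show "(\<lambda>t. M t ** U t) absolutely_integrable_on {0..x}"
      using absolutely_integrable_continuous[of 0 x] c' by (simp add: cbox_interval)
    show "bounded ((\<lambda>t. M t ** U t) ` {0..x})"
      by (intro compact_imp_bounded compact_continuous_image c') simp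
    show "U x = U 0 + integral {0..x} (\<lambda>t. M t ** U t)"
      using eq[OF x] by (simp only: U0)
  qed
  with U0 show ?thesis using that by blast
qed

lemma fundamental_solution_exists:
  fixes v :: "real \<Rightarrow> complex^'m2^'m1"
  assumes "continuous_on {0..} v"
  obtains u where "fundamental_solution v u"
proof -
  have "\<exists>U. U 0 = mat 1 \<and> prim U (\<lambda>t. dirac_rhs v z t ** U t)" for z
    using linear_ode_exists[OF continuous_on_dirac_rhs[OF assms]] by metis
  then obtain u where u: "\<forall>z. u z 0 = mat 1 \<and> prim (u z) (\<lambda>t. dirac_rhs v z t ** u z t)"
    using choice[of "\<lambda>z U. U 0 = mat 1 \<and> prim U (\<lambda>t. dirac_rhs v z t ** U t)"] by blast
  have "fundamental_solution v (\<lambda>x z. u z x)"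
    unfolding fundamental_solution_def
  proof (intro allI impI conjI)
    fix z and x :: real assume x: "0 \<le> x"
    from u have u0: "u z 0 = mat 1" and p: "prim (u z) (\<lambda>t. dirac_rhs v z t ** u z t)" by simp_all
    show "(\<lambda>t. dirac_rhs v z t ** u z t) absolutely_integrable_on {0..x}"
      by (rule primD(1)[OF p x])
    show "u z x = mat 1 + integral {0..x} (\<lambda>t. dirac_rhs v z t ** u z t)"
      using primD(3)[OF p x] by (simp only: u0)
  qed
  then show ?thesis by (rule that)
qed

section \<open>The matrix exponential\<close>

definition mat_power :: "complex^'n^'n \<Rightarrow> nat \<Rightarrow> complex^'n^'n" where
  "mat_power N k = (((**) N) ^^ k) (mat 1)"

lemma mat_power_0 [simp]: "mat_power N 0 = mat 1"
  and mat_power_Suc: "mat_power N (Suc k) = N ** mat_power N k"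
  by (simp_all add: mat_power_def)

lemma mat_power_Suc': "mat_power N (Suc k) = mat_power N k ** N"
  by (induction k) (simp_all add: mat_power_Suc matrix_mul_assoc)

lemma mat_power_scale: "mat_power (c *\<^sub>m N) k = c ^ k *\<^sub>m mat_power N k"
  by (induction k)
    (simp_all add: mat_power_Suc mat_scale_mult_left mat_scale_mult_right, simp_all add: vec_eq_iff mult_ac)

lemma cadjoint_mat_power: "(mat_power N k)\<^sup>\<dagger> = mat_power (N\<^sup>\<dagger>) k"
proof (induction k)
  case (Suc k)
  have "(mat_power N (Suc k))\<^sup>\<dagger> = mat_power (N\<^sup>\<dagger>) k ** N\<^sup>\<dagger>"
    by (simp add: mat_power_Suc cadjoint_mult Suc)
  then show ?case by (simp only: mat_power_Suc')
qed (simp add: cadjoint_mat)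

lemma norm_mat_power_le: "norm (mat_power N k) \<le> norm (mat 1 :: complex^'n^'n) * norm N ^ k"
  for N :: "complex^'n^'n"
proof (induction k)
  case (Suc k)
  have "norm (mat_power N (Suc k)) \<le> norm N * norm (mat_power N k)"
    unfolding mat_power_Suc by (rule norm_matrix_mult_le)
  also have "\<dots> \<le> norm N * (norm (mat 1 :: complex^'n^'n) * norm N ^ k)"
    by (rule mult_left_mono[OF Suc]) simp
  finally show ?case by (simp add: mult_ac)
qed simp

lemma mat_exp_sums: "(\<lambda>k. (1 / fact k) *\<^sub>R mat_power N k) sums mat_exp N"
  for N :: "complex^'n^'n"
proof -
  have "summable (\<lambda>k. norm (mat 1 :: complex^'n^'n) * ((1 / fact k) * norm N ^ k))"
    using summable_exp[of "norm N"] by (intro summable_mult) (simp add: inverse_eq_divide)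
  then have "summable (\<lambda>k. (1 / fact k) *\<^sub>R mat_power N k)"
  proof (rule summable_comparison_test'[where N = 0])
    fix k
    show "norm ((1 / fact k) *\<^sub>R mat_power N k) \<le> norm (mat 1 :: complex^'n^'n) * ((1 / fact k) * norm N ^ k)"
      using mult_left_mono[OF norm_mat_power_le[of N k], of "1 / fact k"] by (simp add: mult_ac)
  qed
  then show ?thesis
    unfolding mat_exp_def mat_power_def by (rule summable_sums)
qed

lemma mat_exp_0: "mat_exp 0 = mat 1"
proof -
  have "mat_power 0 (Suc k) = (0 :: complex^'n^'n)" for k
    by (simp add: mat_power_Suc matrix_matrix_mult_def vec_eq_iff)
  then have "(\<lambda>k. (1 / fact k) *\<^sub>R mat_power 0 k) sums ((1 / fact 0) *\<^sub>R mat_power 0 0 :: complex^'n^'n)"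
    by (intro sums_single[of 0 "\<lambda>k. (1 / fact k) *\<^sub>R mat_power 0 k", THEN sums_cong[THEN iffD1, rotated]])
      (auto simp: gr0_conv_Suc)
  then show ?thesis using sums_unique2[OF mat_exp_sums] by simp
qed

lemma mat_exp_commute: "N ** mat_exp (c *\<^sub>m N) = mat_exp (c *\<^sub>m N) ** N"
proof -
  have "(\<lambda>k. N ** ((1 / fact k) *\<^sub>R mat_power (c *\<^sub>m N) k)) sums (N ** mat_exp (c *\<^sub>m N))"
    by (rule bounded_linear.sums[OF bounded_bilinear.bounded_linear_right[OF bounded_bilinear_matrix_matrix] mat_exp_sums])
  moreover have "(\<lambda>k. ((1 / fact k) *\<^sub>R mat_power (c *\<^sub>m N) k) ** N) sums (mat_exp (c *\<^sub>m N) ** N)"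
    by (rule bounded_linear.sums[OF bounded_bilinear.bounded_linear_left[OF bounded_bilinear_matrix_matrix] mat_exp_sums])
  moreover have "N ** ((1 / fact k) *\<^sub>R mat_power (c *\<^sub>m N) k) = ((1 / fact k) *\<^sub>R mat_power (c *\<^sub>m N) k) ** N" for k
    unfolding bounded_bilinear.scaleR_left[OF bounded_bilinear_matrix_matrix]
      bounded_bilinear.scaleR_right[OF bounded_bilinear_matrix_matrix]
      mat_power_scale mat_scale_mult_left mat_scale_mult_right
      mat_power_Suc[symmetric] mat_power_Suc'[symmetric] ..
  ultimately show ?thesis using sums_unique2 by simp
qed

lemma cadjoint_mat_exp: "(mat_exp N)\<^sup>\<dagger> = mat_exp (N\<^sup>\<dagger>)"
proof -
  have "(\<lambda>k. ((1 / fact k) *\<^sub>R mat_power N k)\<^sup>\<dagger>) sums (mat_exp N)\<^sup>\<dagger>"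
    by (rule bounded_linear.sums[OF bounded_linear_cadjoint mat_exp_sums])
  then have "(\<lambda>k. (1 / fact k) *\<^sub>R mat_power (N\<^sup>\<dagger>) k) sums (mat_exp N)\<^sup>\<dagger>"
    by (simp add: cadjoint_mat_power linear_cmul[OF bounded_linear.linear[OF bounded_linear_cadjoint]])
  then show ?thesis by (rule sums_unique2[OF _ mat_exp_sums])
qed

text \<open>Each entry is an everywhere convergent power series in c, and its formally
  differentiated coefficients are those of N times the exponential.\<close>

lemma mat_exp_entry_derivative:
  "((\<lambda>c. mat_exp (c *\<^sub>m N) $ i $ j) has_field_derivative (N ** mat_exp (c *\<^sub>m N)) $ i $ j) (at c)"
proof -
  define a where "a = (\<lambda>k. mat_power N k $ i $ j / fact k)"
  have scaleR_fact: "(1 / fact k) *\<^sub>R w = w / fact k" for k and w :: complex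
    by (simp add: scaleR_conv_of_real)
  have sums_a: "(\<lambda>k. a k * c ^ k) sums (mat_exp (c *\<^sub>m N) $ i $ j)" for c
    using bounded_linear.sums[OF bounded_linear_entry mat_exp_sums[of "c *\<^sub>m N"], of i j]
    by (simp only: mat_power_scale a_def vector_scaleR_component scaleR_fact mat_scale_component)
      (simp add: mult_ac)
  have "(\<lambda>k. (N ** ((1 / fact k) *\<^sub>R mat_power (c *\<^sub>m N) k)) $ i $ j) sums ((N ** mat_exp (c *\<^sub>m N)) $ i $ j)"
    by (rule bounded_linear.sums[OF bounded_linear_compose[OF bounded_linear_entry
      bounded_bilinear.bounded_linear_right[OF bounded_bilinear_matrix_matrix]] mat_exp_sums])
  moreover have "(N ** ((1 / fact k) *\<^sub>R mat_power (c *\<^sub>m N) k)) $ i $ j = diffs a k * c ^ k" for k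
  proof -
    have "(N ** ((1 / fact k) *\<^sub>R mat_power (c *\<^sub>m N) k)) $ i $ j = (1 / fact k) *\<^sub>R (c ^ k * mat_power N (Suc k) $ i $ j)"
      by (simp add: bounded_bilinear.scaleR_right[OF bounded_bilinear_matrix_matrix] mat_power_scale
          mat_scale_mult_right mat_power_Suc)
    also have "\<dots> = diffs a k * c ^ k"
      by (simp add: diffs_def a_def scaleR_fact field_simps del: of_nat_Suc)
    finally show ?thesis .
  qed
  ultimately have "(\<lambda>k. diffs a k * c ^ k) sums ((N ** mat_exp (c *\<^sub>m N)) $ i $ j)" by simp
  then have "(\<Sum>k. diffs a k * c ^ k) = (N ** mat_exp (c *\<^sub>m N)) $ i $ j" by (rule sums_unique[symmetric])
  moreover have "(\<lambda>c. mat_exp (c *\<^sub>m N) $ i $ j) = (\<lambda>c. \<Sum>k. a k * c ^ k)"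
    using sums_a by (auto simp: sums_iff)
  ultimately show ?thesis
    using termdiffs_strong_converges_everywhere[of a c] sums_a by (auto simp: sums_iff)
qed

lemma has_vector_derivative_vecI:
  fixes f :: "real \<Rightarrow> ('a::real_normed_vector)^'n"
  assumes "\<And>i. ((\<lambda>x. f x $ i) has_vector_derivative f' $ i) (at x within S)"
  shows "(f has_vector_derivative f') (at x within S)"
  unfolding has_vector_derivative_def has_derivative_within
proof (intro conjI vec_tendstoI bounded_linear_scaleR_left)
  fix i
  show "((\<lambda>y. ((1 / norm (y - x)) *\<^sub>R (f y - (f x + (y - x) *\<^sub>R f'))) $ i) \<longlongrightarrow> 0 $ i) (at x within S)"
    using assms[of i] unfolding has_vector_derivative_def has_derivative_within by simp
qed

lemma mat_exp_prim:
  "prim (\<lambda>x. mat_exp ((c * of_real x) *\<^sub>m N)) (\<lambda>x. c *\<^sub>m (N ** mat_exp ((c * of_real x) *\<^sub>m N)))"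
proof -
  have d: "((\<lambda>x. mat_exp ((c * of_real x) *\<^sub>m N)) has_vector_derivative c *\<^sub>m (N ** mat_exp ((c * of_real x) *\<^sub>m N)))
      (at x within {0..})" for x
  proof (rule has_vector_derivative_at_within, (rule has_vector_derivative_vecI)+)
    fix i j
    have "((\<lambda>x. c * of_real x) has_vector_derivative c) (at x)"
      using bounded_linear.has_vector_derivative[OF bounded_linear_compose[OF bounded_linear_mult_right
            bounded_linear_of_real] has_vector_derivative_id, of c "at x"] by simp
    from field_vector_diff_chain_at[OF this mat_exp_entry_derivative[of N i j]]
    show "((\<lambda>x. mat_exp ((c * of_real x) *\<^sub>m N) $ i $ j) has_vector_derivative
        (c *\<^sub>m (N ** mat_exp ((c * of_real x) *\<^sub>m N))) $ i $ j) (at x)"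
      by (simp add: o_def)
  qed
  show ?thesis
  proof (rule prim_of_derivative[OF d])
    have "continuous_on {0..} (\<lambda>x. mat_exp ((c * of_real x) *\<^sub>m N))"
      unfolding continuous_on_eq_continuous_within using d has_vector_derivative_continuous by blast
    then show "continuous_on {0..} (\<lambda>x. c *\<^sub>m (N ** mat_exp ((c * of_real x) *\<^sub>m N)))"
      by (intro bounded_linear.continuous_on[OF bounded_linear_mat_scale]
          bounded_bilinear.continuous_on[OF bounded_bilinear_matrix_matrix] continuous_on_const)
  qed
qed

section \<open>The explicit potential\<close>

text \<open>Cramer's rule writes the entries as quotients of determinants. Continuity comes first
  because it makes the linear equation in \<open>prim_matrix_inv\<close> solvable.\<close>

lemma continuous_on_matrix_inv:
  fixes S :: "'a::topological_space \<Rightarrow> complex^'n^'n"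
  assumes c: "continuous_on T S" and inv: "\<And>x. x \<in> T \<Longrightarrow> invertible (S x)"
  shows "continuous_on T (\<lambda>x. matrix_inv (S x))"
proof -
  have entry: "matrix_inv (S x) $ k $ l =
      det (\<chi> i j. if j = k then axis l 1 $ i else S x $ i $ j) / det (S x)" if x: "x \<in> T" for x k l
  proof -
    have "S x *v (matrix_inv (S x) *v axis l 1) = axis l 1"
      by (simp add: matrix_vector_mul_assoc matrix_inv_left_right[OF inv[OF x]])
    then have "matrix_inv (S x) *v axis l 1 =
        (\<chi> k. det (\<chi> i j. if j = k then axis l 1 $ i else S x $ i $ j) / det (S x))"
      using cramer[of "S x"] inv[OF x] by (simp add: invertible_det_nz)
    then have "(matrix_inv (S x) *v axis l 1) $ k =
        det (\<chi> i j. if j = k then axis l 1 $ i else S x $ i $ j) / det (S x)"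
      by simp
    then show ?thesis
      by (simp add: matrix_vector_mult_def axis_def if_distrib[of "\<lambda>x. _ * x"] cong: if_cong)
  qed
  have cdet: "continuous_on T (\<lambda>x. det (F x))" if "\<And>i j. continuous_on T (\<lambda>x. F x $ i $ j)"
    for F :: "'a \<Rightarrow> complex^'n^'n"
    unfolding det_def by (intro continuous_intros that)
  have cS: "continuous_on T (\<lambda>x. S x $ i $ j)" for i j
    by (intro continuous_intros c)
  have "continuous_on T (\<lambda>x. matrix_inv (S x) $ k $ l)" for k l
  proof (rule continuous_on_eq)
    show "continuous_on T (\<lambda>x. det (\<chi> i j. if j = k then axis l 1 $ i else S x $ i $ j) / det (S x))"
    proof (intro continuous_on_divide cdet cS ballI)
      show "continuous_on T (\<lambda>x. (\<chi> i j. if j = k then axis l 1 $ i else S x $ i $ j) $ i $ j)" for i j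
        by (cases "j = k") (simp_all add: cS)
      show "det (S x) \<noteq> 0" if "x \<in> T" for x using inv[OF that] by (simp add: invertible_det_nz)
    qed
  qed (simp add: entry)
  then show ?thesis
    by (auto simp: continuous_on_def intro!: vec_tendstoI)
qed

text \<open>The inverse of \<open>S\<close> is found as the solution \<open>G\<close> of \<open>G' = - S\<^sup>-\<^sup>1 S' G\<close>, since \<open>(S G)' = 0\<close>.\<close>

lemma prim_matrix_inv:
  fixes S R :: "real \<Rightarrow> complex^'n^'n"
  assumes S: "prim S R" and R: "continuous_on {0..} R" and inv: "\<And>x. 0 \<le> x \<Longrightarrow> invertible (S x)"
  shows "prim (\<lambda>x. matrix_inv (S x)) (\<lambda>x. - (matrix_inv (S x) ** R x ** matrix_inv (S x)))"
proof -
  define Si where "Si x = matrix_inv (S x)" for x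
  have SSi: "S x ** Si x = mat 1" "Si x ** S x = mat 1" if "0 \<le> x" for x
    using matrix_inv_left_right[OF inv[OF that]] by (simp_all add: Si_def)
  have cSi: "continuous_on {0..} Si"
    unfolding Si_def[abs_def] by (intro continuous_on_matrix_inv prim_continuous_atLeast[OF S] inv) simp
  have "continuous_on {0..} (\<lambda>x. - (Si x ** R x))"
    by (intro continuous_on_minus bounded_bilinear.continuous_on[OF bounded_bilinear_matrix_matrix] cSi R)
  from linear_ode_exists[OF this] obtain U where U: "U 0 = mat 1" "prim U (\<lambda>t. - (Si t ** R t) ** U t)"
    by blast
  define G where "G = (\<lambda>x. U x ** Si 0)"
  have G: "prim G (\<lambda>t. - (Si t ** R t) ** U t ** Si 0)"
    unfolding G_def
    by (rule prim_bounded_linear[OF bounded_bilinear.bounded_linear_left[OF bounded_bilinear_matrix_matrix] U(2)])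
  have "prim (\<lambda>x. S x ** G x) (\<lambda>x. 0)"
  proof (rule prim_cong[OF prim_bilinear[OF bounded_bilinear_matrix_matrix S G] refl])
    fix x :: real assume x: "0 \<le> x"
    have "S x ** (- (Si x ** R x) ** U x ** Si 0) = - ((S x ** Si x) ** R x ** (U x ** Si 0))"
      by (simp add: bounded_bilinear.minus_left[OF bounded_bilinear_matrix_matrix]
          bounded_bilinear.minus_right[OF bounded_bilinear_matrix_matrix] matrix_mul_assoc)
    then show "R x ** G x + S x ** (- (Si x ** R x) ** U x ** Si 0) = 0"
      by (simp add: SSi x G_def)
  qed
  from primD(3)[OF this] have SG: "S x ** G x = mat 1" if "0 \<le> x" for x
    using that by (simp add: G_def U(1) SSi)
  have G_eq: "G x = Si x" if "0 \<le> x" for x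
    using SG[OF that] SSi(2)[OF that] by (metis matrix_mul_assoc matrix_mul_lid matrix_mul_rid)
  show ?thesis
    unfolding Si_def[symmetric]
  proof (rule prim_cong[OF G G_eq])
    fix x :: real assume x: "0 \<le> x"
    then show "- (Si x ** R x) ** U x ** Si 0 = - (Si x ** R x ** Si x)"
      using G_eq[OF x] by (simp add: G_def bounded_bilinear.minus_left[OF bounded_bilinear_matrix_matrix]
          flip: matrix_mul_assoc)
  qed
qed

text \<open>Here b and c are the matrices \<vartheta>1 and \<vartheta>2, L1 and L2 are the blocks of
  \<Lambda>, S is \<Sigma> and R its derivative. Only this identity, not the Riccati equation
  itself, enters the analysis in x.\<close>

locale gbdt =
  fixes \<alpha> X :: "complex^'n^'n" and b :: "complex^'m1^'n" and c :: "complex^'m2^'n"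
  assumes X: "pos_def X"
    and identity: "\<alpha> ** X - X ** \<alpha>\<^sup>\<dagger> = \<i> *\<^sub>m (b ** b\<^sup>\<dagger> - c ** c\<^sup>\<dagger>)"
begin

definition E1 :: "real \<Rightarrow> complex^'n^'n" where "E1 x = mat_exp ((- \<i> * of_real x) *\<^sub>m \<alpha>)"
definition L1 :: "real \<Rightarrow> complex^'m1^'n" where "L1 x = E1 x ** b"
definition L2 :: "real \<Rightarrow> complex^'m2^'n" where "L2 x = mat_exp ((\<i> * of_real x) *\<^sub>m \<alpha>) ** c"
definition R :: "real \<Rightarrow> complex^'n^'n" where "R x = L1 x ** (L1 x)\<^sup>\<dagger> + L2 x ** (L2 x)\<^sup>\<dagger>"
definition S :: "real \<Rightarrow> complex^'n^'n" where "S x = X + integral {0..x} R"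
definition Si :: "real \<Rightarrow> complex^'n^'n" where "Si x = matrix_inv (S x)"
definition pot :: "real \<Rightarrow> complex^'m2^'m1" where "pot x = (- 2 * \<i>) *\<^sub>m ((L1 x)\<^sup>\<dagger> ** Si x ** L2 x)"

lemma E1_prim: "prim E1 (\<lambda>t. (- \<i>) *\<^sub>m (\<alpha> ** E1 t))"
  unfolding E1_def by (rule mat_exp_prim)

lemma E1_0: "E1 0 = mat 1"
proof -
  have "(0 :: complex) *\<^sub>m \<alpha> = 0" by (simp add: vec_eq_iff)
  then show ?thesis by (simp add: E1_def mat_exp_0)
qed

lemma L1_prim: "prim L1 (\<lambda>t. (- \<i>) *\<^sub>m (\<alpha> ** L1 t))"
  using prim_bounded_linear[OF bounded_bilinear.bounded_linear_left[OF bounded_bilinear_matrix_matrix] E1_prim, of b]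
  by (simp add: L1_def[abs_def] mat_scale_mult_left matrix_mul_assoc)

lemma L2_prim: "prim L2 (\<lambda>t. \<i> *\<^sub>m (\<alpha> ** L2 t))"
  using prim_bounded_linear[OF bounded_bilinear.bounded_linear_left[OF bounded_bilinear_matrix_matrix] mat_exp_prim[of \<i> \<alpha>], of c]
  by (simp add: L2_def[abs_def] mat_scale_mult_left matrix_mul_assoc)

lemma L1_adjoint_prim: "prim (\<lambda>t. (L1 t)\<^sup>\<dagger>) (\<lambda>t. \<i> *\<^sub>m ((L1 t)\<^sup>\<dagger> ** \<alpha>\<^sup>\<dagger>))"
  using prim_bounded_linear[OF bounded_linear_cadjoint L1_prim] by (simp add: cadjoint_scale cadjoint_mult)

lemma L2_adjoint_prim: "prim (\<lambda>t. (L2 t)\<^sup>\<dagger>) (\<lambda>t. (- \<i>) *\<^sub>m ((L2 t)\<^sup>\<dagger> ** \<alpha>\<^sup>\<dagger>))"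
  using prim_bounded_linear[OF bounded_linear_cadjoint L2_prim] by (simp add: cadjoint_scale cadjoint_mult)

lemma L_continuous: "continuous_on {0..} L1" "continuous_on {0..} L2"
  by (rule prim_continuous_atLeast[OF L1_prim] prim_continuous_atLeast[OF L2_prim])+

lemma R_continuous: "continuous_on {0..} R"
  unfolding R_def
  by (intro continuous_on_add bounded_bilinear.continuous_on[OF bounded_bilinear_matrix_matrix]
      bounded_linear.continuous_on[OF bounded_linear_cadjoint] L_continuous)

lemma S_prim: "prim S R"
  unfolding S_def[abs_def] by (rule prim_integral_of_continuous[OF R_continuous])

lemma S_0: "S 0 = X" by (simp add: S_def)

lemma L_0: "L1 0 = b" "L2 0 = c"
proof -
  have "(0 :: complex) *\<^sub>m \<alpha> = 0" by (simp add: vec_eq_iff)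
  then show "L1 0 = b" "L2 0 = c" by (simp_all add: L1_def L2_def E1_0 mat_exp_0)
qed

lemmas vector_algebra = matrix_vector_mult_add_rdistrib matrix_vector_mult_diff_rdistrib mat_scale_vector
  vector_scalar_commute matrix_vector_right_distrib matrix_vector_mult_diff_distrib vector_minus_mult mat_minus_vector

text \<open>Both sides have the integrand \<alpha> R - R \<alpha>\<dagger>, since the opposite signs
  in the two exponentials turn the difference on the right into a sum. So the identity propagates
  from x = 0.\<close>

lemma lyapunov:
  assumes x: "0 \<le> x"
  shows "\<alpha> ** S x - S x ** \<alpha>\<^sup>\<dagger> = \<i> *\<^sub>m (L1 x ** (L1 x)\<^sup>\<dagger> - L2 x ** (L2 x)\<^sup>\<dagger>)"
proof -
  define Z where "Z = (\<lambda>x. \<alpha> ** S x - S x ** \<alpha>\<^sup>\<dagger> - \<i> *\<^sub>m (L1 x ** (L1 x)\<^sup>\<dagger> - L2 x ** (L2 x)\<^sup>\<dagger>))"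
  note mm = bounded_bilinear_matrix_matrix
  have "prim Z (\<lambda>t. 0)"
    unfolding Z_def
  proof (rule prim_cong[OF prim_diff[OF prim_diff[OF
        prim_bounded_linear[OF bounded_bilinear.bounded_linear_right[OF mm] S_prim]
        prim_bounded_linear[OF bounded_bilinear.bounded_linear_left[OF mm] S_prim]]
        prim_bounded_linear[OF bounded_linear_mat_scale prim_diff[OF
          prim_bilinear[OF mm L1_prim L1_adjoint_prim] prim_bilinear[OF mm L2_prim L2_adjoint_prim]]]] refl])
    fix t :: real
    show "\<alpha> ** R t - R t ** \<alpha>\<^sup>\<dagger> - \<i> *\<^sub>m ((- \<i>) *\<^sub>m (\<alpha> ** L1 t) ** (L1 t)\<^sup>\<dagger> + L1 t ** \<i> *\<^sub>m ((L1 t)\<^sup>\<dagger> ** \<alpha>\<^sup>\<dagger>)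
        - (\<i> *\<^sub>m (\<alpha> ** L2 t) ** (L2 t)\<^sup>\<dagger> + L2 t ** (- \<i>) *\<^sub>m ((L2 t)\<^sup>\<dagger> ** \<alpha>\<^sup>\<dagger>))) = 0"
    proof (rule matrix_eqI)
      fix h
      show "(\<alpha> ** R t - R t ** \<alpha>\<^sup>\<dagger> - \<i> *\<^sub>m ((- \<i>) *\<^sub>m (\<alpha> ** L1 t) ** (L1 t)\<^sup>\<dagger> + L1 t ** \<i> *\<^sub>m ((L1 t)\<^sup>\<dagger> ** \<alpha>\<^sup>\<dagger>)
        - (\<i> *\<^sub>m (\<alpha> ** L2 t) ** (L2 t)\<^sup>\<dagger> + L2 t ** (- \<i>) *\<^sub>m ((L2 t)\<^sup>\<dagger> ** \<alpha>\<^sup>\<dagger>)))) *v h = 0 *v h"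
        by (simp add: R_def vector_algebra flip: matrix_vector_mul_assoc)
    qed
  qed
  from primD(3)[OF this x] have "Z x = Z 0" by simp
  also have "Z 0 = 0" by (simp add: Z_def S_0 L_0 identity)
  finally show ?thesis by (simp add: Z_def)
qed

lemma R_hermitian: "(R t)\<^sup>\<dagger> = R t"
  by (simp add: R_def cadjoint_add cadjoint_mult)

lemma S_hermitian:
  assumes "0 \<le> x"
  shows "(S x)\<^sup>\<dagger> = S x"
proof -
  have "prim (\<lambda>x. (S x)\<^sup>\<dagger>) R"
    using prim_bounded_linear[OF bounded_linear_cadjoint S_prim] by (simp add: R_hermitian)
  from primD(3)[OF this assms] primD(3)[OF S_prim assms] show ?thesis
    using X by (simp add: S_0 pos_def_def)
qed

text \<open>The integrand R is positive semidefinite and the initial value X positive definite; this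
  is why \<Sigma>(x) is invertible for every x.\<close>

lemma cip_S_pos:
  assumes x: "0 \<le> x" and w: "w \<noteq> 0"
  shows "0 < Re (cip w (S x *v w))"
proof -
  have "bounded_linear (\<lambda>M. Re (cip w (M *v w)))"
    by (intro bounded_linear_compose[OF bounded_linear_Re]
        bounded_linear_compose[OF bounded_bilinear.bounded_linear_right[OF bounded_bilinear_cip]]
        bounded_bilinear.bounded_linear_left[OF bounded_bilinear_matrix_vector])
  from prim_bounded_linear[OF this S_prim]
  have p: "prim (\<lambda>x. Re (cip w (S x *v w))) (\<lambda>t. Re (cip w (R t *v w)))" .
  have "Re (cip w (R t *v w)) = (norm ((L1 t)\<^sup>\<dagger> *v w))\<^sup>2 + (norm ((L2 t)\<^sup>\<dagger> *v w))\<^sup>2" for t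
    by (simp add: R_def vector_algebra cip_simps cip_self flip: matrix_vector_mul_assoc cip_adjoint)
  then have "0 \<le> integral {0..x} (\<lambda>t. Re (cip w (R t *v w)))"
    by (intro integral_nonneg prim_integral(1)[OF p]) (use x in auto)
  moreover have "0 < Re (cip w (S 0 *v w))"
    using X w by (simp add: S_0 pos_def_def quad_form_cip)
  ultimately show ?thesis using primD(3)[OF p x] by linarith
qed

lemma S_invertible:
  assumes "0 \<le> x"
  shows "invertible (S x)"
proof (rule invertible_if_injective, rule ccontr)
  fix w assume "S x *v w = 0" "w \<noteq> 0"
  then show False using cip_S_pos[OF assms, of w] by simp
qed

lemma Si_S: "0 \<le> x \<Longrightarrow> Si x ** S x = mat 1" and S_Si: "0 \<le> x \<Longrightarrow> S x ** Si x = mat 1"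
  using matrix_inv_left_right[OF S_invertible] by (simp_all add: Si_def)

lemma Si_hermitian:
  assumes "0 \<le> x"
  shows "(Si x)\<^sup>\<dagger> = Si x"
proof -
  have "(Si x)\<^sup>\<dagger> ** S x = mat 1"
    using arg_cong[OF S_Si[OF assms], of cadjoint] by (simp add: cadjoint_mult S_hermitian[OF assms] cadjoint_mat)
  then show ?thesis unfolding Si_def using matrix_inv_unique(2) by metis
qed

lemma Si_prim: "prim Si (\<lambda>t. - (Si t ** R t ** Si t))"
  unfolding Si_def[abs_def] by (rule prim_matrix_inv[OF S_prim R_continuous S_invertible])

lemma pot_continuous: "continuous_on {0..} pot"
  unfolding pot_def[abs_def]
  by (intro bounded_linear.continuous_on[OF bounded_linear_mat_scale]
      bounded_bilinear.continuous_on[OF bounded_bilinear_matrix_matrix]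
      bounded_linear.continuous_on[OF bounded_linear_cadjoint] L_continuous prim_continuous_atLeast[OF Si_prim])

lemma pot_bounded: "bounded (pot ` {0..r})"
  by (intro compact_imp_bounded compact_continuous_image continuous_on_subset[OF pot_continuous]) auto

lemma pot_vector: "pot x *v p = (- 2 * \<i>) *s ((L1 x)\<^sup>\<dagger> *v (Si x *v (L2 x *v p)))"
  by (simp add: pot_def mat_scale_vector flip: matrix_vector_mul_assoc)

lemma pot_adjoint_vector:
  "0 \<le> x \<Longrightarrow> (pot x)\<^sup>\<dagger> *v p = (2 * \<i>) *s ((L2 x)\<^sup>\<dagger> *v (Si x *v (L1 x *v p)))"
  by (simp add: pot_def mat_scale_vector cadjoint_scale cadjoint_mult Si_hermitian flip: matrix_vector_mul_assoc)

section \<open>Explicit solutions of the system from vectors with (\<alpha> - z) q0 = b k\<close>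

context
  fixes z :: complex and q0 :: "complex^'n" and k :: "complex^'m1"
  assumes q0: "\<alpha> *v q0 = z *s q0 + b *v k"
begin

definition q where "q x = E1 x *v q0"
definition s where "s x = Si x *v q x"
definition w1 where "w1 x = (L1 x)\<^sup>\<dagger> *v s x"
definition w2 where "w2 x = (L2 x)\<^sup>\<dagger> *v s x"
definition y1 where "y1 x = exp (\<i> * z * of_real x) *s (k - \<i> *s w1 x)"
definition y2 where "y2 x = exp (\<i> * z * of_real x) *s (\<i> *s w2 x)"

lemma q_prim: "prim q (\<lambda>t. (- \<i>) *s (\<alpha> *v q t))"
  using prim_bounded_linear[OF bounded_bilinear.bounded_linear_left[OF bounded_bilinear_matrix_vector] E1_prim, of q0]
  by (simp add: q_def[abs_def] mat_scale_vector flip: matrix_vector_mul_assoc)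

text \<open>The relation for q0 persists because the exponential commutes with \<alpha>. It is the
  place where z enters the construction.\<close>

lemma alpha_q: "\<alpha> *v q x = z *s q x + L1 x *v k"
proof -
  have "\<alpha> *v q x = E1 x *v (\<alpha> *v q0)"
    using mat_exp_commute[of \<alpha> "- \<i> * of_real x"] by (simp add: q_def E1_def matrix_vector_mul_assoc)
  then show ?thesis
    by (simp add: q0 vector_algebra q_def L1_def flip: matrix_vector_mul_assoc)
qed

lemma S_s: "0 \<le> x \<Longrightarrow> S x *v s x = q x"
  by (simp add: s_def matrix_vector_mul_assoc S_Si)

lemma Si_q: "Si x *v q x = s x"
  by (simp add: s_def)

text \<open>The Lyapunov identity applied to s trades the adjoint of \<alpha>, produced by
  differentiating \<Lambda>\<dagger>, for \<alpha> acting on q. Then it can be combined with the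
  \<alpha> term in the derivative of s.\<close>

lemma alpha_adjoint_s:
  assumes x: "0 \<le> x"
  shows "\<alpha>\<^sup>\<dagger> *v s x = Si x *v (\<alpha> *v q x - \<i> *s (L1 x *v w1 x) + \<i> *s (L2 x *v w2 x))"
proof -
  have "(\<alpha> ** S x - S x ** \<alpha>\<^sup>\<dagger>) *v s x = \<i> *\<^sub>m (L1 x ** (L1 x)\<^sup>\<dagger> - L2 x ** (L2 x)\<^sup>\<dagger>) *v s x"
    by (simp only: lyapunov[OF x])
  then have "\<alpha> *v q x - S x *v (\<alpha>\<^sup>\<dagger> *v s x) = \<i> *s (L1 x *v w1 x - L2 x *v w2 x)"
    by (simp add: vector_algebra S_s[OF x] w1_def w2_def flip: matrix_vector_mul_assoc)
  then have "S x *v (\<alpha>\<^sup>\<dagger> *v s x) = \<alpha> *v q x - \<i> *s (L1 x *v w1 x) + \<i> *s (L2 x *v w2 x)"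
    by (simp add: vector_ssub_ldistrib algebra_simps)
  then have "Si x *v (S x *v (\<alpha>\<^sup>\<dagger> *v s x)) = Si x *v (\<alpha> *v q x - \<i> *s (L1 x *v w1 x) + \<i> *s (L2 x *v w2 x))"
    by simp
  then show ?thesis by (simp only: matrix_vector_mul_assoc[of "Si x" "S x"] Si_S[OF x] matrix_vector_mul_lid)
qed

lemma s_prim: "prim s (\<lambda>t. - (Si t *v (L1 t *v w1 t)) - Si t *v (L2 t *v w2 t) - \<i> *s (Si t *v (\<alpha> *v q t)))"
  unfolding s_def[abs_def]
proof (rule prim_cong[OF prim_bilinear[OF bounded_bilinear_matrix_vector Si_prim q_prim] refl])
  fix t :: real
  show "- (Si t ** R t ** Si t) *v q t + Si t *v ((- \<i>) *s (\<alpha> *v q t)) =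
      - (Si t *v (L1 t *v w1 t)) - Si t *v (L2 t *v w2 t) - \<i> *s (Si t *v (\<alpha> *v q t))"
    by (simp add: R_def vector_algebra Si_q w1_def w2_def vector_smult_lneg flip: matrix_vector_mul_assoc)
qed

text \<open>The terms with \<alpha> and those through L1 cancel, while the two equal terms through
  L2 add up. This doubling is the origin of the factor - 2 \<i> in the potential.\<close>

lemma w1_prim: "prim w1 (\<lambda>t. (- \<i>) *s (pot t *v w2 t))"
  unfolding w1_def[abs_def]
proof (rule prim_cong[OF prim_bilinear[OF bounded_bilinear_matrix_vector L1_adjoint_prim s_prim] refl])
  fix t :: real assume t: "0 \<le> t"
  show "(\<i> *\<^sub>m ((L1 t)\<^sup>\<dagger> ** \<alpha>\<^sup>\<dagger>)) *v s t + (L1 t)\<^sup>\<dagger> *v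
        (- (Si t *v (L1 t *v w1 t)) - Si t *v (L2 t *v w2 t) - \<i> *s (Si t *v (\<alpha> *v q t))) =
      (- \<i>) *s (pot t *v w2 t)"
    by (simp add: vector_algebra alpha_adjoint_s[OF t] pot_vector flip: matrix_vector_mul_assoc)
      (simp add: vec_eq_iff algebra_simps)
qed

text \<open>Here the \<alpha> terms add up instead of cancelling, and \<open>alpha_q\<close> turns
  them into - 2 \<i> z w2 plus a term in k. The factor exp (\<i> z x) in \<open>y2\<close> then
  changes - 2 \<i> z into the required - \<i> z.\<close>

lemma w2_prim: "prim w2 (\<lambda>t. (- 2 * \<i> * z) *s w2 t + \<i> *s ((pot t)\<^sup>\<dagger> *v (\<i> *s k + w1 t)))"
  unfolding w2_def[abs_def]
proof (rule prim_cong[OF prim_bilinear[OF bounded_bilinear_matrix_vector L2_adjoint_prim s_prim] refl])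
  fix t :: real assume t: "0 \<le> t"
  show "((- \<i>) *\<^sub>m ((L2 t)\<^sup>\<dagger> ** \<alpha>\<^sup>\<dagger>)) *v s t + (L2 t)\<^sup>\<dagger> *v
        (- (Si t *v (L1 t *v w1 t)) - Si t *v (L2 t *v w2 t) - \<i> *s (Si t *v (\<alpha> *v q t))) =
      (- 2 * \<i> * z) *s ((L2 t)\<^sup>\<dagger> *v s t) + \<i> *s ((pot t)\<^sup>\<dagger> *v (\<i> *s k + w1 t))"
    by (simp add: vector_algebra alpha_adjoint_s[OF t] pot_adjoint_vector[OF t] alpha_q Si_q
          flip: matrix_vector_mul_assoc)
      (simp add: vec_eq_iff algebra_simps)
qed

lemma exp_prim: "prim (\<lambda>x. exp (\<i> * z * of_real x)) (\<lambda>x. \<i> * z * exp (\<i> * z * of_real x))"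
proof (rule prim_of_derivative)
  fix x :: real
  have "((\<lambda>x. \<i> * z * of_real x) has_vector_derivative \<i> * z) (at x)"
    using bounded_linear.has_vector_derivative[OF bounded_linear_compose[OF bounded_linear_mult_right
          bounded_linear_of_real] has_vector_derivative_id, of "\<i> * z" "at x"] by simp
  from field_vector_diff_chain_at[OF this DERIV_exp, unfolded o_def]
  show "((\<lambda>x. exp (\<i> * z * of_real x)) has_vector_derivative \<i> * z * exp (\<i> * z * of_real x)) (at x within {0..})"
    by (rule has_vector_derivative_at_within)
qed (intro continuous_intros)

lemma y1_prim: "prim y1 (\<lambda>t. (\<i> * z) *s y1 t + \<i> *s (pot t *v y2 t))"
  unfolding y1_def[abs_def]
proof (rule prim_cong[OF prim_bilinear[OF bounded_bilinear_scale_vector exp_prim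
        prim_diff[OF prim_const[of k] prim_bounded_linear[OF bounded_linear_scale_vector w1_prim]]] refl])
  fix t :: real
  show "(\<i> * z * exp (\<i> * z * of_real t)) *s (k - \<i> *s w1 t) + exp (\<i> * z * of_real t) *s
        (0 - \<i> *s ((- \<i>) *s (pot t *v w2 t))) =
      (\<i> * z) *s (exp (\<i> * z * of_real t) *s (k - \<i> *s w1 t)) + \<i> *s (pot t *v y2 t)"
    by (simp add: y2_def vector_algebra) (simp add: vec_eq_iff algebra_simps)
qed

lemma y2_prim: "prim y2 (\<lambda>t. - (\<i> * z) *s y2 t - \<i> *s ((pot t)\<^sup>\<dagger> *v y1 t))"
  unfolding y2_def[abs_def]
proof (rule prim_cong[OF prim_bilinear[OF bounded_bilinear_scale_vector exp_prim
        prim_bounded_linear[OF bounded_linear_scale_vector w2_prim]] refl])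
  fix t :: real
  show "(\<i> * z * exp (\<i> * z * of_real t)) *s (\<i> *s w2 t) + exp (\<i> * z * of_real t) *s
        (\<i> *s ((- 2 * \<i> * z) *s w2 t + \<i> *s ((pot t)\<^sup>\<dagger> *v (\<i> *s k + w1 t)))) =
      - (\<i> * z) *s (exp (\<i> * z * of_real t) *s (\<i> *s w2 t)) - \<i> *s ((pot t)\<^sup>\<dagger> *v y1 t)"
    by (simp add: y1_def vector_algebra) (simp add: vec_eq_iff algebra_simps)
qed

text \<open>The Lyapunov identity is evaluated as a quadratic form at s(x), with \<alpha> q replaced
  by z q + L1 k; positivity of \<Sigma>(x) gives the sign.\<close>

lemma y_energy:
  assumes x: "0 \<le> x" and z: "0 < Im z"
  shows "norm (y2 x) \<le> norm (y1 x)"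
proof -
  define \<sigma> where "\<sigma> = cip (s x) (q x)"
  have \<sigma>: "cip (q x) (s x) = \<sigma>" "0 \<le> Re \<sigma>"
  proof -
    have "cip (q x) (s x) = cip (S x *v s x) (s x)" by (simp add: S_s[OF x])
    also have "\<dots> = cip (s x) (S x *v s x)"
      using cip_adjoint[of "S x" "s x" "s x"] by (simp add: S_hermitian[OF x])
    finally show "cip (q x) (s x) = \<sigma>" by (simp add: \<sigma>_def S_s[OF x])
    show "0 \<le> Re \<sigma>"
      using cip_S_pos[OF x, of "s x"] by (cases "s x = 0") (auto simp: \<sigma>_def S_s[OF x])
  qed
  have "cnj \<sigma> = \<sigma>" using \<sigma>(1) by (simp add: \<sigma>_def cip_cnj)
  then have Im\<sigma>: "Im \<sigma> = 0" by (metis Reals_cnj_iff complex_is_Real_iff)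
  have adj: "cip (s x) (L1 x *v p) = cip (w1 x) p" "cip (s x) (L2 x *v p') = cip (w2 x) p'"
    "cip (L1 x *v p) (s x) = cip p (w1 x)" for p p'
    by (simp_all add: w1_def w2_def cip_adjoint cip_adjoint')
  have "S x *v (\<alpha>\<^sup>\<dagger> *v s x) = \<alpha> *v q x - \<i> *s (L1 x *v w1 x) + \<i> *s (L2 x *v w2 x)"
    unfolding alpha_adjoint_s[OF x] by (simp only: matrix_vector_mul_assoc[of "S x" "Si x"] S_Si[OF x] matrix_vector_mul_lid)
  then have "cip (s x) (S x *v (\<alpha>\<^sup>\<dagger> *v s x)) =
      cip (s x) (\<alpha> *v q x) - \<i> * cip (w1 x) (w1 x) + \<i> * cip (w2 x) (w2 x)"
    by (simp add: cip_simps adj)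
  moreover have "cip (s x) (S x *v (\<alpha>\<^sup>\<dagger> *v s x)) = cip (\<alpha> *v q x) (s x)"
    using cip_adjoint[of "S x" "s x" "\<alpha>\<^sup>\<dagger> *v s x"] by (simp add: S_hermitian[OF x] S_s[OF x] cip_adjoint')
  moreover have "cip (\<alpha> *v q x) (s x) = cnj z * \<sigma> + cip k (w1 x)"
    "cip (s x) (\<alpha> *v q x) = z * \<sigma> + cip (w1 x) k"
    by (simp_all add: alpha_q cip_simps \<sigma>(1) adj) (simp add: \<sigma>_def)
  ultimately have "\<i> * cip (w1 x) (w1 x) - \<i> * cip (w2 x) (w2 x) =
      z * \<sigma> + cip (w1 x) k - cnj z * \<sigma> - cip k (w1 x)"
    by (simp add: algebra_simps)
  from arg_cong[OF this, of "\<lambda>c. - \<i> * c"]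
  have "cip (w1 x) (w1 x) - cip (w2 x) (w2 x) = - \<i> * (z * \<sigma> + cip (w1 x) k - cnj z * \<sigma> - cip k (w1 x))"
    by (simp add: algebra_simps)
  \<comment> \<open>The mixed terms of w1 and k are exactly those that complete the square.\<close>
  then have "cip (k - \<i> *s w1 x) (k - \<i> *s w1 x) - cip (w2 x) (w2 x) = cip k k - \<i> * (z - cnj z) * \<sigma>"
    by (simp add: cip_simps algebra_simps)
  from arg_cong[OF this, of Re]
  have "(norm (k - \<i> *s w1 x))\<^sup>2 - (norm (w2 x))\<^sup>2 = (norm k)\<^sup>2 + 2 * Im z * Re \<sigma>"
    by (simp add: cip_self Im\<sigma>)
  moreover have "0 \<le> 2 * Im z * Re \<sigma>" using z \<sigma>(2) by simp
  ultimately have "(norm (w2 x))\<^sup>2 \<le> (norm (k - \<i> *s w1 x))\<^sup>2"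
    using zero_le_power2[of "norm k"] by linarith
  then have "norm (w2 x) \<le> norm (k - \<i> *s w1 x)" by (rule power2_le_imp_le) simp
  then show ?thesis
    unfolding y1_def y2_def norm_scale_vector by (simp add: mult_left_mono)
qed

lemma y_0: "y1 0 = k - \<i> *s (b\<^sup>\<dagger> *v (matrix_inv X *v q0))" "y2 0 = \<i> *s (c\<^sup>\<dagger> *v (matrix_inv X *v q0))"
  by (simp_all add: y1_def y2_def w1_def w2_def s_def q_def L_0 E1_0 Si_def S_0)

text \<open>The difference of the two sides solves the same homogeneous equation with zero initial
  value, so Gronwall makes it vanish.\<close>

lemma sol_eq_y:
  assumes u: "fundamental_solution pot u" and x: "0 \<le> x"
  shows "u x z *v stack (y1 0) (y2 0) = stack (y1 x) (y2 x)"
proof -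
  interpret bounded_dirac pot u by unfold_locales (use pot_bounded u in auto)
  let ?h = "stack (y1 0) (y2 0)"
  have bl: "bounded_linear (\<lambda>p. stack p (0 :: complex^'m2))" "bounded_linear (\<lambda>p. stack (0 :: complex^'m1) p)"
    unfolding linear_conv_bounded_linear[symmetric]
    by (rule linearI; simp add: stack_def vec_eq_iff split: sum.split)+
  have "prim (\<lambda>x. stack (y1 x) (y2 x)) (\<lambda>t. dirac_rhs pot z t *v stack (y1 t) (y2 t))"
  proof (rule prim_cong[OF prim_add[OF prim_bounded_linear[OF bl(1) y1_prim] prim_bounded_linear[OF bl(2) y2_prim]]])
    show "stack (y1 x) 0 + stack 0 (y2 x) = stack (y1 x) (y2 x)" for x by (simp flip: stack_add)
    show "stack ((\<i> * z) *s y1 t + \<i> *s (pot t *v y2 t)) 0 + stack 0 (- (\<i> * z) *s y2 t - \<i> *s ((pot t)\<^sup>\<dagger> *v y1 t)) =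
        dirac_rhs pot z t *v stack (y1 t) (y2 t)" for t
      by (rule block_vector_eqI) (simp_all add: up_add lo_add dirac_rhs_vector)
  qed
  from prim_diff[OF sol_prim[of z ?h] this]
  have p: "prim (\<lambda>x. u x z *v ?h - stack (y1 x) (y2 x))
      (\<lambda>t. dirac_rhs pot z t *v (u t z *v ?h - stack (y1 t) (y2 t)))"
    by (simp add: matrix_vector_mult_diff_distrib)
  obtain K where K: "\<forall>t\<in>{0..x}. norm (dirac_rhs pot z t) \<le> K"
    using bounded_dirac_rhs[OF pot_bounded[of x], of z] unfolding bounded_iff by auto
  have "u x z *v ?h - stack (y1 x) (y2 x) = 0"
  proof (rule prim_zero[OF p x, where K = K])
    show "norm (dirac_rhs pot z t *v (u t z *v ?h - stack (y1 t) (y2 t))) \<le> K * norm (u t z *v ?h - stack (y1 t) (y2 t))"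
      if "t \<in> {0..x}" for t
      by (rule order_trans[OF norm_matrix_vector_le mult_right_mono]) (use K that in auto)
  qed (simp add: u_0)
  then show ?thesis by simp
qed

end

end

section \<open>Combining existence and uniqueness\<close>

lemma weyl_function_cong:
  assumes "\<And>x. 0 \<le> x \<Longrightarrow> v x = w x"
  shows "weyl_function v \<phi> \<longleftrightarrow> weyl_function w \<phi>"
proof -
  have "locally_summable v \<longleftrightarrow> locally_summable w"
    unfolding locally_summable_def using assms by (intro all_cong1 imp_cong refl set_integrable_cong) auto
  moreover have "fundamental_solution v u \<longleftrightarrow> fundamental_solution w u" for u
  proof -
    have rhs: "dirac_rhs v z t ** u t z = dirac_rhs w z t ** u t z" if "t \<in> {0..x}" for x t z
      using that assms by (simp add: dirac_rhs_def)
    have "(\<lambda>t. dirac_rhs v z t ** u t z) absolutely_integrable_on {0..x} \<longleftrightarrow>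
        (\<lambda>t. dirac_rhs w z t ** u t z) absolutely_integrable_on {0..x}" for x z
      by (intro set_integrable_cong refl rhs)
    moreover have "integral {0..x} (\<lambda>t. dirac_rhs v z t ** u t z) = integral {0..x} (\<lambda>t. dirac_rhs w z t ** u t z)" for x z
      by (rule integral_cong[OF rhs])
    ultimately show ?thesis unfolding fundamental_solution_def by simp
  qed
  ultimately show ?thesis unfolding weyl_function_def by simp
qed

lemma weyl_function_unique_potential:
  assumes v: "measurable_locally_bounded v" "weyl_function v \<phi>"
    and w: "measurable_locally_bounded w" "weyl_function w \<phi>"
  shows "AE x in lebesgue_on {0..}. w x = v x"
proof -
  obtain u1 where u1: "fundamental_solution v u1" "\<forall>z\<in>\<complex>\<^sub>+. (\<Inter>x\<in>{0..}. weyl_set u1 x z) = {\<phi> z}"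
    using v(2) unfolding weyl_function_def by blast
  obtain u2 where u2: "fundamental_solution w u2" "\<forall>z\<in>\<complex>\<^sub>+. (\<Inter>x\<in>{0..}. weyl_set u2 x z) = {\<phi> z}"
    using w(2) unfolding weyl_function_def by blast
  have "\<phi> z \<in> weyl_set u1 x z" "\<phi> z \<in> weyl_set u2 x z" if "z \<in> \<complex>\<^sub>+" "0 \<le> x" for x z
    using u1(2) u2(2) that by blast+
  then interpret dirac_pair v w u1 u2 \<phi>
    by unfold_locales (use u1(1) u2(1) v(1) w(1) in \<open>auto simp: measurable_locally_bounded_def\<close>)
  show ?thesis by (rule potentials_AE_eq)
qed

context gbdt
begin

lemma pot_measurable_locally_bounded:
  assumes "\<And>x. 0 \<le> x \<Longrightarrow> v x = pot x"
  shows "measurable_locally_bounded v"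
  unfolding measurable_locally_bounded_def
proof (intro conjI allI impI)
  have "continuous_on {0..} v"
    by (rule continuous_on_eq[OF pot_continuous]) (simp add: assms)
  then show "v \<in> borel_measurable (lebesgue_on {0..})"
    by (rule continuous_imp_measurable_on_sets_lebesgue) simp
  have "v ` {0..r} = pot ` {0..r}" for r
    by (rule image_cong) (simp_all add: assms)
  then show "bounded (v ` {0..r})" for r using pot_bounded by simp
qed

text \<open>The assumption isolates the algebra at each z: some pair q0, k must make the explicit
  solution start at [g; \<phi>(z) g]. Its energy estimate gives membership in every Weyl set, and
  \<open>weyl_point_unique\<close> excludes other points.\<close>

lemma weyl_function_pot:
  assumes ex: "\<And>z g. z \<in> \<complex>\<^sub>+ \<Longrightarrow> \<exists>q0 k. \<alpha> *v q0 = z *s q0 + b *v k \<and>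
      k - \<i> *s (b\<^sup>\<dagger> *v (matrix_inv X *v q0)) = g \<and> \<i> *s (c\<^sup>\<dagger> *v (matrix_inv X *v q0)) = \<phi> z *v g"
  shows "weyl_function pot \<phi>"
proof -
  obtain u where u: "fundamental_solution pot u"
    using fundamental_solution_exists[OF pot_continuous] by blast
  interpret bounded_dirac pot u by unfold_locales (use pot_bounded u in auto)
  have mem: "\<phi> z \<in> weyl_set u x z" if z: "z \<in> \<complex>\<^sub>+" and x: "0 \<le> x" for x z
  proof (rule weyl_setI[OF x])
    fix g
    obtain q0 k where q0: "\<alpha> *v q0 = z *s q0 + b *v k"
      and eq: "k - \<i> *s (b\<^sup>\<dagger> *v (matrix_inv X *v q0)) = g" "\<i> *s (c\<^sup>\<dagger> *v (matrix_inv X *v q0)) = \<phi> z *v g"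
      using ex[OF z] by blast
    have "u x z *v stack g (\<phi> z *v g) = stack (y1 z q0 k x) (y2 z q0 x)"
      using sol_eq_y[OF q0 u x] by (simp add: y_0[OF q0] eq)
    then show "norm (lo (u x z *v stack g (\<phi> z *v g))) \<le> norm (up (u x z *v stack g (\<phi> z *v g)))"
      using y_energy[OF q0 x] z by (simp add: upper_half_plane_def)
  qed
  have "(\<Inter>x\<in>{0..}. weyl_set u x z) = {\<phi> z}" if z: "z \<in> \<complex>\<^sub>+" for z
  proof (intro equalityI subsetI)
    fix \<Psi> assume \<Psi>: "\<Psi> \<in> (\<Inter>x\<in>{0..}. weyl_set u x z)"
    have "\<Psi> = \<phi> z"
      by (rule weyl_point_unique[OF z _ mem[OF z]]) (use \<Psi> in simp_all)
    then show "\<Psi> \<in> {\<phi> z}" by simp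
  qed (simp add: mem[OF z])
  moreover have "pot absolutely_integrable_on {0..r}" for r
    using absolutely_integrable_continuous[of 0 r pot] continuous_on_subset[OF pot_continuous, of "{0..r}"]
    by (auto simp: cbox_interval)
  ultimately show ?thesis
    using u unfolding weyl_function_def locally_summable_def by blast
qed

end

text \<open>An eigenvector \<open>f\<close> for an eigenvalue in the upper half-plane is excluded by evaluating the
  quadratic form of the Riccati equation at \<open>X\<^sup>-\<^sup>1 f\<close>.\<close>

lemma riccati_resolvent_invertible:
  fixes A X :: "complex^'n^'n" and B :: "complex^'m1^'n" and C :: "complex^'n^'m2"
  assumes X: "pos_def X" and z: "z \<in> \<complex>\<^sub>+"
    and ric: "X ** C\<^sup>\<dagger> ** C ** X + \<i> *\<^sub>m (X ** A\<^sup>\<dagger> - A ** X) + B ** B\<^sup>\<dagger> = 0"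
  shows "invertible (mat z - A)"
proof (rule invertible_if_injective)
  fix f assume "(mat z - A) *v f = 0"
  then have Af: "A *v f = z *s f" by (simp add: matrix_vector_mult_diff_rdistrib mat_vector)
  define w where "w = matrix_inv X *v f"
  have Xw: "X *v w = f"
    by (simp add: w_def matrix_vector_mul_assoc matrix_inv_left_right[OF pos_def_invertible[OF X]])
  have Xh: "X\<^sup>\<dagger> = X" using X by (simp add: pos_def_def)
  define \<sigma> where "\<sigma> = cip w f"
  have "cnj \<sigma> = cip f w" by (simp add: \<sigma>_def cip_cnj)
  also have "\<dots> = \<sigma>" using cip_adjoint[of X w w] by (simp add: Xh Xw \<sigma>_def)
  finally have \<sigma>: "cnj \<sigma> = \<sigma>" .
  have "cip w ((X ** C\<^sup>\<dagger> ** C ** X + \<i> *\<^sub>m (X ** A\<^sup>\<dagger> - A ** X) + B ** B\<^sup>\<dagger>) *v w) = 0"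
    unfolding ric by simp
  moreover have Xadj: "cip w (X *v y) = cip f y" for y
    using cip_adjoint[of X w y] by (simp add: Xh Xw)
  moreover have "cip w (X *v (C\<^sup>\<dagger> *v (C *v f))) = cip (C *v f) (C *v f)"
    unfolding Xadj by (rule cip_adjoint')
  moreover have "cip w (X *v (A\<^sup>\<dagger> *v w)) = cnj z * \<sigma>"
    unfolding Xadj using cip_cnj[of w f] by (simp add: cip_adjoint' Af cip_simps \<sigma> flip: \<sigma>_def)
  ultimately have "cip (C *v f) (C *v f) + \<i> * (cnj z * \<sigma> - z * \<sigma>) + cip (B\<^sup>\<dagger> *v w) (B\<^sup>\<dagger> *v w) = 0"
    by (simp add: matrix_vector_mult_add_rdistrib matrix_vector_mult_diff_rdistrib mat_scale_vector Xw Af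
        cip_simps cip_adjoint right_diff_distrib mult.assoc flip: matrix_vector_mul_assoc \<sigma>_def)
  from arg_cong[OF this, of Re]
  \<comment> \<open>With \<sigma> the value of the form of X at w, all three summands are
    nonnegative, and the last is positive unless w = 0.\<close>
  have "(norm (C *v f))\<^sup>2 + (norm (B\<^sup>\<dagger> *v w))\<^sup>2 + 2 * Im z * Re \<sigma> = 0"
    using \<sigma> by (simp add: cip_self algebra_simps)
  moreover have "0 < Im z" using z by (simp add: upper_half_plane_def)
  moreover have "0 < Re \<sigma>" if "w \<noteq> 0"
    using X that Xw unfolding pos_def_def quad_form_cip \<sigma>_def by metis
  ultimately have "w = 0"
    by (smt (verit) mult_pos_pos zero_le_power2)
  then show "f = 0" using Xw by simp
qed

theorem theorem3p4:
  fixes \<phi> :: "complex \<Rightarrow> complex^'m1^'m2"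
    and C :: "complex^'n^'m2" and A :: "complex^'n^'n" and B :: "complex^'m1^'n"
    and X \<alpha> \<Sigma>\<^sub>0 :: "complex^'n^'n"
    and \<theta>\<^sub>1 :: "complex^'m1^'n" and \<theta>\<^sub>2 :: "complex^'m2^'n"
    and \<Lambda> :: "real \<Rightarrow> complex^('m1 + 'm2)^'n"
    and \<Sigma> :: "real \<Rightarrow> complex^'n^'n"
    and v :: "real \<Rightarrow> complex^'m2^'m1"
  assumes "rational_matrix_function \<phi>"
    and "strictly_proper \<phi>"
    and "nonexpansive_on_reals \<phi>"
    and "no_poles_in_upper_half_plane \<phi>"
    and "minimal_realization \<phi> C A B"
    and "pos_def X"
    and "X ** C\<^sup>\<dagger> ** C ** X + \<i> *\<^sub>m (X ** A\<^sup>\<dagger> - A ** X) + B ** B\<^sup>\<dagger> = 0"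
    and "\<alpha> = A + \<i> *\<^sub>m (B ** B\<^sup>\<dagger> ** matrix_inv X)"
    and "\<Sigma>\<^sub>0 = X"
    and "\<theta>\<^sub>1 = B"
    and "\<theta>\<^sub>2 = (- \<i>) *\<^sub>m (X ** C\<^sup>\<dagger>)"
    and "\<And>x. x \<ge> 0 \<Longrightarrow> \<Lambda> x =
           block_row (mat_exp ((- \<i> * of_real x) *\<^sub>m \<alpha>) ** \<theta>\<^sub>1) (mat_exp ((\<i> * of_real x) *\<^sub>m \<alpha>) ** \<theta>\<^sub>2)"
    and "\<And>x. x \<ge> 0 \<Longrightarrow> \<Sigma> x = \<Sigma>\<^sub>0 + integral {0..x} (\<lambda>t. \<Lambda> t ** (\<Lambda> t)\<^sup>\<dagger>)"
    and "\<And>x. x \<ge> 0 \<Longrightarrow> v x =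
           (- 2 * \<i>) *\<^sub>m (\<theta>\<^sub>1\<^sup>\<dagger> ** mat_exp ((\<i> * of_real x) *\<^sub>m \<alpha>\<^sup>\<dagger>) ** matrix_inv (\<Sigma> x)
             ** mat_exp ((\<i> * of_real x) *\<^sub>m \<alpha>) ** \<theta>\<^sub>2)"
  shows "weyl_function v \<phi> \<and> measurable_locally_bounded v \<and>
    (\<forall>w. measurable_locally_bounded w \<and> weyl_function w \<phi> \<longrightarrow>
         (AE x in lebesgue_on {0..}. w x = v x))"
proof -
  note X = assms(6) and ric = assms(7) and \<alpha> = assms(8) and \<theta>\<^sub>1 = assms(10) and \<theta>\<^sub>2 = assms(11)
  have Xh: "X\<^sup>\<dagger> = X" using X by (simp add: pos_def_def)
  note Xinv = matrix_inv_left_right[OF pos_def_invertible[OF X]]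
  have Xih: "(matrix_inv X)\<^sup>\<dagger> = matrix_inv X"
  proof -
    have "(matrix_inv X)\<^sup>\<dagger> ** X = mat 1"
      using arg_cong[OF Xinv(1), of cadjoint] by (simp add: cadjoint_mult Xh cadjoint_mat)
    from matrix_inv_unique(2)[OF this] show ?thesis by simp
  qed
  have XiX: "matrix_inv X *v (X *v h) = h" "X *v (matrix_inv X *v h) = h" for h
    by (simp_all add: matrix_vector_mul_assoc Xinv)
  \<comment> \<open>The shift adds 2 \<i> B B\<dagger> to A X - X A\<dagger>, which by the Riccati
    equation equals - \<i> (X C\<dagger> C X + B B\<dagger>). The sum is \<i> (B B\<dagger> - X
    C\<dagger> C X).\<close>
  have "\<alpha> ** X - X ** \<alpha>\<^sup>\<dagger> = \<i> *\<^sub>m (\<theta>\<^sub>1 ** \<theta>\<^sub>1\<^sup>\<dagger> - \<theta>\<^sub>2 ** \<theta>\<^sub>2\<^sup>\<dagger>)"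
  proof (rule matrix_eqI)
    fix h
    have "(X ** C\<^sup>\<dagger> ** C ** X + \<i> *\<^sub>m (X ** A\<^sup>\<dagger> - A ** X) + B ** B\<^sup>\<dagger>) *v h = 0"
      unfolding ric by simp
    then have "\<i> *s (X *v (A\<^sup>\<dagger> *v h) - A *v (X *v h)) =
        - (X *v (C\<^sup>\<dagger> *v (C *v (X *v h)))) - B *v (B\<^sup>\<dagger> *v h)"
      by (simp add: matrix_vector_mult_add_rdistrib matrix_vector_mult_diff_rdistrib mat_scale_vector
          algebra_simps eq_neg_iff_add_eq_0 flip: matrix_vector_mul_assoc)
    from arg_cong[OF this, of "\<lambda>y. \<i> *s y"]
    have "A *v (X *v h) - X *v (A\<^sup>\<dagger> *v h) =
        \<i> *s (- (X *v (C\<^sup>\<dagger> *v (C *v (X *v h)))) - B *v (B\<^sup>\<dagger> *v h))"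
      by (simp add: vec_eq_iff algebra_simps)
    then show "(\<alpha> ** X - X ** \<alpha>\<^sup>\<dagger>) *v h = \<i> *\<^sub>m (\<theta>\<^sub>1 ** \<theta>\<^sub>1\<^sup>\<dagger> - \<theta>\<^sub>2 ** \<theta>\<^sub>2\<^sup>\<dagger>) *v h"
      by (simp add: \<alpha> \<theta>\<^sub>1 \<theta>\<^sub>2 cadjoint_add cadjoint_scale cadjoint_mult Xh Xih XiX vector_scalar_commute vector_minus_mult
          matrix_vector_mult_add_rdistrib matrix_vector_mult_diff_rdistrib mat_scale_vector
          matrix_vector_right_distrib flip: matrix_vector_mul_assoc)
        (simp add: vec_eq_iff vector_scalar_commute vector_minus_mult XiX algebra_simps)
  qed
  then interpret G: gbdt \<alpha> X \<theta>\<^sub>1 \<theta>\<^sub>2 by unfold_locales (rule X)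
  have \<Lambda>\<Lambda>: "\<Lambda> t ** (\<Lambda> t)\<^sup>\<dagger> = G.R t" if "0 \<le> t" for t
    by (simp add: assms(12)[OF that] cadjoint_block_row_gram G.R_def G.L1_def G.L2_def G.E1_def)
  have \<Sigma>: "\<Sigma> x = G.S x" if "0 \<le> x" for x
  proof -
    have "integral {0..x} (\<lambda>t. \<Lambda> t ** (\<Lambda> t)\<^sup>\<dagger>) = integral {0..x} G.R"
      by (rule integral_cong) (simp add: \<Lambda>\<Lambda>)
    then show ?thesis by (simp add: assms(13)[OF that] assms(9) G.S_def)
  qed
  have v: "v x = G.pot x" if "0 \<le> x" for x
  proof -
    have "(G.L1 x)\<^sup>\<dagger> = \<theta>\<^sub>1\<^sup>\<dagger> ** mat_exp ((\<i> * of_real x) *\<^sub>m \<alpha>\<^sup>\<dagger>)"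
      by (simp add: G.L1_def G.E1_def cadjoint_mult cadjoint_mat_exp cadjoint_scale)
    then show ?thesis
      by (simp add: assms(14)[OF that] G.pot_def G.Si_def G.L2_def \<Sigma>[OF that] matrix_mul_assoc)
  qed
  have "weyl_function G.pot \<phi>"
  proof (rule G.weyl_function_pot)
    fix z and g :: "complex^'m1" assume z: "z \<in> \<complex>\<^sub>+"
    have inv: "invertible (mat z - A)" by (rule riccati_resolvent_invertible[OF X z ric])
    \<comment> \<open>The sign appears because the inverse is that of z - A, while q0 has to solve
      (A - z) q0 = B g.\<close>
    define q0 where "q0 = - (matrix_inv (mat z - A) *v (B *v g))"
    define k where "k = g + \<i> *s (B\<^sup>\<dagger> *v (matrix_inv X *v q0))"
    have "(mat z - A) *v (matrix_inv (mat z - A) *v (B *v g)) = B *v g"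
      unfolding matrix_vector_mul_assoc[of "mat z - A"] matrix_inv_left_right[OF inv] by simp
    then have "A *v q0 = z *s q0 + B *v g"
      by (simp add: q0_def vector_minus_mult matrix_vector_mult_diff_rdistrib mat_vector vector_smult_rneg algebra_simps)
    then have 1: "\<alpha> *v q0 = z *s q0 + \<theta>\<^sub>1 *v k"
      by (simp add: \<alpha> \<theta>\<^sub>1 k_def matrix_vector_mult_add_rdistrib mat_scale_vector matrix_vector_right_distrib
          vector_scalar_commute flip: matrix_vector_mul_assoc)
    have 2: "k - \<i> *s (\<theta>\<^sub>1\<^sup>\<dagger> *v (matrix_inv X *v q0)) = g" by (simp add: k_def \<theta>\<^sub>1)
    have "\<phi> z = C ** matrix_inv (mat z - A) ** B"
      using assms(5) inv by (simp add: minimal_realization_def realization_def)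
    \<comment> \<open>The adjoint of \<vartheta>2 times the inverse of X is \<i> C, so the left-hand
      side is - C q0, which is the realization applied to g.\<close>
    then have 3: "\<i> *s (\<theta>\<^sub>2\<^sup>\<dagger> *v (matrix_inv X *v q0)) = \<phi> z *v g"
      by (simp add: \<theta>\<^sub>2 cadjoint_scale cadjoint_mult Xh mat_scale_vector XiX q0_def vector_minus_mult
          vector_smult_assoc vector_smult_rneg flip: matrix_vector_mul_assoc)
    from 1 2 3 show "\<exists>q0 k. \<alpha> *v q0 = z *s q0 + \<theta>\<^sub>1 *v k \<and>
        k - \<i> *s (\<theta>\<^sub>1\<^sup>\<dagger> *v (matrix_inv X *v q0)) = g \<and> \<i> *s (\<theta>\<^sub>2\<^sup>\<dagger> *v (matrix_inv X *v q0)) = \<phi> z *v g"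
      by blast
  qed
  then have weyl: "weyl_function v \<phi>"
    using weyl_function_cong[of v G.pot \<phi>] v by simp
  moreover have mlb: "measurable_locally_bounded v"
    by (rule G.pot_measurable_locally_bounded[OF v])
  ultimately show ?thesis
    using weyl_function_unique_potential[OF mlb weyl] by blast
qed

end
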